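(* Let $A$ be a $C^*$-algebra. Then its Cuntz semigroup $\mathrm{Cu}(A)$ satisfies (O7): for all $x_1',x_1,x_2',x_2,w\in \mathrm{Cu}(A)$ satisfying $$x_1'\ll x_1\leq w \quad\text{and}\quad x_2'\ll x_2\leq w,$$ there exists $x\in \mathrm{Cu}(A)$ such that $x_1'\ll x$, $x_2'\ll x$, $x\leq w$ and $x\leq x_1+x_2$.
   Context: For positive elements $a,b$ in a $C^*$-algebra $B$, write $a\precsim b$ (Cuntz subequivalence) if there is a sequence $(x_n)_n$ in $B$ with $\lim_n\|a-x_nbx_n^*\|=0$, and $a\sim b$ if $a\precsim b$ and $b\precsim a$. The Cuntz semigroup of $A$ is $\mathrm{Cu}(A)=(A\otimes\mathcal K)_+/\!\sim$, where $\mathcal K$ is the algebra of compact operators on $\ell^2(\mathbb N)$. The class of $a$ is denoted $[a]$. It is an ordered commutative monoid with $[a]\leq[b]$ iff $a\precsim b$, and with addition $[a]+[b]=[\mathrm{diag}(a,b)]$ (using an isomorphism $M_2(\mathcal K)\cong\mathcal K$). Every increasing sequence in $\mathrm{Cu}(A)$ has a supremum. For $x,y$ in an ordered set in which increasing sequences have suprema, $x\ll y$ ($x$ is way-below $y$) means: whenever $(y_n)_n$ is an increasing sequence with $y\leq\sup_n y_n$, there is $n_0$ with $x\leq y_{n_0}$. *)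

theory Defs
  imports "HOL-Analysis.Analysis" "HOL-Library.Lub_Glb"
begin

section \<open>C*-algebras\<close>

text \<open>
  Complex scalar multiplication is a new operation, tied to the real one by \<open>scaleR_scaleC\<close>.
  Algebras need not have a unit, and the zero algebra is allowed.
\<close>

class cstar_algebra = real_normed_algebra + complete_space +
  fixes scaleC :: "complex \<Rightarrow> 'a \<Rightarrow> 'a"
    and star :: "'a \<Rightarrow> 'a"
  assumes scaleC_add_right: "scaleC c (x + y) = scaleC c x + scaleC c y"
    and scaleC_add_left: "scaleC (c + d) x = scaleC c x + scaleC d x"
    and scaleC_scaleC: "scaleC c (scaleC d x) = scaleC (c * d) x"
    and scaleR_scaleC: "r *\<^sub>R x = scaleC (of_real r) x"
    and mult_scaleC_left: "scaleC c x * y = scaleC c (x * y)"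
    and mult_scaleC_right: "x * scaleC c y = scaleC c (x * y)"
    and norm_scaleC: "norm (scaleC c x) = cmod c * norm x"
    and star_add: "star (x + y) = star x + star y"
    and star_scaleC: "star (scaleC c x) = scaleC (cnj c) (star x)"
    and star_mult: "star (x * y) = star y * star x"
    and star_star: "star (star x) = x"
    and cstar_identity: "norm (star x * x) = (norm x)\<^sup>2"
begin

subclass banach ..

end


section \<open>The stabilization\<close>

text \<open>
  The tensor product of \<open>A\<close> with the compact operators on \<open>\<ell>\<^sup>2(\<nat>)\<close> is realized as the C*-algebra
  of matrices over \<open>A\<close> indexed by \<open>\<nat> \<times> \<nat>\<close>: the matrix \<open>(a\<^sub>i\<^sub>j)\<close> stands for
  \<open>\<Sum>\<^sub>i\<^sub>j a\<^sub>i\<^sub>j \<otimes> e\<^sub>i\<^sub>j\<close>, where \<open>e\<^sub>i\<^sub>j\<close> are the matrix units.  It is the completion of the union of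
  the algebras \<open>M\<^sub>n(A)\<close>.

  The C*-norm of \<open>M\<^sub>n(A)\<close> (it is unique) is the operator norm for the faithful action
  by matrix multiplication on the right Hilbert module \<open>A\<^sup>n\<close>, whose inner product is
  \<open>\<langle>u, v\<rangle> = \<Sum>\<^sub>i u\<^sub>i\<^sup>* v\<^sub>i\<close>.
\<close>

type_synonym 'a mat = "nat \<Rightarrow> nat \<Rightarrow> 'a"

definition vec_norm :: "nat \<Rightarrow> (nat \<Rightarrow> 'a::cstar_algebra) \<Rightarrow> real" where
  "vec_norm n v = sqrt (norm (\<Sum>i<n. star (v i) * v i))"

text \<open>The C*-norm of the upper left \<open>n \<times> n\<close> corner of a matrix.\<close>

definition corner_norm :: "nat \<Rightarrow> 'a::cstar_algebra mat \<Rightarrow> real" where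
  "corner_norm n a = (SUP v\<in>{v. vec_norm n v \<le> 1}. vec_norm n (\<lambda>i. \<Sum>j<n. a i j * v j))"

text \<open>
  The corner norms increase with \<open>n\<close>.  The matrices with bounded corner norms form a Banach space
  under their supremum, and the stabilization is the closure in it of the finitely supported
  matrices.
\<close>

definition finite_mats :: "'a::cstar_algebra mat set" where
  "finite_mats = {b. \<exists>n. \<forall>i j. n \<le> i \<or> n \<le> j \<longrightarrow> b i j = 0}"

definition stab :: "'a::cstar_algebra mat set" where
  "stab = {a. \<forall>e>0. \<exists>b\<in>finite_mats. \<forall>n. corner_norm n (a - b) \<le> e}"

definition mat_norm :: "'a::cstar_algebra mat \<Rightarrow> real" where
  "mat_norm a = (SUP n. corner_norm n a)"

definition mat_star :: "'a::cstar_algebra mat \<Rightarrow> 'a mat" where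
  "mat_star a = (\<lambda>i j. star (a j i))"

text \<open>The series converge in norm if both factors lie in the stabilization.\<close>

definition mat_mult :: "'a::cstar_algebra mat \<Rightarrow> 'a mat \<Rightarrow> 'a mat" where
  "mat_mult a b = (\<lambda>i j. \<Sum>k. a i k * b k j)"

definition stab_pos :: "'a::cstar_algebra mat set" where
  "stab_pos = {mat_mult (mat_star y) y | y. y \<in> stab}"

text \<open>
  The diagonal sum, brought back from \<open>M\<^sub>2(A \<otimes> K)\<close> to \<open>A \<otimes> K\<close> along the unitary
  \<open>\<ell>\<^sup>2(\<nat>) \<oplus> \<ell>\<^sup>2(\<nat>) \<cong> \<ell>\<^sup>2(\<nat>)\<close> that sends the two standard bases to the basis vectors of even and of
  odd index.
\<close>

definition mat_diag :: "'a::cstar_algebra mat \<Rightarrow> 'a mat \<Rightarrow> 'a mat" where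
  "mat_diag a b = (\<lambda>i j.
     if even i \<and> even j then a (i div 2) (j div 2)
     else if odd i \<and> odd j then b (i div 2) (j div 2)
     else 0)"


section \<open>The Cuntz semigroup\<close>

definition cuntz_le :: "'a::cstar_algebra mat \<Rightarrow> 'a mat \<Rightarrow> bool" where
  "cuntz_le a b \<longleftrightarrow> (\<exists>x. (\<forall>n. x n \<in> stab) \<and>
     (\<lambda>n. mat_norm (a - mat_mult (mat_mult (x n) b) (mat_star (x n)))) \<longlonglongrightarrow> 0)"

definition cuntz_rel :: "('a::cstar_algebra mat \<times> 'a mat) set" where
  "cuntz_rel = {(a, b). a \<in> stab_pos \<and> b \<in> stab_pos \<and> cuntz_le a b \<and> cuntz_le b a}"

lemma zero_in_stab_pos: "(\<lambda>_ _. 0) \<in> (stab_pos :: 'a::cstar_algebra mat set)"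
proof -
  let ?z = "(\<lambda>_ _. 0) :: 'a mat"
  have v0: "vec_norm n (\<lambda>_. 0 :: 'a) = 0" for n
    by (simp add: vec_norm_def)
  have ne: "{v :: nat \<Rightarrow> 'a. vec_norm n v \<le> 1} \<noteq> {}" for n
  proof -
    have "(\<lambda>_. 0) \<in> {v :: nat \<Rightarrow> 'a. vec_norm n v \<le> 1}"
      unfolding mem_Collect_eq v0 by simp
    then show ?thesis by blast
  qed
  have d: "?z - ?z = ?z"
    by (simp add: fun_eq_iff)
  have c0: "corner_norm n (?z - ?z) = 0" for n
    unfolding d corner_norm_def mult_zero_left sum.neutral_const v0
    by (rule cSUP_const[OF ne])
  have fin: "?z \<in> finite_mats"
    by (simp add: finite_mats_def)
  have z: "?z \<in> stab"
    unfolding stab_def mem_Collect_eq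
  proof (intro allI impI)
    fix e :: real
    assume "e > 0"
    then have "\<forall>n. corner_norm n (?z - ?z) \<le> e"
      unfolding c0 by simp
    then show "\<exists>b\<in>finite_mats. \<forall>n. corner_norm n (?z - b) \<le> e"
      using fin by (rule bexI[where x = ?z])
  qed
  have "?z = mat_mult (mat_star ?z) ?z"
    by (simp add: mat_mult_def)
  with z have "\<exists>y. ?z = mat_mult (mat_star y) y \<and> y \<in> stab"
    by (intro exI[where x = ?z] conjI)
  then show ?thesis
    unfolding stab_pos_def mem_Collect_eq .
qed

typedef (overloaded) 'a cu = "(stab_pos :: 'a::cstar_algebra mat set) // cuntz_rel"
  by (rule exI, rule quotientI, rule zero_in_stab_pos)

definition cu_class :: "'a::cstar_algebra mat \<Rightarrow> 'a cu" where
  "cu_class a = Abs_cu (cuntz_rel `` {a})"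

definition cu_rep :: "'a::cstar_algebra cu \<Rightarrow> 'a mat" where
  "cu_rep x = (SOME a. a \<in> Rep_cu x)"

text \<open>Order and addition do not depend on the chosen representatives.\<close>

instantiation cu :: (cstar_algebra) "{ord, plus}"
begin

definition less_eq_cu :: "'a cu \<Rightarrow> 'a cu \<Rightarrow> bool" where
  "x \<le> y \<longleftrightarrow> cuntz_le (cu_rep x) (cu_rep y)"

definition less_cu :: "'a cu \<Rightarrow> 'a cu \<Rightarrow> bool" where
  "x < y \<longleftrightarrow> x \<le> y \<and> \<not> y \<le> (x :: 'a cu)"

definition plus_cu :: "'a cu \<Rightarrow> 'a cu \<Rightarrow> 'a cu" where
  "x + y = cu_class (mat_diag (cu_rep x) (cu_rep y))"

instance ..

end


section \<open>The way-below relation\<close>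

definition way_below :: "'b::ord \<Rightarrow> 'b \<Rightarrow> bool" (infix "\<lless>" 50) where
  "x \<lless> y \<longleftrightarrow> (\<forall>z s. (\<forall>n::nat. z n \<le> z (Suc n)) \<and> isLub UNIV (range z) s \<and> y \<le> s
     \<longrightarrow> (\<exists>n. x \<le> z n))"

end

theory Submission
  imports Defs
begin

text \<open>
  Let \<open>a\<^sub>i\<close> and \<open>c\<close> represent \<open>x\<^sub>i\<close> and \<open>w\<close>. Some cut-down \<open>(a\<^sub>i - e)\<^sub>+\<close> still dominates \<open>x\<^sub>i'\<close>, and since
  \<open>a\<^sub>i \<precsim> c\<close> there is \<open>z\<^sub>i c z\<^sub>i\<^sup>* \<precsim> a\<^sub>i\<close> close to \<open>a\<^sub>i\<close>, hence dominating \<open>(a\<^sub>i - e)\<^sub>+\<close> along with all its neighbours.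
  With \<open>W\<close> the column of \<open>z\<^sub>1\<close> and \<open>z\<^sub>2\<close>, the class \<open>x\<close> of \<open>W c W\<^sup>*\<close> does the job: its diagonal blocks are the
  \<open>z\<^sub>i c z\<^sub>i\<^sup>*\<close>, it lies below \<open>w\<close> by construction, and \<open>W c W\<^sup>* \<sim> c\<^bsup>1/2\<^esup> (z\<^sub>1\<^sup>*z\<^sub>1 + z\<^sub>2\<^sup>*z\<^sub>2) c\<^bsup>1/2\<^esup> \<precsim> a\<^sub>1 \<oplus> a\<^sub>2\<close>.

  That a norm neighbourhood suffices for the way-below relation rests on a concrete upper bound of an
  increasing sequence \<open>[b\<^sub>n]\<close>: the Gram matrix of vectors representing the \<open>b\<^sub>n\<close> in the inductive limit of the
  Hilbert modules, scaled so as to converge. Every element of the limit module comes from a finite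
  stage, so every approximation of the Gram matrix by a corner is dominated by some \<open>b\<^sub>n\<close>.

  The functional calculus is obtained without spectra. A self-adjoint contraction \<open>h\<close> is the real part of
  a unitary multiplier \<open>h + i\<surd>(1 - h\<^sup>2)\<close>, which bounds the Chebyshev polynomials of \<open>h\<close>. Hence \<open>\<parallel>p(h)\<parallel>\<close> is at most
  \<open>sup \<bar>p\<bar>\<close> times a factor linear in the degree, and applying this to powers of \<open>p\<close> removes the factor.
\<close>


section \<open>Functional calculus for self-adjoint elements\<close>

text \<open>Cuntz comparison yields approximations only, whereas \<open>x\<close> has to lie below
  \<open>w\<close> exactly and way above both \<open>x1'\<close> and \<open>x2'\<close>. This is why
  the representatives are first replaced by elements of the exact form
  \<open>z * c * star z\<close>: two of these combine into a single column \<open>W\<close>, with no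
  control over the off-diagonal blocks of \<open>W * c * star W\<close>. Compression shows that a
  block is Cuntz below the whole, so way-belowness is carried by the blocks, as a norm ball around
  each, and is inherited upwards. Operator inequalities enter the comparison through one device:
  roots of positive \<open>p\<close> and \<open>q\<close> are stacked into a column \<open>v\<close>
  with \<open>star v * v = p + q\<close>, and \<open>v * star v\<close> has a corner equivalent to
  \<open>p\<close>. This ties the comparison results to the stabilization, where there is room for
  columns. Positivity of sums and limits rests on contractivity of \<open>1 - m\<close>, a condition
  that survives averages and limits.\<close>

abbreviation mult_ii :: "'a::cstar_algebra \<Rightarrow> 'a" where
  "mult_ii \<equiv> scaleC \<i>"

section \<open>Rules for the involution and for complex scalars\<close>

lemma star_zero [simp]: "star (0::'a::cstar_algebra) = 0"
  using star_add[of "0::'a" 0] by simp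

lemma star_minus: "star (- x) = - star (x::'a::cstar_algebra)"
proof -
  have "star (- x) + star x = star (- x + x)"
    by (simp only: star_add)
  then show ?thesis
    by (simp add: eq_neg_iff_add_eq_0)
qed

lemma star_diff: "star (x - y) = star x - star (y::'a::cstar_algebra)"
  using star_add[of x "- y"] star_minus[of y] by simp

lemma star_scaleR: "star (r *\<^sub>R x) = r *\<^sub>R star (x::'a::cstar_algebra)"
  by (simp add: scaleR_scaleC star_scaleC)

lemma star_sum: "star (sum f A) = (\<Sum>i\<in>A. star (f i :: 'a::cstar_algebra))"
  by (induction A rule: infinite_finite_induct) (simp_all add: star_add)

lemma norm_star [simp]: "norm (star x) = norm (x::'a::cstar_algebra)"
proof -
  have le: "norm y \<le> norm (star y)" for y :: 'a
  proof (cases "norm y = 0")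
    case False
    have "norm y * norm y \<le> norm (star y) * norm y"
      using norm_mult_ineq[of "star y" y] cstar_identity[of y] by (simp add: power2_eq_square)
    then show ?thesis
      using False by simp
  qed simp
  show ?thesis
    using le[of x] le[of "star x"] by (simp add: star_star)
qed

lemma norm_mult_star: "norm (x * star x) = (norm (x::'a::cstar_algebra))\<^sup>2"
  using cstar_identity[of "star x"] by (simp add: star_star)

lemma norm_square_selfadjoint: "star x = x \<Longrightarrow> norm (x * x) = (norm (x::'a::cstar_algebra))\<^sup>2"
  using cstar_identity[of x] by simp

lemma bounded_linear_star: "bounded_linear (star :: 'a::cstar_algebra \<Rightarrow> 'a)"
  by (rule bounded_linear_intro[where K = 1]) (simp_all add: star_add star_scaleR)

lemmas tendsto_star = bounded_linear.tendsto[OF bounded_linear_star]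

lemma scaleC_zero_right [simp]: "scaleC c 0 = (0::'a::cstar_algebra)"
  using scaleC_add_right[of c "0::'a" 0] by simp

lemma scaleC_diff_right: "scaleC c (x - y) = scaleC c x - scaleC c (y::'a::cstar_algebra)"
  by (metis add_diff_cancel diff_add_cancel scaleC_add_right)

lemma scaleC_sum_right: "scaleC c (\<Sum>i\<in>A. f i) = (\<Sum>i\<in>A. scaleC c (f i :: 'a::cstar_algebra))"
  by (induction A rule: infinite_finite_induct) (simp_all add: scaleC_add_right)

lemma mult_ii_mult_ii: "mult_ii (mult_ii x) = - (x::'a::cstar_algebra)"
proof -
  have "mult_ii (mult_ii x) = (- 1) *\<^sub>R x"
    by (simp add: scaleC_scaleC scaleR_scaleC)
  then show ?thesis
    by simp
qed

lemma star_mult_ii: "star (mult_ii x) = - mult_ii (star (x::'a::cstar_algebra))"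
proof -
  have "scaleC (- \<i>) y = - mult_ii y" for y :: 'a
    using scaleC_add_left[of "- \<i>" \<i> y] scaleR_scaleC[of 0 y]
    by (simp add: eq_neg_iff_add_eq_0)
  then show ?thesis
    by (simp add: star_scaleC)
qed

lemma mult_ii_scaleR: "mult_ii (r *\<^sub>R x) = r *\<^sub>R mult_ii (x::'a::cstar_algebra)"
  by (simp add: scaleR_scaleC scaleC_scaleC mult.commute)

lemmas mult_ii_simps = mult_ii_mult_ii scaleC_add_right scaleC_diff_right star_mult_ii mult_ii_scaleR
  mult_scaleC_left mult_scaleC_right

text \<open>There need not be a unit, so \<open>p(h)\<close> is taken as a left multiplier, with constants acting as scalars.\<close>

definition lact :: "real poly \<Rightarrow> 'a::cstar_algebra \<Rightarrow> 'a \<Rightarrow> 'a" where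
  "lact p h x = fold_coeffs (\<lambda>c y. c *\<^sub>R x + h * y) p 0"

section \<open>Polynomials of a self-adjoint element as left multipliers\<close>

lemma lact_0 [simp]: "lact 0 h x = 0"
  by (simp add: lact_def)

lemma lact_pCons [simp]: "lact (pCons c p) h x = c *\<^sub>R x + h * lact p h x"
  by (cases "p = 0 \<and> c = 0") (auto simp: lact_def)

lemma lact_1 [simp]: "lact 1 h x = x"
  by (simp add: one_pCons)

lemma lact_add: "lact (p + q) h x = lact p h x + lact q h x"
  by (induction p q rule: poly_induct2) (simp_all add: algebra_simps)

lemma lact_smult: "lact (smult c p) h x = c *\<^sub>R lact p h x"
  by (induction p) (simp_all add: algebra_simps)

lemma lact_diff: "lact (p - q) h x = lact p h x - lact q h x"
  using lact_add[of "p - q" q h x] by simp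

lemma lact_sum: "lact (sum f A) h x = (\<Sum>i\<in>A. lact (f i) h x)"
  by (induction A rule: infinite_finite_induct) (simp_all add: lact_add)

lemma lact_arg_zero [simp]: "lact p h 0 = 0"
  by (induction p) simp_all

lemma lact_arg_mult: "lact p h (x * y) = lact p h x * y"
  by (induction p) (simp_all add: algebra_simps)

lemma lact_mult: "lact (p * q) h x = lact p h (lact q h x)"
  by (induction p) (simp_all add: lact_add lact_smult)

lemma lact_commute: "h * lact p h x = lact p h (h * x)"
proof -
  have "lact ([:0, 1:] * p) h x = lact (p * [:0, 1:]) h x"
    by (simp only: mult.commute)
  then show ?thesis
    unfolding lact_mult by simp
qed

lemma lact_intertwine:
  assumes "z * h2 = h1 * z"
  shows "z * lact p h2 x = lact p h1 (z * x)"
proof (induction p)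
  case (pCons c p)
  have "z * (h2 * lact p h2 x) = h1 * (z * lact p h2 x)"
    by (simp only: mult.assoc[symmetric] assms)
  then show ?case
    using pCons.IH by (simp add: algebra_simps)
qed simp

text \<open>Real coefficients make the multiplier \<open>lact p h\<close> self-adjoint. Its adjoint
  is not an element that could be named, so this is expressed by moving it across a product.\<close>

lemma star_lact:
  assumes "star h = h"
  shows "star (lact p h x) * y = star x * lact p h y"
proof (induction p arbitrary: y)
  case (pCons c p)
  have "star (h * lact p h x) * y = star (lact p h x) * (h * y)"
    by (simp add: star_mult assms mult.assoc)
  then show ?case
    using pCons.IH[of "h * y"] by (simp add: star_add star_scaleR algebra_simps lact_commute)
qed simp

lemma lact_pcompose: "lact (pcompose p [:0, r:]) h x = lact p (r *\<^sub>R h) x"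
  by (induction p) (simp_all add: pcompose_pCons lact_add lact_smult)

text \<open>The C*-identity for a multiplier: \<open>p\<close> is traded for \<open>p * p\<close> at
  the price of one factor \<open>norm x\<close>. Iteration reaches the powers
  \<open>p ^ (2 ^ k)\<close>.\<close>

lemma norm_lact_square:
  assumes "star h = h"
  shows "(norm (lact p h x))\<^sup>2 \<le> norm x * norm (lact (p * p) h x)"
proof -
  have "(norm (lact p h x))\<^sup>2 = norm (star (lact p h x) * lact p h x)"
    by (simp add: cstar_identity)
  also have "\<dots> = norm (star x * lact (p * p) h x)"
    by (simp add: star_lact[OF assms] lact_mult)
  also have "\<dots> \<le> norm x * norm (lact (p * p) h x)"
    using norm_mult_ineq[of "star x"] by simp
  finally show ?thesis .
qed


subsection \<open>The bound of von Neumann\<close>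

text \<open>
  The iteration \<open>Q \<mapsto> (z + Q\<^sup>2) / 2\<close> converges to \<open>1 - \<surd>(1 - z)\<close>; it is dominated by the same iteration
  for the scalar \<open>1\<close>.
\<close>

primrec sqrt_iter :: "'a::cstar_algebra \<Rightarrow> nat \<Rightarrow> 'a" where
  "sqrt_iter z 0 = 0"
| "sqrt_iter z (Suc n) = (1/2) *\<^sub>R (z + sqrt_iter z n * sqrt_iter z n)"

primrec scalar_iter :: "nat \<Rightarrow> real" where
  "scalar_iter 0 = 0"
| "scalar_iter (Suc n) = (1 + scalar_iter n * scalar_iter n) / 2"

lemma scalar_iter_bounds: "0 \<le> scalar_iter n \<and> scalar_iter n \<le> 1"
proof (induction n)
  case (Suc n)
  then have "scalar_iter n * scalar_iter n \<le> 1"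
    by (simp add: mult_le_one)
  then show ?case
    using Suc by simp
qed simp

lemma norm_sqrt_iter_le:
  assumes "norm z \<le> 1"
  shows "norm (sqrt_iter z n) \<le> scalar_iter n"
proof (induction n)
  case (Suc n)
  have "norm (sqrt_iter z n * sqrt_iter z n) \<le> scalar_iter n * scalar_iter n"
    using Suc scalar_iter_bounds by (intro order_trans[OF norm_mult_ineq] mult_mono) auto
  then have "norm (z + sqrt_iter z n * sqrt_iter z n) \<le> 1 + scalar_iter n * scalar_iter n"
    using assms by (intro norm_triangle_le) simp
  then show ?case
    by simp
qed simp

lemma norm_sqrt_iter_diff_le:
  assumes "norm z \<le> 1"
  shows "norm (sqrt_iter z (Suc n) - sqrt_iter z n) \<le> scalar_iter (Suc n) - scalar_iter n"
proof (induction n)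
  case 0
  then show ?case
    using assms by simp
next
  case (Suc n)
  let ?q = "sqrt_iter z" and ?r = "scalar_iter"
  \<comment> \<open>This splitting of \<open>a * a - b * b\<close> holds without commutativity and
    has the same shape as for scalars.\<close>
  have "(1/2) *\<^sub>R (z + a * a) - (1/2) *\<^sub>R (z + b * b) = (1/2) *\<^sub>R (a * (a - b) + (a - b) * b)" for a b
    by (simp add: algebra_simps)
  from this[of "?q (Suc n)" "?q n"] have "?q (Suc (Suc n)) - ?q (Suc n)
      = (1/2) *\<^sub>R (?q (Suc n) * (?q (Suc n) - ?q n) + (?q (Suc n) - ?q n) * ?q n)"
    by simp
  also have "norm \<dots> \<le> (1/2) * (norm (?q (Suc n)) * norm (?q (Suc n) - ?q n)
      + norm (?q (Suc n) - ?q n) * norm (?q n))"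
    by (simp del: sqrt_iter.simps)
      (intro norm_triangle_le add_mono norm_mult_ineq)
  also have "\<dots> \<le> (1/2) * (?r (Suc n) * (?r (Suc n) - ?r n) + (?r (Suc n) - ?r n) * ?r n)"
    using Suc norm_sqrt_iter_le[OF assms] order_trans[OF norm_ge_zero Suc]
    by (intro mult_left_mono add_mono mult_mono) (use scalar_iter_bounds in \<open>auto simp del: sqrt_iter.simps scalar_iter.simps\<close>)
  also have "\<dots> = ?r (Suc (Suc n)) - ?r (Suc n)"
    by (simp add: field_simps)
  finally show ?case .
qed

text \<open>\<open>Q\<close> stands for \<open>1 - sqrt (1 - z)\<close>: the equation is
  \<open>(1 - Q)^2 = 1 - z\<close> with the unit multiplied out. As \<open>norm z = 1\<close> is
  allowed, no geometric series controls the iteration; its increments are summable because the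
  scalar iteration is increasing and bounded. Being a limit of polynomials in \<open>z\<close>,
  \<open>Q\<close> commutes with whatever commutes with \<open>z\<close>.\<close>

lemma sqrt_complement_exists:
  fixes z :: "'a::cstar_algebra"
  assumes "norm z \<le> 1" and "star z = z"
  obtains Q where "star Q = Q" and "2 *\<^sub>R Q = z + Q * Q"
    and "\<And>y. y * z = z * y \<Longrightarrow> y * Q = Q * y"
proof -
  let ?q = "sqrt_iter z" and ?r = "scalar_iter"
  have "incseq ?r"
    by (rule incseq_SucI) (use order_trans[OF norm_ge_zero norm_sqrt_iter_diff_le[OF assms(1)]] in force)
  then obtain l where l: "?r \<longlonglongrightarrow> l"
    using incseq_convergent[of ?r 1] scalar_iter_bounds by metis
  have diff: "norm (?q (m + k) - ?q m) \<le> ?r (m + k) - ?r m" for m k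
  proof (induction k)
    case (Suc k)
    have "norm (?q (Suc (m + k)) - ?q m) \<le> norm (?q (Suc (m + k)) - ?q (m + k)) + norm (?q (m + k) - ?q m)"
      using norm_triangle_ineq[of "?q (Suc (m + k)) - ?q (m + k)" "?q (m + k) - ?q m"]
      by (simp del: sqrt_iter.simps)
    then show ?case
      using Suc norm_sqrt_iter_diff_le[OF assms(1), of "m + k"] by simp
  qed simp
  have "Cauchy ?q"
  proof (rule CauchyI')
    fix e :: real
    assume "e > 0"
    with l obtain M where M: "\<And>n. n \<ge> M \<Longrightarrow> norm (?r n - l) < e/2"
      by (meson LIMSEQ_iff half_gt_zero)
    have "dist (?q m) (?q n) < e" if "m \<ge> M" "n > m" for m n
    proof -
      have "norm (?q n - ?q m) \<le> ?r n - ?r m"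
        using diff[of m "n - m"] that by simp
      also have "\<dots> < e"
        using M[of m] M[of n] that by (simp add: abs_real_def split: if_splits)
      finally show ?thesis
        by (simp add: dist_norm norm_minus_commute)
    qed
    then show "\<exists>M. \<forall>m\<ge>M. \<forall>n>m. dist (?q m) (?q n) < e"
      by blast
  qed
  then obtain Q where Q: "?q \<longlonglongrightarrow> Q"
    using Cauchy_convergent convergentD by blast
  have s: "star (?q n) = ?q n" for n
    by (induction n) (simp_all add: star_scaleR star_add star_mult assms)
  show thesis
  proof (rule that[of Q])
    show "star Q = Q"
      using tendsto_star[OF Q] Q by (simp add: s LIMSEQ_unique)
    have "(\<lambda>n. 2 *\<^sub>R ?q (Suc n)) \<longlonglongrightarrow> z + Q * Q"
      unfolding sqrt_iter.simps by (simp, intro tendsto_intros Q)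
    moreover have "(\<lambda>n. 2 *\<^sub>R ?q (Suc n)) \<longlonglongrightarrow> 2 *\<^sub>R Q"
      by (intro tendsto_intros LIMSEQ_Suc Q)
    ultimately show "2 *\<^sub>R Q = z + Q * Q"
      using LIMSEQ_unique by blast
    show "y * Q = Q * y" if c: "y * z = z * y" for y
    proof -
      have "y * ?q n = ?q n * y" for n
      proof (induction n)
        case (Suc n)
        have "y * (?q n * ?q n) = ?q n * ?q n * y"
          by (metis Suc mult.assoc)
        then show ?case
          by (simp add: c algebra_simps)
      qed simp
      moreover have "(\<lambda>n. y * ?q n) \<longlonglongrightarrow> y * Q" "(\<lambda>n. ?q n * y) \<longlonglongrightarrow> Q * y"
        by (intro tendsto_intros Q)+
      ultimately show ?thesis
        using LIMSEQ_unique by auto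
    qed
  qed
qed

section \<open>Chebyshev polynomials and cosine integrals\<close>

fun cheb :: "nat \<Rightarrow> real poly" where
  "cheb 0 = 1"
| "cheb (Suc 0) = [:0, 1:]"
| "cheb (Suc (Suc n)) = pCons 0 (smult 2 (cheb (Suc n))) - cheb n"

lemma poly_cheb: "poly (cheb n) (cos t) = cos (real n * t)"
proof (induction n rule: cheb.induct)
  case (3 n)
  have "cos ((real n + 2) * t) + cos (real n * t) = 2 * cos t * cos ((real n + 1) * t)"
    by (simp add: cos_plus_cos) (simp add: algebra_simps add_divide_distrib diff_divide_distrib)
  then show ?case
    using 3 by (simp add: algebra_simps)
qed simp_all

lemma coeff_cheb: "(m > n \<longrightarrow> coeff (cheb n) m = 0) \<and> coeff (cheb n) n > 0"
proof (induction n arbitrary: m rule: cheb.induct)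
  case (3 n)
  then show ?case
    by (cases m) auto
next
  case 2
  then show ?case
    by (cases m) (auto simp: coeff_pCons split: nat.splits)
qed auto

lemma poly_eq_sum_cheb:
  assumes "degree q \<le> n"
  shows "\<exists>c. q = (\<Sum>j\<le>n. smult (c j) (cheb j))"
  using assms
proof (induction n arbitrary: q)
  case 0
  then obtain a where "q = [:a:]"
    by (metis degree_eq_zeroE le_zero_eq)
  then show ?case
    by (intro exI[of _ "\<lambda>_. a"]) simp
next
  case (Suc n)
  define a where "a = coeff q (Suc n) / coeff (cheb (Suc n)) (Suc n)"
  have "degree (q - smult a (cheb (Suc n))) \<le> n"
  proof (rule degree_le, intro allI impI)
    fix i
    assume "n < i"
    show "coeff (q - smult a (cheb (Suc n))) i = 0"
    proof (cases "i = Suc n")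
      case True
      then show ?thesis
        using coeff_cheb[of "Suc n" "Suc n"] by (simp add: a_def)
    next
      case False
      then show ?thesis
        using \<open>n < i\<close> Suc.prems coeff_cheb[of "Suc n" i] by (simp add: coeff_eq_0)
    qed
  qed
  from Suc.IH[OF this] obtain c where
    c: "q - smult a (cheb (Suc n)) = (\<Sum>j\<le>n. smult (c j) (cheb j))" by blast
  have "q = (\<Sum>j\<le>n. smult (c j) (cheb j)) + smult a (cheb (Suc n))"
    by (simp add: c[symmetric])
  also have "\<dots> = (\<Sum>j\<le>Suc n. smult ((c(Suc n := a)) j) (cheb j))"
    by simp
  finally show ?case
    by blast
qed

lemma integral_cos_nat: "((\<lambda>t. cos (real n * t)) has_integral (if n = 0 then pi else 0)) {0..pi}"
proof (cases "n = 0")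
  case True
  then show ?thesis
    using has_integral_const_real[of "1::real" 0 pi] by simp
next
  case False
  have "((\<lambda>t. cos (real n * t)) has_integral (sin (real n * pi) / n - sin (real n * 0) / n)) {0..pi}"
    using False
    by (intro fundamental_theorem_of_calculus)
      (auto intro!: derivative_eq_intros simp flip: has_real_derivative_iff_has_vector_derivative)
  then show ?thesis
    using False by simp
qed

lemma integral_cos_cos:
  "((\<lambda>t. cos (real j * t) * cos (real k * t)) has_integral
    (if j = k then if k = 0 then pi else pi / 2 else 0)) {0..pi}"
proof -
  define d where "d = (if j \<le> k then k - j else j - k)"
  have "cos (real d * t) = cos (real j * t - real k * t)" for t
  proof (cases "j \<le> k")
    case True
    then have "real d * t = - (real j * t - real k * t)"
      by (simp add: d_def of_nat_diff algebra_simps)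
    then show ?thesis
      by (simp only: cos_minus)
  next
    case False
    then show ?thesis
      by (simp add: d_def of_nat_diff left_diff_distrib)
  qed
  then have *: "cos (real j * t) * cos (real k * t) = (cos (real d * t) + cos (real (j + k) * t)) / 2" for t
    by (simp add: cos_times_cos distrib_right)
  have "((\<lambda>t. (cos (real d * t) + cos (real (j + k) * t)) / 2) has_integral
     ((if d = 0 then pi else 0) + (if j + k = 0 then pi else 0)) / 2) {0..pi}"
    by (intro has_integral_divide has_integral_add integral_cos_nat)
  then show ?thesis
    unfolding * by (rule has_integral_eq_rhs) (auto simp: d_def)
qed

text \<open>At \<open>cos t\<close> the Chebyshev coefficients become cosine Fourier coefficients,
  hence integrals of \<open>poly q\<close> against functions of size at most 1. The factor 2 is the
  length \<open>pi\<close> of the interval over the integral \<open>pi / 2\<close> of a squared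
  cosine with \<open>k > 0\<close>.\<close>

lemma cheb_coefficient_bound:
  assumes q: "q = (\<Sum>j\<le>n. smult (c j) (cheb j))"
    and M: "\<And>t. \<bar>t\<bar> \<le> 1 \<Longrightarrow> \<bar>poly q t\<bar> \<le> M" and "k \<le> n"
  shows "\<bar>c k\<bar> \<le> 2 * M"
proof -
  have "((\<lambda>t. \<Sum>j\<le>n. c j * (cos (real j * t) * cos (real k * t))) has_integral
     (\<Sum>j\<le>n. c j * (if j = k then if k = 0 then pi else pi / 2 else 0))) {0..pi}"
    by (intro has_integral_sum has_integral_mult_right integral_cos_cos) simp
  moreover have "(\<Sum>j\<le>n. c j * (if j = k then if k = 0 then pi else pi / 2 else 0))
      = c k * (if k = 0 then pi else pi / 2)"
    using \<open>k \<le> n\<close> by (subst sum.remove[of _ k]) auto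
  moreover have "(\<Sum>j\<le>n. c j * (cos (real j * t) * cos (real k * t))) = poly q (cos t) * cos (real k * t)" for t
    by (simp add: q poly_sum poly_cheb sum_distrib_right mult.assoc)
  ultimately have i: "((\<lambda>t. poly q (cos t) * cos (real k * t)) has_integral
     c k * (if k = 0 then pi else pi / 2)) {0..pi}"
    by simp
  have "norm (c k * (if k = 0 then pi else pi / 2)) \<le> M * measure lborel {0..pi}"
  proof (rule has_integral_bound_real[OF _ finite.emptyI i])
    show "0 \<le> M"
      using M[of 0] by simp
    show "norm (poly q (cos x) * cos (real k * x)) \<le> M" for x
    proof -
      have "\<bar>poly q (cos x)\<bar> * \<bar>cos (real k * x)\<bar> \<le> M * 1"
        using M[of "cos x"] M[of 0] by (intro mult_mono) auto
      then show ?thesis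
        by (simp add: abs_mult)
    qed
  qed
  then show ?thesis
    using M[of 0] pi_gt_zero by (auto simp: abs_mult field_simps split: if_splits)
qed

section \<open>From Chebyshev polynomials to the supremum norm\<close>

lemma norm_lact_cheb_le:
  assumes h: "star h = h" "norm h \<le> 1"
  shows "norm (lact (cheb n) h x) \<le> norm x"
proof -
  have "norm (h * h) \<le> 1"
    using h by (simp add: norm_square_selfadjoint power_le_one)
  moreover have "star (h * h) = h * h"
    by (simp add: star_mult h)
  ultimately obtain Q where Q: "star Q = Q" "2 *\<^sub>R Q = h * h + Q * Q"
    and c: "\<And>y. y * (h * h) = h * h * y \<Longrightarrow> y * Q = Q * y"
    using sqrt_complement_exists by metis
  have hQ: "h * Q = Q * h"
    by (intro c) (simp add: mult.assoc)
  have hQ': "h * (Q * x) = Q * (h * x)" for x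
    by (metis hQ mult.assoc)
  have QQ: "Q * (Q * x) = 2 *\<^sub>R (Q * x) - h * (h * x)" for x
  proof -
    have "Q * Q = 2 *\<^sub>R Q - h * h"
      using Q by simp
    then have "Q * Q * x = (2 *\<^sub>R Q - h * h) * x"
      by simp
    then show ?thesis
      by (simp add: algebra_simps)
  qed
  \<comment> \<open>\<open>U\<close> and \<open>V\<close> are \<open>h + i (1 - Q)\<close> and
    \<open>h - i (1 - Q)\<close>, where \<open>1 - Q\<close> is \<open>sqrt (1 - h^2)\<close>. They
    are adjoint and inverse to each other, hence isometric, and play the part of
    \<open>exp (i t)\<close> and \<open>exp (- i t)\<close> for \<open>h = cos t\<close>.\<close>
  define U where "U x = h * x + mult_ii (x - Q * x)" for x
  define V where "V x = h * x - mult_ii (x - Q * x)" for x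
  have VU: "V (U x) = x" and UV: "U (V x) = x" for x
    unfolding U_def V_def by (simp_all add: algebra_simps mult_ii_simps hQ' QQ scaleR_2)
  have adj: "star (U x) * y = star x * V y" "star (V x) * y = star x * U y" for x y
    unfolding U_def V_def
    by (simp_all add: algebra_simps mult_ii_simps star_add star_diff star_mult h Q)
  have "norm (U x) = norm x" for x
    using cstar_identity[of "U x"] cstar_identity[of x] adj(1)[of x "U x"] VU by simp
  then have nU: "norm ((U ^^ n) x) = norm x" for x
    by (induction n) simp_all
  have "norm (V x) = norm x" for x
    using cstar_identity[of "V x"] cstar_identity[of x] adj(2)[of x "V x"] UV by simp
  then have nV: "norm ((V ^^ n) x) = norm x" for x
    by (induction n) simp_all
  have UpV: "2 *\<^sub>R (h * x) = U x + V x" for x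
    by (simp add: U_def V_def scaleR_2)
  have UVadd: "U (x + y) = U x + U y" "V (x + y) = V x + V y" for x y
    unfolding U_def V_def by (simp_all add: algebra_simps mult_ii_simps)
  \<comment> \<open>The operator form of \<open>2 cos (n t) = exp (i n t) + exp (- i n t)\<close>;
    the recursion of \<open>cheb\<close> matches because \<open>U\<close> and \<open>V\<close>
    cancel each other.\<close>
  have "2 *\<^sub>R lact (cheb n) h x = (U ^^ n) x + (V ^^ n) x" for n
  proof (induction n rule: cheb.induct)
    case (3 n)
    have "2 *\<^sub>R lact (cheb (Suc (Suc n))) h x
        = 2 *\<^sub>R (h * (2 *\<^sub>R lact (cheb (Suc n)) h x)) - 2 *\<^sub>R lact (cheb n) h x"
      by (simp add: lact_diff lact_smult algebra_simps)
    also have "\<dots> = U ((U ^^ Suc n) x + (V ^^ Suc n) x) + V ((U ^^ Suc n) x + (V ^^ Suc n) x)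
        - ((U ^^ n) x + (V ^^ n) x)"
      by (simp only: 3 UpV)
    also have "\<dots> = (U ^^ Suc (Suc n)) x + (V ^^ Suc (Suc n)) x"
      by (simp add: UVadd UV VU)
    finally show ?case .
  qed (simp_all add: scaleR_2 UpV[unfolded scaleR_2])
  then have "2 * norm (lact (cheb n) h x) = norm ((U ^^ n) x + (V ^^ n) x)"
    by (metis norm_scaleR abs_numeral)
  also have "\<dots> \<le> norm x + norm x"
    by (intro norm_triangle_le) (simp add: nU nV)
  finally show ?thesis
    by simp
qed

lemma norm_lact_le_degree:
  assumes h: "star h = h" "norm h \<le> 1"
    and M: "\<And>t. \<bar>t\<bar> \<le> 1 \<Longrightarrow> \<bar>poly q t\<bar> \<le> M"
  shows "norm (lact q h x) \<le> 2 * (real (degree q) + 1) * M * norm x"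
proof -
  obtain c where c: "q = (\<Sum>j\<le>degree q. smult (c j) (cheb j))"
    using poly_eq_sum_cheb by blast
  have "norm (lact q h x) = norm (\<Sum>j\<le>degree q. c j *\<^sub>R lact (cheb j) h x)"
    by (subst c) (simp add: lact_sum lact_smult)
  also have "\<dots> \<le> (\<Sum>j\<le>degree q. 2 * M * norm x)"
    using cheb_coefficient_bound[OF c M] norm_lact_cheb_le[OF h] M[of 0]
    by (intro sum_norm_le) (auto intro!: mult_mono)
  also have "\<dots> = 2 * (real (degree q) + 1) * M * norm x"
    by simp
  finally show ?thesis .
qed

text \<open>For \<open>r > 1\<close> the power \<open>r ^ (2 ^ k)\<close> outgrows every linear
  function of its exponent.\<close>

lemma le_one_if_powers_bounded_linearly:
  fixes r :: real
  assumes "\<And>k. r ^ (2 ^ k) \<le> A * 2 ^ k + B"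
  shows "r \<le> 1"
proof (rule ccontr)
  assume "\<not> r \<le> 1"
  define x where "x = 1 / r"
  have x: "0 < x" "x < 1" "r * x = 1"
    using \<open>\<not> r \<le> 1\<close> by (simp_all add: x_def)
  have "(\<lambda>n. A * (real n * x ^ n) + B * x ^ n) \<longlonglongrightarrow> A * 0 + B * 0"
    using x by (intro tendsto_intros powser_times_n_limit_0 LIMSEQ_power_zero) auto
  moreover have "strict_mono (\<lambda>k. 2 ^ k :: nat)"
    by (rule strict_monoI) simp
  ultimately have "(\<lambda>k. A * (real (2 ^ k) * x ^ (2 ^ k)) + B * x ^ (2 ^ k)) \<longlonglongrightarrow> 0"
    using LIMSEQ_subseq_LIMSEQ[of _ _ "\<lambda>k. 2 ^ k :: nat"] by (fastforce simp: comp_def)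
  moreover have "1 \<le> A * (real (2 ^ k) * x ^ (2 ^ k)) + B * x ^ (2 ^ k)" for k
  proof -
    have "(r * x) ^ (2 ^ k) \<le> (A * 2 ^ k + B) * x ^ (2 ^ k)"
      unfolding power_mult_distrib using assms x by (intro mult_right_mono) auto
    then show ?thesis
      by (simp add: x(3) algebra_simps)
  qed
  ultimately have "(1::real) \<le> 0"
    by (intro LIMSEQ_le_const) auto
  then show False
    by simp
qed

text \<open>The factor depending on the degree disappears on passing to the powers \<open>p\<^bsup>2^k\<^esup>\<close>.\<close>

lemma norm_lact_le_unit_ball:
  assumes h: "star h = h" "norm h \<le> 1"
    and M: "\<And>t. \<bar>t\<bar> \<le> 1 \<Longrightarrow> \<bar>poly p t\<bar> \<le> M" and "M > 0"
  shows "norm (lact p h x) \<le> M * norm x"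
proof (cases "x = 0")
  case False
  then have nx: "norm x > 0"
    by simp
  define r where "r = norm (lact p h x) / (M * norm x)"
  \<comment> \<open>Both sides are homogeneous of degree \<open>2 ^ k + 1\<close> in
    \<open>x\<close>, which lets the surplus factor \<open>norm x\<close> be cancelled after each
    squaring.\<close>
  have pow: "(norm (lact p h x)) ^ (2 ^ k) * norm x \<le> norm x ^ (2 ^ k) * norm (lact (p ^ (2 ^ k)) h x)" for k
  proof (induction k)
    case (Suc k)
    let ?a = "norm (lact p h x)" and ?y = "norm (lact (p ^ (2 ^ k)) h x)"
    have "(?a ^ (2 ^ k) * norm x)\<^sup>2 \<le> (norm x ^ (2 ^ k) * ?y)\<^sup>2"
      using Suc by (intro power_mono) auto
    also have "\<dots> = norm x ^ (2 ^ Suc k) * ?y\<^sup>2"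
      by (simp add: power_mult_distrib power_mult[symmetric] mult.commute)
    also have "\<dots> \<le> norm x ^ (2 ^ Suc k) * (norm x * norm (lact (p ^ (2 ^ Suc k)) h x))"
      using norm_lact_square[OF h(1), of "p ^ (2 ^ k)" x]
      by (intro mult_left_mono) (simp_all add: power_add[symmetric] mult_2)
    also have "(?a ^ (2 ^ k) * norm x)\<^sup>2 = norm x * (?a ^ (2 ^ Suc k) * norm x)"
      by (simp add: power_mult_distrib power_mult[symmetric] power2_eq_square[of "norm x"]
        mult.commute mult.left_commute)
    also have "norm x ^ (2 ^ Suc k) * (norm x * norm (lact (p ^ (2 ^ Suc k)) h x))
        = norm x * (norm x ^ (2 ^ Suc k) * norm (lact (p ^ (2 ^ Suc k)) h x))"
      by simp
    finally show ?case
      using nx by (simp only: mult_le_cancel_left_pos)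
  qed simp
  have "r ^ (2 ^ k) \<le> (2 * real (degree p)) * 2 ^ k + 2" for k
  proof -
    have "\<bar>poly (p ^ (2 ^ k)) t\<bar> \<le> M ^ (2 ^ k)" if "\<bar>t\<bar> \<le> 1" for t
      using M[OF that] by (simp add: poly_power power_abs power_mono)
    from norm_lact_le_degree[OF h this]
    have "norm (lact (p ^ (2 ^ k)) h x) \<le> 2 * (real (degree (p ^ (2 ^ k))) + 1) * M ^ (2 ^ k) * norm x"
      by simp
    also have "\<dots> \<le> 2 * (real (degree p) * 2 ^ k + 1) * M ^ (2 ^ k) * norm x"
    proof -
      have "real (degree (p ^ (2 ^ k))) \<le> real (degree p * 2 ^ k)"
        using degree_power_le[of p "2 ^ k"] by (simp only: of_nat_le_iff)
      then show ?thesis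
        using \<open>M > 0\<close> by (intro mult_right_mono mult_left_mono) auto
    qed
    finally have "norm x ^ (2 ^ k) * norm (lact (p ^ (2 ^ k)) h x)
        \<le> norm x ^ (2 ^ k) * (2 * (real (degree p) * 2 ^ k + 1) * M ^ (2 ^ k) * norm x)"
      by (intro mult_left_mono) auto
    with pow[of k] have "(norm (lact p h x)) ^ (2 ^ k) * norm x
        \<le> (norm x ^ (2 ^ k) * (2 * (real (degree p) * 2 ^ k + 1) * M ^ (2 ^ k))) * norm x"
      by (simp add: mult_ac)
    then have "(norm (lact p h x)) ^ (2 ^ k)
        \<le> (2 * (real (degree p) * 2 ^ k + 1)) * (M * norm x) ^ (2 ^ k)"
      using nx by (simp add: power_mult_distrib mult_ac)
    then show ?thesis
      using nx \<open>M > 0\<close> by (simp add: r_def power_divide pos_divide_le_eq algebra_simps)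
  qed
  then have "r \<le> 1"
    by (rule le_one_if_powers_bounded_linearly)
  then show ?thesis
    using nx \<open>M > 0\<close> by (simp add: r_def field_simps)
qed simp

lemma norm_lact_le:
  assumes h: "star h = h" and M: "\<And>t. \<bar>t\<bar> \<le> norm h \<Longrightarrow> \<bar>poly p t\<bar> \<le> M"
  shows "norm (lact p h x) \<le> M * norm x"
proof -
  \<comment> \<open>The estimate on the unit ball asks for a positive bound, and \<open>M\<close>
    may be 0; hence the detour through \<open>K > M\<close>.\<close>
  have K: "norm (lact p h x) \<le> K * norm x" if "K > M" for K
  proof -
    have "K > 0"
      using M[of 0] that by simp
    show ?thesis
    proof (cases "h = 0")
      case True
      have "lact p 0 x = coeff p 0 *\<^sub>R x"
        by (cases p) simp
      moreover have "\<bar>coeff p 0\<bar> \<le> K"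
        using M[of 0] that by (simp add: poly_0_coeff_0)
      ultimately show ?thesis
        using True by (simp add: mult_right_mono)
    next
      case False
      have "lact p h x = lact (pcompose p [:0, norm h:]) ((1 / norm h) *\<^sub>R h) x"
        using False by (simp add: lact_pcompose)
      moreover have "norm (lact (pcompose p [:0, norm h:]) ((1 / norm h) *\<^sub>R h) x) \<le> K * norm x"
      proof (rule norm_lact_le_unit_ball)
        show "\<bar>poly (pcompose p [:0, norm h:]) t\<bar> \<le> K" if "\<bar>t\<bar> \<le> 1" for t
          using M[of "t * norm h"] that \<open>K > M\<close>
          by (simp add: poly_pcompose abs_mult mult_left_le_one_le)
      qed (use False h \<open>K > 0\<close> in \<open>simp_all add: star_scaleR\<close>)
      ultimately show ?thesis
        by simp
    qed
  qed
  have "norm (lact p h x) \<le> M * norm x + e" if "e > 0" for e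
  proof (cases "x = 0")
    case False
    then have "(M + e / norm x) * norm x = M * norm x + e"
      by (simp add: field_simps)
    then show ?thesis
      using K[of "M + e / norm x"] that False by simp
  qed (use that in simp)
  then show ?thesis
    by (rule field_le_epsilon)
qed


subsection \<open>Continuous functions of a self-adjoint element\<close>

text \<open>Without a unit only functions vanishing at 0 give elements of the algebra. Continuity on
  the whole line keeps the class closed under composition and independent of the element.\<close>

definition cont0 :: "(real \<Rightarrow> real) \<Rightarrow> bool" where
  "cont0 f \<longleftrightarrow> continuous_on UNIV f \<and> f 0 = 0"

lemma cont0_id [simp]: "cont0 (\<lambda>t. t)"
  by (simp add: cont0_def)

lemma cont0_add: "cont0 f \<Longrightarrow> cont0 g \<Longrightarrow> cont0 (\<lambda>t. f t + g t)"
  by (auto simp: cont0_def intro!: continuous_intros)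

lemma cont0_diff: "cont0 f \<Longrightarrow> cont0 g \<Longrightarrow> cont0 (\<lambda>t. f t - g t)"
  by (auto simp: cont0_def intro!: continuous_intros)

lemma cont0_scale: "cont0 f \<Longrightarrow> cont0 (\<lambda>t. c * f t)"
  by (auto simp: cont0_def intro!: continuous_intros)

lemma cont0_minus: "cont0 f \<Longrightarrow> cont0 (\<lambda>t. - f t)"
  by (auto simp: cont0_def intro!: continuous_intros)

lemma cont0_mult: "cont0 f \<Longrightarrow> cont0 g \<Longrightarrow> cont0 (\<lambda>t. f t * g t)"
  by (auto simp: cont0_def intro!: continuous_intros)

lemma cont0_poly: "cont0 f \<Longrightarrow> cont0 (\<lambda>t. f t * poly q (f t))"
  by (auto simp: cont0_def intro!: continuous_intros)

lemma cont0_compose: "cont0 f \<Longrightarrow> cont0 g \<Longrightarrow> cont0 (\<lambda>t. f (g t))"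
  by (auto simp: cont0_def intro: continuous_on_compose2[of UNIV f UNIV g])

lemmas cont0_intros = cont0_id cont0_add cont0_diff cont0_scale cont0_minus cont0_mult

lemma cont0_bound:
  assumes "cont0 f"
  obtains K where "K > 0" and "\<And>t. \<bar>t\<bar> \<le> r \<Longrightarrow> \<bar>f t\<bar> \<le> K"
proof -
  have "continuous_on {-r..r} f"
    using assms continuous_on_subset unfolding cont0_def by blast
  then have "bounded (f ` {-r..r})"
    by (intro compact_imp_bounded compact_continuous_image) auto
  then obtain K where "K > 0" "\<forall>y\<in>f ` {-r..r}. norm y \<le> K"
    using bounded_pos by blast
  then show thesis
    by (intro that[of K]) (auto simp: abs_le_iff)
qed

text \<open>The approximants do not depend on the algebra element, and the intervals exhaust the line.\<close>

definition weier :: "(real \<Rightarrow> real) \<Rightarrow> nat \<Rightarrow> real poly" where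
  "weier f n = (SOME q. \<forall>t. \<bar>t\<bar> \<le> real n \<longrightarrow> \<bar>t * poly q t - f t\<bar> \<le> 1 / real (Suc n))"

lemma weier:
  assumes f: "cont0 f" and t: "\<bar>t\<bar> \<le> real n"
  shows "\<bar>t * poly (weier f n) t - f t\<bar> \<le> 1 / real (Suc n)"
proof -
  \<comment> \<open>Removing the constant term of the approximating polynomial adds the error
    \<open>g 0\<close>, which is small because \<open>f 0 = 0\<close>; hence one half of
    \<open>1 / Suc n\<close> for each of the two errors.\<close>
  define e where "e = 1 / (2 * real (Suc n))"
  have "e > 0"
    by (simp add: e_def)
  have "continuous_on {- real n..real n} f"
    using f continuous_on_subset unfolding cont0_def by blast
  then obtain g where g: "real_polynomial_function g"
    and gf: "\<And>x. x \<in> {- real n..real n} \<Longrightarrow> \<bar>f x - g x\<bar> < e"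
    using Stone_Weierstrass_real_polynomial_function[of "{- real n..real n}" f e] \<open>e > 0\<close> by auto
  from g obtain a m where g_eq: "g = (\<lambda>x. \<Sum>i\<le>m. a i * x ^ i)"
    using real_polynomial_function_iff_sum by auto
  define p where "p = (\<Sum>i\<le>m. monom (a i) i)"
  have p: "poly p x = g x" for x
    by (simp add: p_def g_eq poly_sum poly_monom)
  obtain c q where q: "p = pCons c q"
    by (cases p) auto
  have "\<bar>x * poly q x - f x\<bar> \<le> 1 / real (Suc n)" if "\<bar>x\<bar> \<le> real n" for x
  proof -
    have "x * poly q x = g x - g 0"
      by (simp flip: p add: q)
    moreover have "\<bar>f x - g x\<bar> < e" "\<bar>f 0 - g 0\<bar> < e"
      using that by (auto intro!: gf)
    moreover have "2 * e = 1 / real (Suc n)"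
      by (simp add: e_def field_simps)
    ultimately show ?thesis
      using f by (simp add: cont0_def)
  qed
  then have "\<exists>q. \<forall>t. \<bar>t\<bar> \<le> real n \<longrightarrow> \<bar>t * poly q t - f t\<bar> \<le> 1 / real (Suc n)"
    by blast
  from someI_ex[OF this] show ?thesis
    using t unfolding weier_def by blast
qed

lemma weier_eventually:
  assumes "cont0 f"
  shows "\<forall>\<^sub>F n in sequentially. \<forall>t. \<bar>t\<bar> \<le> r \<longrightarrow> \<bar>t * poly (weier f n) t - f t\<bar> \<le> 1 / real (Suc n)"
  using eventually_ge_at_top[of "nat \<lceil>r\<rceil>"]
proof eventually_elim
  case (elim n)
  then have "r \<le> real n"
    by linarith
  then show ?case
    using weier[OF assms] by force
qed

text \<open>The algebra acts faithfully on itself: test with \<open>y = star (a - b)\<close>. In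
  this way identities of multipliers become identities of elements.\<close>

lemma mult_right_eqI:
  fixes a b :: "'a::cstar_algebra"
  assumes "\<And>y. a * y = b * y"
  shows "a = b"
proof -
  have "(a - b) * star (a - b) = 0"
    by (simp add: algebra_simps assms)
  then have "(norm (a - b))\<^sup>2 = 0"
    by (metis norm_mult_star norm_zero)
  then show ?thesis
    by simp
qed

text \<open>\<open>lact q h h\<close> is the element \<open>h q(h)\<close>, which exists without a
  unit; as a left multiplier it is the polynomial \<open>t q(t)\<close>.\<close>

lemma lact_self_mult: "lact q h h * x = lact (pCons 0 q) h x"
  by (simp add: lact_commute lact_arg_mult)

lemma lact_self_mult_self: "lact p h h * lact q h h = lact (p * pCons 0 q) h h"
  by (simp add: lact_self_mult lact_mult lact_commute)

lemma star_lact_self: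
  assumes "star h = h"
  shows "star (lact q h h) = lact q h h"
proof (rule mult_right_eqI)
  show "star (lact q h h) * y = lact q h h * y" for y
    by (simp add: star_lact[OF assms] assms lact_commute lact_arg_mult)
qed

text \<open>Since \<open>norm (F * star F) = (norm F)^2\<close>, a bound for \<open>F\<close> as a
  multiplier, applied to its own adjoint, bounds the element \<open>F\<close>.\<close>

lemma norm_lact_self_le:
  assumes h: "star h = h" and M: "\<And>t. \<bar>t\<bar> \<le> norm h \<Longrightarrow> \<bar>t * poly q t\<bar> \<le> M"
  shows "norm (lact q h h) \<le> M"
proof -
  let ?F = "lact q h h"
  have "0 \<le> M"
    using M[of 0] by simp
  have "(norm ?F)\<^sup>2 = norm (?F * star ?F)"
    by (simp add: norm_mult_star)
  also have "\<dots> \<le> M * norm ?F"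
    using norm_lact_le[OF h, of "pCons 0 q" M "star ?F"] M by (simp add: lact_self_mult)
  finally show ?thesis
    using \<open>0 \<le> M\<close> by (cases "norm ?F = 0") (simp_all add: power2_eq_square)
qed

section \<open>Limits of polynomials and the rules of the calculus\<close>

definition fc :: "'a::cstar_algebra \<Rightarrow> (real \<Rightarrow> real) \<Rightarrow> 'a" where
  "fc h f = lim (\<lambda>n. lact (weier f n) h h)"

lemma inverse_Suc_tendsto: "(\<lambda>n. 1 / real (Suc n)) \<longlonglongrightarrow> 0"
  using LIMSEQ_inverse_real_of_nat by (simp add: inverse_eq_divide)

lemma fc_tendsto:
  assumes h: "star h = h" and f: "cont0 f"
  shows "(\<lambda>n. lact (weier f n) h h) \<longlonglongrightarrow> fc h f"
proof -
  let ?w = "\<lambda>n. lact (weier f n) h h"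
  obtain N where N: "\<And>n t. n \<ge> N \<Longrightarrow> \<bar>t\<bar> \<le> norm h \<Longrightarrow> \<bar>t * poly (weier f n) t - f t\<bar> \<le> 1 / real (Suc n)"
    using weier_eventually[OF f, of "norm h"] unfolding eventually_sequentially by blast
  have d: "norm (?w m - ?w n) \<le> 1 / real (Suc m) + 1 / real (Suc n)" if "m \<ge> N" "n \<ge> N" for m n
    unfolding lact_diff[symmetric]
  proof (rule norm_lact_self_le[OF h])
    fix t :: real
    assume "\<bar>t\<bar> \<le> norm h"
    then show "\<bar>t * poly (weier f m - weier f n) t\<bar> \<le> 1 / real (Suc m) + 1 / real (Suc n)"
      using N[of m t] N[of n t] that unfolding poly_diff right_diff_distrib by linarith
  qed
  have "Cauchy ?w"
  proof (rule metric_CauchyI)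
    fix e :: real
    assume "e > 0"
    then have "\<forall>\<^sub>F n in sequentially. 1 / real (Suc n) < e / 2"
      using order_tendstoD(2)[OF inverse_Suc_tendsto, of "e/2"] by simp
    then obtain M where M: "\<And>n. n \<ge> M \<Longrightarrow> 1 / real (Suc n) < e / 2"
      unfolding eventually_sequentially by blast
    have "dist (?w m) (?w n) < e" if "m \<ge> max M N" "n \<ge> max M N" for m n
      using d[of m n] M[of m] M[of n] that unfolding dist_norm by simp
    then show "\<exists>M. \<forall>m\<ge>M. \<forall>n\<ge>M. dist (?w m) (?w n) < e"
      by blast
  qed
  then show ?thesis
    unfolding fc_def by (simp add: Cauchy_convergent_iff convergent_LIMSEQ_iff)
qed

lemma norm_lact_diff_fc_le:
  assumes h: "star h = h" and f: "cont0 f"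
    and e: "\<And>t. \<bar>t\<bar> \<le> norm h \<Longrightarrow> \<bar>t * poly q t - f t\<bar> \<le> e"
  shows "norm (lact q h h - fc h f) \<le> e"
proof (rule LIMSEQ_le)
  show "(\<lambda>n. norm (lact q h h - lact (weier f n) h h)) \<longlonglongrightarrow> norm (lact q h h - fc h f)"
    by (intro tendsto_intros fc_tendsto assms)
  show "(\<lambda>n. e + 1 / real (Suc n)) \<longlonglongrightarrow> e"
    using tendsto_add[OF tendsto_const inverse_Suc_tendsto, of e] by simp
  have "\<forall>\<^sub>F n in sequentially. norm (lact q h h - lact (weier f n) h h) \<le> e + 1 / real (Suc n)"
    using weier_eventually[OF f, of "norm h"]
  proof eventually_elim
    case (elim n)
    show ?case
      unfolding lact_diff[symmetric]
    proof (rule norm_lact_self_le[OF h])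
      show "\<bar>t * poly (q - weier f n) t\<bar> \<le> e + 1 / real (Suc n)" if "\<bar>t\<bar> \<le> norm h" for t
        using elim e[OF that] that by (simp only: poly_diff right_diff_distrib) (smt (verit))
    qed
  qed
  then show "\<exists>N. \<forall>n\<ge>N. norm (lact q h h - lact (weier f n) h h) \<le> e + 1 / real (Suc n)"
    unfolding eventually_sequentially .
qed

lemma norm_fc_le:
  assumes "star h = h" "cont0 f" "\<And>t. \<bar>t\<bar> \<le> norm h \<Longrightarrow> \<bar>f t\<bar> \<le> M"
  shows "norm (fc h f) \<le> M"
  using norm_lact_diff_fc_le[OF assms(1,2), of 0 M] assms(3) by simp

text \<open>Frees the calculus from the chosen approximants: any uniformly convergent polynomials
  will do, so sums and products of approximants compute sums and products of functions.\<close>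

lemma fc_eqI:
  assumes h: "star h = h" and f: "cont0 f"
    and q: "\<forall>\<^sub>F n in sequentially. \<forall>t. \<bar>t\<bar> \<le> norm h \<longrightarrow> \<bar>t * poly (q n) t - f t\<bar> \<le> d n"
    and d: "d \<longlonglongrightarrow> 0" and F: "(\<lambda>n. lact (q n) h h) \<longlonglongrightarrow> F"
  shows "fc h f = F"
proof -
  have "(\<lambda>n. lact (q n) h h - fc h f) \<longlonglongrightarrow> 0"
  proof (rule Lim_null_comparison[OF _ d])
    show "\<forall>\<^sub>F n in sequentially. norm (lact (q n) h h - fc h f) \<le> d n"
      using q by eventually_elim (simp add: norm_lact_diff_fc_le[OF h f])
  qed
  then have "(\<lambda>n. lact (q n) h h) \<longlonglongrightarrow> fc h f"
    using Lim_null by blast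
  then show ?thesis
    using F LIMSEQ_unique by blast
qed

lemma star_fc:
  assumes "star h = h" "cont0 f"
  shows "star (fc h f) = fc h f"
  using tendsto_star[OF fc_tendsto[OF assms]] fc_tendsto[OF assms] LIMSEQ_unique
  by (simp add: star_lact_self[OF assms(1)]) blast

lemma fc_id:
  assumes "star h = h"
  shows "fc h (\<lambda>t. t) = h"
  using norm_lact_diff_fc_le[OF assms cont0_id, of 1 0] by simp

lemma fc_linear:
  assumes h: "star h = h" and f: "cont0 f" and g: "cont0 g"
  shows "fc h (\<lambda>t. c * f t + g t) = c *\<^sub>R fc h f + fc h g"
proof (rule fc_eqI[OF h])
  let ?q = "\<lambda>n. smult c (weier f n) + weier g n"
  show "\<forall>\<^sub>F n in sequentially. \<forall>t. \<bar>t\<bar> \<le> norm h \<longrightarrow>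
      \<bar>t * poly (?q n) t - (c * f t + g t)\<bar> \<le> (\<bar>c\<bar> + 1) * (1 / real (Suc n))"
    using weier_eventually[OF f, of "norm h"] weier_eventually[OF g, of "norm h"]
  proof eventually_elim
    case (elim n)
    show ?case
    proof (intro allI impI)
      fix t :: real
      assume t: "\<bar>t\<bar> \<le> norm h"
      have "t * poly (?q n) t - (c * f t + g t)
          = c * (t * poly (weier f n) t - f t) + (t * poly (weier g n) t - g t)"
        by (simp add: algebra_simps)
      also have "\<bar>\<dots>\<bar> \<le> \<bar>c\<bar> * \<bar>t * poly (weier f n) t - f t\<bar> + \<bar>t * poly (weier g n) t - g t\<bar>"
        by (metis abs_mult abs_triangle_ineq)
      also have "\<dots> \<le> \<bar>c\<bar> * (1 / real (Suc n)) + 1 / real (Suc n)"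
        using elim t by (intro add_mono mult_left_mono) auto
      finally show "\<bar>t * poly (?q n) t - (c * f t + g t)\<bar> \<le> (\<bar>c\<bar> + 1) * (1 / real (Suc n))"
        by (simp only: distrib_right mult_1)
    qed
  qed
  show "(\<lambda>n. (\<bar>c\<bar> + 1) * (1 / real (Suc n))) \<longlonglongrightarrow> 0"
    using tendsto_mult_left[OF inverse_Suc_tendsto, of "\<bar>c\<bar> + 1"] by simp
  show "(\<lambda>n. lact (?q n) h h) \<longlonglongrightarrow> c *\<^sub>R fc h f + fc h g"
    unfolding lact_add lact_smult by (intro tendsto_intros fc_tendsto h f g)
qed (intro cont0_add cont0_scale f g)

lemma fc_add:
  assumes "star h = h" "cont0 f" "cont0 g"
  shows "fc h (\<lambda>t. f t + g t) = fc h f + fc h g"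
  using fc_linear[OF assms, of 1] by simp

lemma fc_zero: "star h = h \<Longrightarrow> fc h (\<lambda>_. 0) = 0"
  using norm_fc_le[of h "\<lambda>_. 0" 0] by (simp add: cont0_def)

lemma fc_scale:
  assumes "star h = h" "cont0 f"
  shows "fc h (\<lambda>t. c * f t) = c *\<^sub>R fc h f"
  using fc_linear[OF assms, of "\<lambda>_. 0" c] by (simp add: cont0_def fc_zero assms)

lemma fc_mult:
  assumes h: "star h = h" and "cont0 f" "cont0 g"
  shows "fc h (\<lambda>t. f t * g t) = fc h f * fc h g"
proof -
  obtain K where K: "K > 0" "\<And>t. \<bar>t\<bar> \<le> norm h \<Longrightarrow> \<bar>f t\<bar> \<le> K"
    using cont0_bound[OF \<open>cont0 f\<close>] by blast
  obtain L where L: "L > 0" "\<And>t. \<bar>t\<bar> \<le> norm h \<Longrightarrow> \<bar>g t\<bar> \<le> L"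
    using cont0_bound[OF \<open>cont0 g\<close>] by blast
  show ?thesis
  proof (rule fc_eqI[OF h])
    show "\<forall>\<^sub>F n in sequentially. \<forall>t. \<bar>t\<bar> \<le> norm h \<longrightarrow>
        \<bar>t * poly (weier f n * pCons 0 (weier g n)) t - f t * g t\<bar> \<le> (L + 1 + K) * (1 / real (Suc n))"
      using weier_eventually[OF \<open>cont0 f\<close>, of "norm h"] weier_eventually[OF \<open>cont0 g\<close>, of "norm h"]
    proof eventually_elim
      case (elim n)
      show ?case
      proof (intro allI impI)
        fix t :: real
        assume t: "\<bar>t\<bar> \<le> norm h"
        define a where "a = t * poly (weier f n) t"
        define b where "b = t * poly (weier g n) t"
        define e where "e = 1 / real (Suc n)"
        have e: "\<bar>a - f t\<bar> \<le> e" "\<bar>b - g t\<bar> \<le> e" "e \<le> 1" "e \<ge> 0"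
          using elim t by (simp_all add: a_def b_def e_def)
        have "\<bar>b\<bar> \<le> L + 1"
          using e L(2)[OF t] by linarith
        have "a * b - f t * g t = (a - f t) * b + f t * (b - g t)"
          by (simp add: algebra_simps)
        also have "\<bar>\<dots>\<bar> \<le> \<bar>a - f t\<bar> * \<bar>b\<bar> + \<bar>f t\<bar> * \<bar>b - g t\<bar>"
          by (metis abs_mult abs_triangle_ineq)
        also have "\<dots> \<le> e * (L + 1) + K * e"
          using e K(1) K(2)[OF t] \<open>\<bar>b\<bar> \<le> L + 1\<close> by (intro add_mono mult_mono) auto
        finally show "\<bar>t * poly (weier f n * pCons 0 (weier g n)) t - f t * g t\<bar> \<le> (L + 1 + K) * (1 / real (Suc n))"
          by (simp add: a_def b_def e_def algebra_simps add_divide_distrib)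
      qed
    qed
    show "(\<lambda>n. (L + 1 + K) * (1 / real (Suc n))) \<longlonglongrightarrow> 0"
      using tendsto_mult_left[OF inverse_Suc_tendsto, of "L + 1 + K"] by simp
    show "(\<lambda>n. lact (weier f n * pCons 0 (weier g n)) h h) \<longlonglongrightarrow> fc h f * fc h g"
      unfolding lact_self_mult_self[symmetric] by (intro tendsto_intros fc_tendsto assms)
  qed (intro cont0_mult assms)
qed

lemma fc_minus:
  assumes "star h = h" "cont0 f"
  shows "fc h (\<lambda>t. - f t) = - fc h f"
  using fc_scale[OF assms, of "-1"] by simp

lemma fc_diff:
  assumes "star h = h" "cont0 f" "cont0 g"
  shows "fc h (\<lambda>t. f t - g t) = fc h f - fc h g"
  using fc_add[OF assms(1,2) cont0_minus[OF assms(3)]] fc_minus[OF assms(1,3)] by simp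

lemma fc_cong:
  assumes h: "star h = h" and "cont0 f" "cont0 g" and "\<And>t. \<bar>t\<bar> \<le> norm h \<Longrightarrow> f t = g t"
  shows "fc h f = fc h g"
  using norm_fc_le[OF h cont0_diff[OF assms(2,3)], of 0] assms(4) fc_diff[OF assms(1-3)] by simp

text \<open>Both sides use the same approximants, so the polynomial case passes to the limit. It is
  meant for \<open>h2 = star z * z\<close> and \<open>h1 = z * star z\<close>.\<close>

lemma fc_intertwine:
  assumes h: "star h1 = h1" "star h2 = h2" and f: "cont0 f" and z: "z * h2 = h1 * z"
  shows "z * fc h2 f = fc h1 f * z"
proof -
  have "z * lact q h2 h2 = lact q h1 h1 * z" for q
    by (simp add: lact_intertwine[OF z] z lact_arg_mult)
  then have "(\<lambda>n. lact (weier f n) h1 h1 * z) \<longlonglongrightarrow> z * fc h2 f"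
    using tendsto_mult_left[OF fc_tendsto[OF h(2) f], of z] by simp
  moreover have "(\<lambda>n. lact (weier f n) h1 h1 * z) \<longlonglongrightarrow> fc h1 f * z"
    by (intro tendsto_intros fc_tendsto h f)
  ultimately show ?thesis
    using LIMSEQ_unique by blast
qed

lemma lact_fc:
  assumes h: "star h = h" and g: "cont0 g"
  shows "lact q (fc h g) (fc h g) = fc h (\<lambda>t. g t * poly q (g t))"
proof (induction q)
  case 0
  then show ?case
    by (simp add: fc_zero[OF h])
next
  case (pCons c q)
  have "fc h (\<lambda>t. g t * poly (pCons c q) (g t))
      = fc h (\<lambda>t. c * g t + g t * (g t * poly q (g t)))"
    by (simp add: algebra_simps)
  also have "\<dots> = c *\<^sub>R fc h g + fc h g * fc h (\<lambda>t. g t * poly q (g t))"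
    using fc_add[OF h cont0_scale[OF g] cont0_mult[OF g cont0_poly[OF g]]]
      fc_scale[OF h g] fc_mult[OF h g cont0_poly[OF g]] by simp
  finally show ?case
    using pCons.IH by simp
qed

lemma fc_compose:
  assumes h: "star h = h" and g: "cont0 g" and f: "cont0 f"
  shows "fc (fc h g) f = fc h (\<lambda>t. f (g t))"
proof -
  have sF: "star (fc h g) = fc h g"
    by (rule star_fc[OF h g])
  obtain K where K: "\<And>t. \<bar>t\<bar> \<le> norm h \<Longrightarrow> \<bar>g t\<bar> \<le> K"
    using cont0_bound[OF g] by blast
  have "(\<lambda>n. lact (weier f n) (fc h g) (fc h g) - fc h (\<lambda>t. f (g t))) \<longlonglongrightarrow> 0"
  proof (rule Lim_null_comparison[OF _ inverse_Suc_tendsto])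
    show "\<forall>\<^sub>F n in sequentially.
        norm (lact (weier f n) (fc h g) (fc h g) - fc h (\<lambda>t. f (g t))) \<le> 1 / real (Suc n)"
      using weier_eventually[OF f, of K]
    proof eventually_elim
      case (elim n)
      show ?case
        unfolding lact_fc[OF h g]
          fc_diff[OF h cont0_poly[OF g] cont0_compose[OF f g], symmetric]
        by (rule norm_fc_le[OF h cont0_diff[OF cont0_poly[OF g] cont0_compose[OF f g]]])
          (use elim K in blast)
    qed
  qed
  then have "(\<lambda>n. lact (weier f n) (fc h g) (fc h g)) \<longlonglongrightarrow> fc h (\<lambda>t. f (g t))"
    using Lim_null by blast
  then show ?thesis
    using fc_tendsto[OF sF f] LIMSEQ_unique by blast
qed


section \<open>Positive elements\<close>

text \<open>A self-adjoint square root replaces a condition on the spectrum. That every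
  \<open>star y * y\<close> has one is \<open>psd_star_mult_self\<close>.\<close>

definition psd :: "'a::cstar_algebra \<Rightarrow> bool" where
  "psd a \<longleftrightarrow> (\<exists>h. star h = h \<and> a = h * h)"

lemma psd_star: "psd a \<Longrightarrow> star a = a"
  by (auto simp: psd_def star_mult)

lemma psd_square: "star h = h \<Longrightarrow> psd (h * h)"
  by (auto simp: psd_def)

lemma psd_zero [simp]: "psd 0"
  unfolding psd_def by (intro exI[of _ 0]) simp

lemma psd_scaleR:
  assumes "psd a" "c \<ge> 0"
  shows "psd (c *\<^sub>R a)"
proof -
  obtain h where "star h = h" "a = h * h"
    using assms by (auto simp: psd_def)
  then show ?thesis
    unfolding psd_def using assms(2)
    by (intro exI[of _ "sqrt c *\<^sub>R h"]) (simp add: star_scaleR)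
qed

lemma selfadjoint_square_eq_0: "star x = x \<Longrightarrow> x * x = 0 \<Longrightarrow> x = (0::'a::cstar_algebra)"
  using norm_square_selfadjoint[of x] by simp

lemma psd_fc_selfadjoint:
  assumes h: "star h = h" and f: "cont0 f" and nn: "\<And>t. \<bar>t\<bar> \<le> norm h \<Longrightarrow> 0 \<le> f t"
  shows "psd (fc h f)"
proof -
  let ?g = "\<lambda>t. sqrt (max (f t) 0)"
  have g: "cont0 ?g"
    using f unfolding cont0_def by (auto intro!: continuous_intros)
  have "fc h f = fc h (\<lambda>t. ?g t * ?g t)"
    by (rule fc_cong[OF h f cont0_mult[OF g g]]) (use nn in auto)
  then show ?thesis
    unfolding psd_def fc_mult[OF h g g] using star_fc[OF h g] by blast
qed

text \<open>Since \<open>a = h * h\<close>, a function of \<open>a\<close> is a function of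
  \<open>h\<close> composed with squaring, so only arguments between 0 and \<open>norm a\<close> are
  seen. This takes the place of locating the spectrum in a half-line.\<close>

lemma fc_psd_cong:
  assumes a: "psd a" and f: "cont0 f" and g: "cont0 g"
    and eq: "\<And>t. 0 \<le> t \<Longrightarrow> t \<le> norm a \<Longrightarrow> f t = g t"
  shows "fc a f = fc a g"
proof -
  obtain h where h: "star h = h" and ah: "a = h * h"
    using a by (auto simp: psd_def)
  let ?s = "\<lambda>t::real. t * t"
  have s: "cont0 ?s"
    by (intro cont0_intros)
  have a_eq: "a = fc h ?s"
    by (simp add: ah fc_mult[OF h] fc_id[OF h])
  have "fc h (\<lambda>t. f (?s t)) = fc h (\<lambda>t. g (?s t))"
  proof (rule fc_cong[OF h cont0_compose[OF f s] cont0_compose[OF g s]])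
    fix t :: real
    assume "\<bar>t\<bar> \<le> norm h"
    then have "\<bar>t\<bar> * \<bar>t\<bar> \<le> norm h * norm h"
      by (intro mult_mono) auto
    then have "t * t \<le> norm a"
      by (simp add: ah norm_square_selfadjoint[OF h] power2_eq_square)
    then show "f (t * t) = g (t * t)"
      by (intro eq) auto
  qed
  then show ?thesis
    by (simp add: a_eq fc_compose[OF h s] f g)
qed

lemma norm_fc_psd_le:
  assumes a: "psd a" and f: "cont0 f" and M: "\<And>t. 0 \<le> t \<Longrightarrow> t \<le> norm a \<Longrightarrow> \<bar>f t\<bar> \<le> M"
  shows "norm (fc a f) \<le> M"
proof -
  have g: "cont0 (\<lambda>t. f (max t 0))"
    by (rule cont0_compose[OF f]) (auto simp: cont0_def intro!: continuous_intros)
  have "fc a f = fc a (\<lambda>t. f (max t 0))"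
    by (rule fc_psd_cong[OF a f g]) auto
  also have "norm \<dots> \<le> M"
    using M by (intro norm_fc_le[OF psd_star[OF a] g]) auto
  finally show ?thesis .
qed

lemma psd_fc:
  assumes a: "psd a" and f: "cont0 f" and nn: "\<And>t. 0 \<le> t \<Longrightarrow> t \<le> norm a \<Longrightarrow> 0 \<le> f t"
  shows "psd (fc a f)"
proof -
  have g: "cont0 (\<lambda>t. f (max t 0))"
    by (rule cont0_compose[OF f]) (auto simp: cont0_def intro!: continuous_intros)
  have "fc a f = fc a (\<lambda>t. f (max t 0))"
    by (rule fc_psd_cong[OF a f g]) auto
  also have "psd \<dots>"
    using nn by (intro psd_fc_selfadjoint[OF psd_star[OF a] g]) auto
  finally show ?thesis .
qed

text \<open>The polynomial \<open>1 - t^2\<close> is bounded by 1 on \<open>[-1, 1]\<close>. This is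
  the easy half of a criterion for positivity, whose other half is
  \<open>psd_if_contractive\<close>.\<close>

lemma norm_diff_square_mult_le:
  assumes "star r = r" "norm r \<le> 1"
  shows "norm (x - r * r * x) \<le> norm (x::'a::cstar_algebra)"
proof -
  have "norm (lact [:1, 0, -1:] r x) \<le> 1 * norm x"
  proof (rule norm_lact_le[OF assms(1)])
    fix t :: real
    assume "\<bar>t\<bar> \<le> norm r"
    then have "t * t \<le> 1"
      using assms(2) by (metis abs_ge_zero abs_mult_self_eq mult_le_one order_trans)
    then show "\<bar>poly [:1, 0, -1:] t\<bar> \<le> 1"
      by simp
  qed
  then show ?thesis
    by (simp add: mult.assoc)
qed

section \<open>Negative parts and the positive cone\<close>

abbreviation neg_part :: "real \<Rightarrow> real" where
  "neg_part t \<equiv> max (- t) 0"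

lemma cont0_neg_part: "cont0 neg_part"
  by (auto simp: cont0_def intro!: continuous_intros)

lemma cont0_pos_part: "cont0 (\<lambda>t. max t 0)"
  by (auto simp: cont0_def intro!: continuous_intros)

lemma psd_if_neg_part_0:
  assumes m: "star m = m" and 0: "fc m neg_part = 0"
  shows "psd m"
proof -
  have "(\<lambda>t::real. t) = (\<lambda>t. max t 0 - neg_part t)"
    by (auto simp: fun_eq_iff)
  then have "m = fc m (\<lambda>t. max t 0 - neg_part t)"
    using fc_id[OF m] by simp
  also have "\<dots> = fc m (\<lambda>t. max t 0)"
    using fc_diff[OF m cont0_pos_part cont0_neg_part] 0 by simp
  finally show ?thesis
    using psd_fc_selfadjoint[OF m cont0_pos_part] by simp
qed

text \<open>
  If \<open>k\<close> is the negative part of \<open>m\<close>, then \<open>(1 - m) k = k + k\<^sup>2\<close>, whose norm is at least that of \<open>k\<close>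
  with equality only for \<open>k = 0\<close>: the function \<open>\<psi>\<close> inverts \<open>s \<mapsto> s + s\<^sup>2\<close>.
\<close>

lemma psd_if_contractive:
  assumes m: "star m = m" and contr: "\<And>x. norm (x - m * x) \<le> norm x"
  shows "psd m"
proof -
  define k where "k = fc m neg_part"
  define \<phi> where "\<phi> t = neg_part t + neg_part t * neg_part t" for t
  define \<psi> where "\<psi> v = (sqrt (1 + 4 * max v 0) - 1) / 2" for v :: real
  have \<phi>: "cont0 \<phi>"
    unfolding \<phi>_def by (intro cont0_intros cont0_neg_part)
  have \<psi>: "cont0 \<psi>"
    unfolding \<psi>_def by (auto simp: cont0_def intro!: continuous_intros)
  have "\<phi> = (\<lambda>t. neg_part t - t * neg_part t)"
    by (auto simp: \<phi>_def fun_eq_iff max_def)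
  then have "fc m \<phi> = k - m * k"
    by (simp add: k_def fc_diff[OF m] fc_mult[OF m] fc_id[OF m] cont0_neg_part cont0_mult)
  then have le: "norm (fc m \<phi>) \<le> norm k"
    using contr by simp
  have inv: "\<psi> (\<phi> t) = neg_part t" for t
  proof -
    have "1 + 4 * max (\<phi> t) 0 = (1 + 2 * neg_part t)\<^sup>2"
      by (auto simp: \<phi>_def max_def power2_eq_square algebra_simps)
    then show ?thesis
      by (simp add: \<psi>_def)
  qed
  have "k = fc (fc m \<phi>) \<psi>"
    by (simp add: fc_compose[OF m \<phi> \<psi>] inv k_def)
  moreover have "norm (fc (fc m \<phi>) \<psi>) \<le> \<psi> (norm (fc m \<phi>))"
    by (rule norm_fc_le[OF star_fc[OF m \<phi>] \<psi>]) (auto simp: \<psi>_def)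
  moreover have "\<psi> (norm (fc m \<phi>)) \<le> \<psi> (norm k)"
    using le by (auto simp: \<psi>_def)
  ultimately have "norm k \<le> \<psi> (norm k)"
    by (metis order_trans)
  then have "1 + 2 * norm k \<le> sqrt (1 + 4 * norm k)"
    by (simp add: \<psi>_def)
  then have "(1 + 2 * norm k)\<^sup>2 \<le> (sqrt (1 + 4 * norm k))\<^sup>2"
    by (intro power_mono) auto
  then have "norm k * norm k \<le> 0"
    by (simp add: power2_eq_square algebra_simps)
  then have "k = 0"
    by (metis mult_le_0_iff norm_ge_zero norm_le_zero_iff order_antisym)
  then show ?thesis
    unfolding k_def by (rule psd_if_neg_part_0[OF m])
qed

text \<open>After scaling the roots into the unit ball, \<open>1 - m\<close> is the average of the
  contractions \<open>1 - r'^2\<close> and \<open>1 - s'^2\<close>, hence itself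
  contractive.\<close>

lemma psd_add:
  assumes "psd a" "psd b"
  shows "psd (a + b)"
proof -
  obtain r s where r: "star r = r" "a = r * r" and s: "star s = s" "b = s * s"
    using assms by (auto simp: psd_def)
  define K where "K = norm r + norm s + 1"
  have "K > 0"
    by (simp add: K_def add_nonneg_pos)
  define r' s' where "r' = (1 / K) *\<^sub>R r" and "s' = (1 / K) *\<^sub>R s"
  have r': "star r' = r'" "norm r' \<le> 1" and s': "star s' = s'" "norm s' \<le> 1"
    using \<open>K > 0\<close> by (simp_all add: r'_def s'_def star_scaleR r s divide_le_eq K_def)
  define m where "m = (1/2) *\<^sub>R (r' * r' + s' * s')"
  have "psd m"
  proof (rule psd_if_contractive)
    show "star m = m"
      by (simp add: m_def star_add star_scaleR star_mult r' s')
    fix x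
    have "x - m * x = (1/2) *\<^sub>R (x - r' * r' * x) + (1/2) *\<^sub>R (x - s' * s' * x)"
      by (simp add: m_def algebra_simps flip: scaleR_add_left)
    also have "norm \<dots> \<le> norm ((1/2) *\<^sub>R (x - r' * r' * x)) + norm ((1/2) *\<^sub>R (x - s' * s' * x))"
      by (rule norm_triangle_ineq)
    also have "\<dots> \<le> norm x"
      using norm_diff_square_mult_le[OF r', of x] norm_diff_square_mult_le[OF s', of x] by simp
    finally show "norm (x - m * x) \<le> norm x" .
  qed
  then have "psd ((2 * K\<^sup>2) *\<^sub>R m)"
    by (rule psd_scaleR) simp
  moreover have "(2 * K\<^sup>2) *\<^sub>R m = a + b"
    using \<open>K > 0\<close> by (simp add: m_def r'_def s'_def r s power2_eq_square algebra_simps)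
  ultimately show ?thesis
    by simp
qed

lemma psd_neg_part_eq_0:
  assumes "psd a"
  shows "fc a neg_part = 0"
proof -
  have "cont0 (\<lambda>_. 0)"
    by (simp add: cont0_def)
  then have "fc a neg_part = fc a (\<lambda>_. 0)"
    using fc_psd_cong[OF assms cont0_neg_part] by simp
  then show ?thesis
    by (simp add: fc_zero psd_star assms)
qed

text \<open>
  Kaplansky's argument: for \<open>k\<close> the negative part of \<open>h = y\<^sup>*y\<close> and \<open>z = y k\<close> one has \<open>z\<^sup>*z = -k\<^sup>3\<close>,
  hence \<open>z z\<^sup>*\<close> is positive, and intertwining by \<open>z\<close> kills the negative part \<open>k\<^sup>3\<close> of \<open>z\<^sup>*z\<close>.
\<close>

lemma psd_star_mult_self: "psd (star y * (y::'a::cstar_algebra))"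
proof -
  define h where "h = star y * y"
  have h: "star h = h"
    by (simp add: h_def star_mult star_star)
  let ?n = neg_part
  let ?c = "\<lambda>t. ?n t * (?n t * ?n t)"
  have c: "cont0 ?c" and c': "cont0 (\<lambda>t. - ?c t)"
    by (intro cont0_intros cont0_neg_part)+
  define k where "k = fc h ?n"
  have sk: "star k = k"
    unfolding k_def by (rule star_fc[OF h cont0_neg_part])
  define z where "z = y * k"
  have zz: "star z * z = fc h (\<lambda>t. - ?c t)"
  proof -
    have "(\<lambda>t. - ?c t) = (\<lambda>t. ?n t * (t * ?n t))"
      by (auto simp: max_def)
    then have "fc h (\<lambda>t. - ?c t) = k * (h * k)"
      by (simp add: k_def fc_mult[OF h] fc_id[OF h] cont0_neg_part cont0_mult)
    then show ?thesis
      by (simp add: z_def h_def star_mult sk mult.assoc)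
  qed
  \<comment> \<open>\<open>z = r + i s\<close> is the decomposition into real and imaginary part,
    for which \<open>star z * z + z * star z = 2 (r^2 + s^2)\<close>.\<close>
  define r where "r = (1/2) *\<^sub>R (z + star z)"
  define s where "s = (1/2) *\<^sub>R mult_ii (star z - z)"
  have r: "star r = r" and s: "star s = s"
    by (simp_all add: r_def s_def star_scaleR star_add star_star star_mult_ii star_diff
      scaleC_diff_right add.commute)
  have "z * star z = 2 *\<^sub>R (r * r) + 2 *\<^sub>R (s * s) + - (star z * z)"
  proof -
    have "4 *\<^sub>R (r * r) = (z + star z) * (z + star z)"
      by (simp add: r_def)
    moreover have "4 *\<^sub>R (s * s) = - ((star z - z) * (star z - z))"
      by (simp add: s_def mult_ii_simps algebra_simps)
    ultimately have "4 *\<^sub>R (r * r) + 4 *\<^sub>R (s * s) = 2 *\<^sub>R (z * star z) + 2 *\<^sub>R (star z * z)"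
      by (simp add: algebra_simps scaleR_2)
    then have "(1/2) *\<^sub>R (4 *\<^sub>R (r * r) + 4 *\<^sub>R (s * s)) = (1/2) *\<^sub>R (2 *\<^sub>R (z * star z) + 2 *\<^sub>R (star z * z))"
      by (rule arg_cong)
    then show ?thesis
      by (simp add: scaleR_add_right)
  qed
  moreover have "psd (- (star z * z))"
    unfolding zz fc_minus[OF h c] minus_minus
    by (rule psd_fc_selfadjoint[OF h c]) simp
  moreover have "psd (2 *\<^sub>R (r * r))" "psd (2 *\<^sub>R (s * s))"
    by (intro psd_scaleR psd_square r s; simp)+
  ultimately have "psd (z * star z)"
    by (simp only: psd_add)
  then have "fc (z * star z) ?n * z = 0"
    using psd_neg_part_eq_0 by fastforce
  moreover have "z * fc (star z * z) ?n = fc (z * star z) ?n * z"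
    by (rule fc_intertwine) (simp_all add: star_mult star_star cont0_neg_part mult.assoc)
  ultimately have "star z * z * fc (star z * z) ?n = 0"
    by (simp add: mult.assoc)
  moreover have "fc (star z * z) ?n = fc h ?c"
    unfolding zz fc_compose[OF h c' cont0_neg_part]
    by (rule arg_cong[of _ _ "fc h"]) (auto simp: fun_eq_iff)
  ultimately have "fc h ?c * fc h ?c = 0"
    by (simp add: zz fc_minus[OF h c])
  then have "fc h ?c = 0"
    by (rule selfadjoint_square_eq_0[OF star_fc[OF h c]])
  then have "k * (k * k) = 0"
    by (simp add: k_def fc_mult[OF h] cont0_neg_part cont0_mult)
  then have "(k * k) * (k * k) = 0"
    by (simp add: mult.assoc)
  then have "k * k = 0"
    by (rule selfadjoint_square_eq_0[rotated]) (simp add: star_mult sk)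
  then have "k = 0"
    by (rule selfadjoint_square_eq_0[OF sk])
  then show ?thesis
    unfolding k_def h_def[symmetric] by (rule psd_if_neg_part_0[OF h])
qed

section \<open>Operator inequalities and monotonicity of the norm\<close>

lemma psd_sum: "(\<And>i. i \<in> A \<Longrightarrow> psd (f i)) \<Longrightarrow> psd (sum f A)"
  by (induction A rule: infinite_finite_induct) (simp_all add: psd_add)

lemma psd_sandwich:
  assumes "psd p"
  shows "psd (star x * (p * x))"
proof -
  obtain h where "star h = h" "p = h * h"
    using assms by (auto simp: psd_def)
  then have "star x * (p * x) = star (h * x) * (h * x)"
    by (simp add: star_mult mult.assoc)
  then show ?thesis
    by (simp add: psd_star_mult_self)
qed

text \<open>The positive square root of \<open>R + h\<close>, which need not exist without a unit, applied to \<open>x\<close>.\<close>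

lemma root_complement:
  fixes h :: "'a::cstar_algebra"
  assumes h: "star h = h" "norm h \<le> R"
  obtains w where "star w * w = R *\<^sub>R (star x * x) + star x * (h * x)"
proof -
  have "R \<ge> 0"
    using h norm_ge_zero order_trans by blast
  \<comment> \<open>Subtracting \<open>sqrt R\<close> makes \<open>f\<close> vanish at 0. The
    intended root of \<open>R + h\<close> is the multiplier \<open>sqrt R + F\<close>, and the
    witness is its value at \<open>x\<close>.\<close>
  define f where "f t = sqrt (max (R + t) 0) - sqrt R" for t
  have f: "cont0 f"
    unfolding f_def using \<open>R \<ge> 0\<close> by (auto simp: cont0_def intro!: continuous_intros)
  define F where "F = fc h f"
  have sF: "star F = F"
    unfolding F_def by (rule star_fc[OF h(1) f])
  have "F * F + (2 * sqrt R) *\<^sub>R F = fc h (\<lambda>t. f t * f t + (2 * sqrt R) * f t)"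
    unfolding F_def by (simp only: fc_add[OF h(1) cont0_mult[OF f f] cont0_scale[OF f]]
      fc_mult[OF h(1) f f] fc_scale[OF h(1) f])
  also have "\<dots> = fc h (\<lambda>t. t)"
  proof (rule fc_cong[OF h(1) cont0_add[OF cont0_mult[OF f f] cont0_scale[OF f]] cont0_id])
    fix t
    assume "\<bar>t\<bar> \<le> norm h"
    then have "sqrt (max (R + t) 0) * sqrt (max (R + t) 0) = R + t"
      using h(2) by simp
    moreover have "f t * f t + (2 * sqrt R) * f t
        = sqrt (max (R + t) 0) * sqrt (max (R + t) 0) - sqrt R * sqrt R"
      by (simp add: f_def algebra_simps)
    ultimately show "f t * f t + (2 * sqrt R) * f t = t"
      using \<open>R \<ge> 0\<close> by simp
  qed
  finally have FF: "F * F = h - (2 * sqrt R) *\<^sub>R F"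
    by (simp add: fc_id[OF h(1)] eq_diff_eq)
  have "star (sqrt R *\<^sub>R x + F * x) * (sqrt R *\<^sub>R x + F * x)
      = (sqrt R * sqrt R) *\<^sub>R (star x * x) + (2 * sqrt R) *\<^sub>R (star x * (F * x)) + star x * ((F * F) * x)"
    by (simp add: star_add star_scaleR star_mult sF algebra_simps flip: scaleR_2)
  also have "\<dots> = R *\<^sub>R (star x * x) + star x * (h * x)"
    using \<open>R \<ge> 0\<close> unfolding FF by (simp add: algebra_simps)
  finally show thesis
    by (rule that)
qed

text \<open>The inequality \<open>c \<le> R\<close> for multipliers, sandwiched by \<open>x\<close>;
  by \<open>root_complement\<close> for \<open>- c\<close> the defect is an inner square.\<close>

lemma psd_norm_bound:
  assumes "psd c" "norm c \<le> R"
  shows "psd (R *\<^sub>R (star x * x) - star x * (c * x))"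
proof -
  obtain w where "star w * w = R *\<^sub>R (star x * x) + star x * ((- c) * x)"
    using root_complement[of "- c" R x] assms by (auto simp: star_minus psd_star)
  then show ?thesis
    using psd_star_mult_self[of w] by simp
qed

text \<open>Let \<open>u(p)\<close> be the part of \<open>p\<close> above \<open>R\<close>.
  Sandwiching \<open>p \<le> p + q \<le> R\<close> by its root gives
  \<open>0 \<le> R u(p) - p u(p) = - u(p)^2\<close>. Hence \<open>u(p) = 0\<close>, so
  \<open>p\<close> does not exceed \<open>R\<close>.\<close>

lemma norm_le_norm_add_psd:
  assumes p: "psd p" and q: "psd q"
  shows "norm p \<le> norm (p + q)"
proof -
  define R where "R = norm (p + q)"
  have "R \<ge> 0"
    by (simp add: R_def)
  define u where "u t = max (t - R) 0" for t
  have u: "cont0 u"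
    unfolding u_def using \<open>R \<ge> 0\<close> by (auto simp: cont0_def intro!: continuous_intros)
  have v: "cont0 (\<lambda>t. sqrt (u t))"
    using u by (auto simp: cont0_def intro!: continuous_intros)
  have sp: "star p = p"
    by (rule psd_star[OF p])
  define x where "x = fc p (\<lambda>t. sqrt (u t))"
  have sx: "star x = x"
    unfolding x_def by (rule star_fc[OF sp v])
  have nn: "u t \<ge> 0" for t
    by (simp add: u_def)
  have xx: "x * x = fc p u"
    unfolding x_def fc_mult[OF sp v v, symmetric] by (simp add: nn)
  have xpx: "x * (p * x) = fc p (\<lambda>t. t * u t)"
  proof -
    have "x * (p * x) = fc p (\<lambda>t. sqrt (u t) * (t * sqrt (u t)))"
      unfolding x_def by (simp add: fc_mult[OF sp] v cont0_mult fc_id[OF sp])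
    moreover have "sqrt (u t) * (t * sqrt (u t)) = t * u t" for t
      using nn[of t] by (simp add: mult.left_commute)
    ultimately show ?thesis
      by simp
  qed
  have "psd (R *\<^sub>R (star x * x) - star x * ((p + q) * x) + star x * (q * x))"
    by (intro psd_add psd_norm_bound psd_sandwich p q) (simp add: R_def)
  also have "R *\<^sub>R (star x * x) - star x * ((p + q) * x) + star x * (q * x) = R *\<^sub>R fc p u - fc p (\<lambda>t. t * u t)"
    by (simp add: sx xx xpx algebra_simps)
  also have "\<dots> = fc p (\<lambda>t. R * u t - t * u t)"
    by (simp add: fc_diff[OF sp] fc_scale[OF sp] u cont0_intros)
  also have "(\<lambda>t. R * u t - t * u t) = (\<lambda>t. - (u t * u t))"
    by (auto simp: u_def max_def fun_eq_iff algebra_simps)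
  finally have "fc (fc p (\<lambda>t. - (u t * u t))) neg_part = 0"
    by (rule psd_neg_part_eq_0)
  then have "fc p u * fc p u = 0"
    by (simp add: fc_compose[OF sp] cont0_intros u cont0_neg_part fc_mult[OF sp u u, symmetric]
      max_absorb1)
  then have 0: "fc p u = 0"
    by (rule selfadjoint_square_eq_0[OF star_fc[OF sp u]])
  have "p = fc p (\<lambda>t. t - u t)"
    by (simp add: fc_diff[OF sp] u 0 fc_id[OF sp])
  moreover have "norm (fc p (\<lambda>t. t - u t)) \<le> R"
    by (rule norm_fc_psd_le[OF p cont0_diff[OF cont0_id u]]) (use \<open>R \<ge> 0\<close> in \<open>auto simp: u_def\<close>)
  ultimately show ?thesis
    by (simp add: R_def)
qed


section \<open>The Hilbert module of columns\<close>

definition ip :: "nat \<Rightarrow> (nat \<Rightarrow> 'a::cstar_algebra) \<Rightarrow> (nat \<Rightarrow> 'a) \<Rightarrow> 'a" where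
  "ip n u v = (\<Sum>i<n. star (u i) * v i)"

lemma vec_norm_ip: "vec_norm n v = sqrt (norm (ip n v v))"
  by (simp add: vec_norm_def ip_def)

lemma vec_norm_nonneg [simp]: "0 \<le> vec_norm n v"
  by (simp add: vec_norm_ip)

lemma vec_norm_power2: "(vec_norm n v)\<^sup>2 = norm (ip n v v)"
  by (simp add: vec_norm_ip)

lemma vec_norm_zero [simp]: "vec_norm n (\<lambda>_. 0) = 0"
  by (simp add: vec_norm_def)

lemma vec_norm_cong: "(\<And>i. i < n \<Longrightarrow> u i = v i) \<Longrightarrow> vec_norm n u = vec_norm n v"
  by (simp add: vec_norm_def)

lemma star_ip: "star (ip n u v) = ip n v u"
  by (simp add: ip_def star_sum star_mult star_star)

lemma norm_sum_star_mono:
  assumes "finite B" "A \<subseteq> B"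
  shows "norm (\<Sum>i\<in>A. star (v i) * v i) \<le> norm (\<Sum>i\<in>B. star (v i) * (v i :: 'a::cstar_algebra))"
proof -
  have "(\<Sum>i\<in>B. star (v i) * v i) = (\<Sum>i\<in>A. star (v i) * v i) + (\<Sum>i\<in>B - A. star (v i) * v i)"
    using assms by (metis add.commute sum.subset_diff)
  then show ?thesis
    by (simp add: norm_le_norm_add_psd psd_sum psd_star_mult_self)
qed

lemma vec_norm_mono: "n \<le> m \<Longrightarrow> vec_norm n v \<le> vec_norm m v"
  unfolding vec_norm_def by (intro real_sqrt_le_mono norm_sum_star_mono) auto

lemma vec_norm_reindex:
  assumes "inj_on f {..<n}" "f ` {..<n} \<subseteq> {..<m}"
  shows "vec_norm n (\<lambda>i. v (f i)) \<le> vec_norm m v"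
proof -
  have "(\<Sum>i<n. star (v (f i)) * v (f i)) = (\<Sum>j\<in>f ` {..<n}. star (v j) * v j)"
    by (simp add: sum.reindex assms)
  then show ?thesis
    unfolding vec_norm_def by (simp add: norm_sum_star_mono assms)
qed

lemma norm_component_le:
  assumes "i < n"
  shows "norm (v i) \<le> vec_norm n v"
proof -
  have "(norm (v i))\<^sup>2 = norm (\<Sum>j\<in>{i}. star (v j) * v j)"
    by (simp add: cstar_identity)
  also have "\<dots> \<le> norm (\<Sum>j<n. star (v j) * v j)"
    using assms by (intro norm_sum_star_mono) auto
  finally show ?thesis
    unfolding vec_norm_def by (simp add: real_le_rsqrt)
qed

lemma vec_norm_le_sum: "vec_norm n v \<le> (\<Sum>i<n. norm (v i))"
proof -
  have "norm (\<Sum>i<n. star (v i) * v i) \<le> (\<Sum>i<n. norm (v i) * norm (v i))"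
    by (intro sum_norm_le) (simp add: cstar_identity power2_eq_square)
  also have "\<dots> \<le> (\<Sum>i<n. norm (v i) * (\<Sum>j<n. norm (v j)))"
    by (intro sum_mono mult_left_mono member_le_sum) auto
  also have "\<dots> = (\<Sum>i<n. norm (v i))\<^sup>2"
    by (simp add: sum_distrib_right power2_eq_square)
  finally show ?thesis
    unfolding vec_norm_def by (intro real_le_lsqrt) (auto simp: sum_nonneg)
qed

lemma ip_add_right: "ip n u (\<lambda>i. v i + w i) = ip n u v + ip n u w"
  by (simp add: ip_def distrib_left sum.distrib)

lemma ip_add_left: "ip n (\<lambda>i. v i + w i) u = ip n v u + ip n w u"
  by (simp add: ip_def distrib_right sum.distrib star_add)

lemma vec_norm_scaleC: "vec_norm n (\<lambda>i. scaleC c (v i)) = cmod c * vec_norm n v"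
proof -
  have "ip n (\<lambda>i. scaleC c (v i)) (\<lambda>i. scaleC c (v i)) = scaleC (cnj c * c) (ip n v v)"
    by (simp add: ip_def star_scaleC mult_scaleC_left mult_scaleC_right scaleC_scaleC scaleC_sum_right
      mult.commute)
  then show ?thesis
    by (simp add: vec_norm_ip norm_scaleC norm_mult real_sqrt_mult)
qed

lemma vec_norm_scaleR: "vec_norm n (\<lambda>i. r *\<^sub>R v i) = \<bar>r\<bar> * vec_norm n v"
  using vec_norm_scaleC[of n "of_real r" v] by (simp add: scaleR_scaleC)

text \<open>The vector \<open>v - u b\<close> with \<open>b = ip n u v\<close> has a positive inner
  square, and \<open>star b * ip n u u * b \<le> star b * b\<close>. Together they give
  \<open>star b * b \<le> ip n v v\<close>, and the norm is monotone.\<close>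

lemma cauchy_schwarz_unit_ball:
  assumes u: "norm (ip n u u) \<le> 1"
  shows "(norm (ip n u v))\<^sup>2 \<le> norm (ip n v v)"
proof -
  define b where "b = ip n u v"
  have "psd (\<Sum>i<n. star (v i - u i * b) * (v i - u i * b))"
    by (intro psd_sum psd_star_mult_self)
  moreover have "psd (1 *\<^sub>R (star b * b) - star b * (ip n u u * b))"
  proof (rule psd_norm_bound)
    show "psd (ip n u u)"
      unfolding ip_def by (intro psd_sum psd_star_mult_self)
  qed (rule u)
  ultimately have "psd ((\<Sum>i<n. star (v i - u i * b) * (v i - u i * b))
      + (1 *\<^sub>R (star b * b) - star b * (ip n u u * b)))"
    by (rule psd_add)
  moreover have "(\<Sum>i<n. star (v i - u i * b) * (v i - u i * b))
      = ip n v v - ip n v u * b - star b * ip n u v + star b * (ip n u u * b)"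
    by (simp add: ip_def star_diff star_mult algebra_simps sum.distrib sum_subtractf
      sum_distrib_left sum_distrib_right)
  moreover have "ip n v u = star b"
    by (simp add: b_def star_ip)
  ultimately have "psd (ip n v v - star b * b)"
    by (simp add: b_def)
  from norm_le_norm_add_psd[OF psd_star_mult_self[of b] this]
  show ?thesis
    by (simp add: cstar_identity b_def)
qed

lemma cauchy_schwarz: "norm (ip n u v) \<le> vec_norm n u * vec_norm n v"
proof (cases "vec_norm n u = 0")
  case True
  then have "u i = 0" if "i < n" for i
    using norm_component_le[OF that, of u] by simp
  then show ?thesis
    by (simp add: ip_def)
next
  case False
  define r where "r = 1 / vec_norm n u"
  have "r > 0"
    using False by (simp add: r_def less_le)
  have "vec_norm n (\<lambda>i. r *\<^sub>R u i) = 1"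
    using False by (simp add: vec_norm_scaleR r_def)
  then have "norm (ip n (\<lambda>i. r *\<^sub>R u i) (\<lambda>i. r *\<^sub>R u i)) \<le> 1"
    by (metis vec_norm_power2 one_power2 order_refl)
  from cauchy_schwarz_unit_ball[OF this, of v]
  have "(r * norm (ip n u v))\<^sup>2 \<le> (vec_norm n v)\<^sup>2"
    using \<open>r > 0\<close>
    by (simp add: ip_def star_scaleR vec_norm_power2 scaleR_sum_right[symmetric])
  then have "r * norm (ip n u v) \<le> vec_norm n v"
    by (rule power2_le_imp_le) simp
  then show ?thesis
    using False \<open>r > 0\<close> by (simp add: r_def divide_le_eq mult.commute)
qed

lemma vec_norm_add: "vec_norm n (\<lambda>i. u i + v i) \<le> vec_norm n u + vec_norm n v"
proof (rule power2_le_imp_le)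
  have "(vec_norm n (\<lambda>i. u i + v i))\<^sup>2 = norm ((ip n u u + ip n u v) + (ip n v u + ip n v v))"
    by (simp add: vec_norm_power2 ip_add_left ip_add_right add_ac)
  also have "\<dots> \<le> (norm (ip n u u) + norm (ip n u v)) + (norm (ip n v u) + norm (ip n v v))"
    by (intro norm_triangle_le add_mono norm_triangle_ineq)
  also have "\<dots> \<le> ((vec_norm n u)\<^sup>2 + vec_norm n u * vec_norm n v)
      + (vec_norm n v * vec_norm n u + (vec_norm n v)\<^sup>2)"
    by (intro add_mono cauchy_schwarz) (simp_all add: vec_norm_power2)
  also have "\<dots> = (vec_norm n u + vec_norm n v)\<^sup>2"
    by (simp add: power2_eq_square algebra_simps)
  finally show "(vec_norm n (\<lambda>i. u i + v i))\<^sup>2 \<le> (vec_norm n u + vec_norm n v)\<^sup>2" .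
qed simp

lemma tendsto_vec_norm:
  assumes "\<And>i. i < n \<Longrightarrow> (\<lambda>k. u k i) \<longlonglongrightarrow> v i"
  shows "(\<lambda>k. vec_norm n (u k)) \<longlonglongrightarrow> vec_norm n v"
  unfolding vec_norm_def
  by (intro tendsto_intros tendsto_star) (use assms in auto)


section \<open>The norm of the corners\<close>

definition mv :: "nat \<Rightarrow> 'a::cstar_algebra mat \<Rightarrow> (nat \<Rightarrow> 'a) \<Rightarrow> nat \<Rightarrow> 'a" where
  "mv n a v = (\<lambda>i. \<Sum>j<n. a i j * v j)"

text \<open>In one role the product of two corners of size \<open>n\<close>, in another the partial
  sum of the series in \<open>mat_mult\<close>; therefore only the inner index is truncated.\<close>

definition fm :: "nat \<Rightarrow> 'a::cstar_algebra mat \<Rightarrow> 'a mat \<Rightarrow> 'a mat" where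
  "fm n a b = (\<lambda>i j. \<Sum>k<n. a i k * b k j)"

lemma corner_norm_mv: "corner_norm n a = (SUP v\<in>{v. vec_norm n v \<le> 1}. vec_norm n (mv n a v))"
  by (simp add: corner_norm_def mv_def)

lemma vec_norm_mv_crude:
  "vec_norm n (mv n a v) \<le> (\<Sum>i<n. \<Sum>j<n. norm (a i j)) * vec_norm n v"
proof -
  have "vec_norm n (mv n a v) \<le> (\<Sum>i<n. norm (mv n a v i))"
    by (rule vec_norm_le_sum)
  also have "\<dots> \<le> (\<Sum>i<n. \<Sum>j<n. norm (a i j) * vec_norm n v)"
    unfolding mv_def
    by (intro sum_mono sum_norm_le order_trans[OF norm_mult_ineq] mult_left_mono norm_component_le) auto
  finally show ?thesis
    by (simp add: sum_distrib_right)
qed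

text \<open>The supremum of an unbounded set of reals is an unspecified number, so this is what
  makes \<open>corner_norm\<close> an operator norm.\<close>

lemma bdd_above_mv: "bdd_above ((\<lambda>v. vec_norm n (mv n a v)) ` {v. vec_norm n v \<le> 1})"
proof (rule bdd_aboveI2)
  fix v :: "nat \<Rightarrow> 'a"
  assume "v \<in> {v. vec_norm n v \<le> 1}"
  then have "(\<Sum>i<n. \<Sum>j<n. norm (a i j)) * vec_norm n v \<le> (\<Sum>i<n. \<Sum>j<n. norm (a i j)) * 1"
    by (intro mult_left_mono) (auto intro!: sum_nonneg)
  then show "vec_norm n (mv n a v) \<le> (\<Sum>i<n. \<Sum>j<n. norm (a i j))"
    using vec_norm_mv_crude[of n a v] by simp
qed

lemma mv_scaleR: "mv n a (\<lambda>i. r *\<^sub>R v i) = (\<lambda>i. r *\<^sub>R mv n a v i)"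
  by (simp add: mv_def scaleR_sum_right)

lemma vec_norm_mv_le: "vec_norm n (mv n a v) \<le> corner_norm n a * vec_norm n v"
proof (cases "vec_norm n v = 0")
  case True
  then show ?thesis
    using vec_norm_mv_crude[of n a v] by simp
next
  case False
  then have pos: "vec_norm n v > 0"
    by (simp add: less_le)
  define w where "w = (\<lambda>i. (1 / vec_norm n v) *\<^sub>R v i)"
  have "vec_norm n w \<le> 1"
    using False by (simp add: w_def vec_norm_scaleR)
  then have "vec_norm n (mv n a w) \<le> corner_norm n a"
    unfolding corner_norm_mv by (intro cSUP_upper bdd_above_mv) auto
  then show ?thesis
    using pos by (simp add: w_def mv_scaleR vec_norm_scaleR divide_le_eq)
qed

lemma corner_norm_le:
  assumes "0 \<le> K" and "\<And>v. vec_norm n (mv n a v) \<le> K * vec_norm n v"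
  shows "corner_norm n a \<le> K"
  unfolding corner_norm_mv
proof (rule cSUP_least)
  show "{v :: nat \<Rightarrow> 'a. vec_norm n v \<le> 1} \<noteq> {}"
    using vec_norm_zero[of n] by (metis (mono_tags) empty_iff mem_Collect_eq zero_le_one)
  fix v :: "nat \<Rightarrow> 'a"
  assume "v \<in> {v. vec_norm n v \<le> 1}"
  then have "K * vec_norm n v \<le> K * 1"
    using assms(1) by (intro mult_left_mono) auto
  then show "vec_norm n (mv n a v) \<le> K"
    using assms(2)[of v] by simp
qed

lemma corner_norm_nonneg [simp]: "0 \<le> corner_norm n a"
proof -
  have "vec_norm n (mv n a (\<lambda>_. 0)) \<le> corner_norm n a"
    unfolding corner_norm_mv by (intro cSUP_upper bdd_above_mv) simp
  then show ?thesis
    using vec_norm_nonneg order_trans by blast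
qed

lemma corner_norm_crude: "corner_norm n a \<le> (\<Sum>i<n. \<Sum>j<n. norm (a i j))"
  by (intro corner_norm_le vec_norm_mv_crude sum_nonneg norm_ge_zero)

lemma corner_norm_zero [simp]: "corner_norm n (\<lambda>_ _. 0) = 0"
  by (rule antisym) (use corner_norm_crude[of n "\<lambda>_ _. 0"] in auto)

lemma corner_norm_cong:
  assumes "\<And>i j. i < n \<Longrightarrow> j < n \<Longrightarrow> a i j = b i j"
  shows "corner_norm n a = corner_norm n b"
proof -
  have "vec_norm n (mv n a v) = vec_norm n (mv n b v)" for v
    by (rule vec_norm_cong) (simp add: mv_def assms)
  then show ?thesis
    by (simp add: corner_norm_mv)
qed

lemma corner_norm_add: "corner_norm n (\<lambda>i j. a i j + b i j) \<le> corner_norm n a + corner_norm n b"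
proof (rule corner_norm_le)
  fix v
  have "vec_norm n (mv n (\<lambda>i j. a i j + b i j) v) = vec_norm n (\<lambda>i. mv n a v i + mv n b v i)"
    by (simp add: mv_def distrib_right sum.distrib)
  also have "\<dots> \<le> vec_norm n (mv n a v) + vec_norm n (mv n b v)"
    by (rule vec_norm_add)
  also have "\<dots> \<le> (corner_norm n a + corner_norm n b) * vec_norm n v"
    unfolding distrib_right by (intro add_mono vec_norm_mv_le)
  finally show "vec_norm n (mv n (\<lambda>i j. a i j + b i j) v) \<le> (corner_norm n a + corner_norm n b) * vec_norm n v" .
qed simp

lemma corner_norm_scaleC_le: "corner_norm n (\<lambda>i j. scaleC c (a i j)) \<le> cmod c * corner_norm n a"
proof (rule corner_norm_le)
  fix v
  have "mv n (\<lambda>i j. scaleC c (a i j)) v = (\<lambda>i. scaleC c (mv n a v i))"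
    by (simp add: mv_def scaleC_sum_right mult_scaleC_left)
  then show "vec_norm n (mv n (\<lambda>i j. scaleC c (a i j)) v) \<le> cmod c * corner_norm n a * vec_norm n v"
    by (simp add: vec_norm_scaleC mult.assoc mult_left_mono vec_norm_mv_le)
qed simp

lemma corner_norm_minus: "corner_norm n (\<lambda>i j. - a i j) = corner_norm n a"
proof -
  have "corner_norm n (\<lambda>i j. - b i j) \<le> corner_norm n b" for b :: "'a mat"
    using corner_norm_scaleC_le[of n "-1" b] scaleR_scaleC[of "-1", where ?'a = 'a] by simp
  from this[of a] this[of "\<lambda>i j. - a i j"] show ?thesis
    by simp
qed

lemma corner_norm_entry:
  assumes "i < n" "j < n"
  shows "norm (a i j) \<le> corner_norm n a"
proof (cases "norm (a i j) = 0")
  case True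
  then show ?thesis
    by simp
next
  case False
  \<comment> \<open>There may be no unit to put at position \<open>j\<close>; the adjoint of the
    entry serves instead, by the C*-identity.\<close>
  define v where "v = (\<lambda>k. if k = j then star (a i j) else 0)"
  have "norm (a i j * star (a i j)) = norm (mv n a v i)"
    using assms by (simp add: mv_def v_def if_distrib[of "\<lambda>x. _ * x"] sum.delta cong: if_cong)
  also have "\<dots> \<le> vec_norm n (mv n a v)"
    by (rule norm_component_le[OF assms(1)])
  also have "\<dots> \<le> corner_norm n a * vec_norm n v"
    by (rule vec_norm_mv_le)
  also have "vec_norm n v = sqrt (norm (\<Sum>k<n. if k = j then a i j * star (a i j) else 0))"
    unfolding vec_norm_def v_def
    by (intro arg_cong[of _ _ sqrt] arg_cong[of _ _ norm] sum.cong) (auto simp: star_star)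
  also have "\<dots> = norm (a i j)"
    using assms by (simp add: norm_mult_star)
  finally have "norm (a i j) * norm (a i j) \<le> corner_norm n a * norm (a i j)"
    by (simp add: norm_mult_star power2_eq_square)
  then show ?thesis
    using False by simp
qed

lemma vec_norm_mv_le_larger:
  assumes "n \<le> m"
  shows "vec_norm m (mv n a v) \<le> corner_norm m a * vec_norm n v"
proof -
  define w where "w = (\<lambda>j. if j < n then v j else 0)"
  have sub: "(\<Sum>j<m. f j) = (\<Sum>j<n. f j)" if "\<And>j. n \<le> j \<Longrightarrow> f j = 0" for f :: "nat \<Rightarrow> 'a"
    using assms that by (intro sum.mono_neutral_right) auto
  have "vec_norm m w = vec_norm n v"
    unfolding vec_norm_def by (subst sub) (simp_all add: w_def)
  moreover have "mv m a w = mv n a v"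
    unfolding mv_def by (rule ext, subst sub) (simp_all add: w_def)
  ultimately show ?thesis
    using vec_norm_mv_le[of m a w] by simp
qed

lemma corner_norm_mono:
  assumes "n \<le> m"
  shows "corner_norm n a \<le> corner_norm m a"
  using vec_norm_mono[OF assms] vec_norm_mv_le_larger[OF assms]
  by (intro corner_norm_le corner_norm_nonneg) (blast intro: order_trans)

lemma ip_mv: "ip n (mv n a u) v = ip n u (mv n (mat_star a) v)"
proof -
  have "ip n (mv n a u) v = (\<Sum>i<n. \<Sum>j<n. star (u j) * (star (a i j) * v i))"
    by (simp add: ip_def mv_def star_sum star_mult sum_distrib_right mult.assoc)
  also have "\<dots> = (\<Sum>j<n. \<Sum>i<n. star (u j) * (star (a i j) * v i))"
    by (rule sum.swap)
  finally show ?thesis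
    by (simp add: ip_def mv_def mat_star_def sum_distrib_left)
qed

lemma mat_star_mat_star [simp]: "mat_star (mat_star a) = a"
  by (simp add: mat_star_def star_star)

lemma corner_norm_mat_star: "corner_norm n (mat_star a) = corner_norm n (a :: 'a::cstar_algebra mat)"
proof -
  have "corner_norm n (mat_star b) \<le> corner_norm n b" for b :: "'a mat"
  proof (rule corner_norm_le)
    fix v
    let ?w = "mv n (mat_star b) v"
    have "(vec_norm n ?w)\<^sup>2 = norm (ip n (mv n b ?w) v)"
      by (simp add: vec_norm_power2 ip_mv)
    also have "\<dots> \<le> vec_norm n (mv n b ?w) * vec_norm n v"
      by (rule cauchy_schwarz)
    also have "\<dots> \<le> corner_norm n b * vec_norm n ?w * vec_norm n v"
      by (intro mult_right_mono vec_norm_mv_le) simp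
    finally show "vec_norm n ?w \<le> corner_norm n b * vec_norm n v"
      by (cases "vec_norm n ?w = 0") (simp_all add: power2_eq_square mult_ac less_le)
  qed simp
  from this[of a] this[of "mat_star a"] show ?thesis
    by simp
qed

lemma mv_fm: "mv n (fm n a b) v = mv n a (mv n b v)"
proof
  fix i
  have "mv n (fm n a b) v i = (\<Sum>j<n. \<Sum>k<n. a i k * (b k j * v j))"
    by (simp add: mv_def fm_def sum_distrib_right mult.assoc)
  also have "\<dots> = (\<Sum>k<n. \<Sum>j<n. a i k * (b k j * v j))"
    by (rule sum.swap)
  finally show "mv n (fm n a b) v i = mv n a (mv n b v) i"
    by (simp add: mv_def sum_distrib_left)
qed

lemma corner_norm_fm_le:
  assumes "n \<le> m"
  shows "corner_norm n (fm m a b) \<le> corner_norm m a * corner_norm m b"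
proof -
  have "corner_norm m (fm m a b) \<le> corner_norm m a * corner_norm m b"
  proof (rule corner_norm_le)
    fix v
    have "vec_norm m (mv m (fm m a b) v) \<le> corner_norm m a * vec_norm m (mv m b v)"
      unfolding mv_fm by (rule vec_norm_mv_le)
    also have "\<dots> \<le> corner_norm m a * (corner_norm m b * vec_norm m v)"
      by (intro mult_left_mono vec_norm_mv_le) simp
    finally show "vec_norm m (mv m (fm m a b) v) \<le> corner_norm m a * corner_norm m b * vec_norm m v"
      by (simp add: mult.assoc)
  qed simp
  then show ?thesis
    using corner_norm_mono[OF assms] order_trans by blast
qed

lemma corner_norm_cstar: "(corner_norm n a)\<^sup>2 \<le> corner_norm n (fm n (mat_star a) a)"
proof -
  let ?c = "corner_norm n (fm n (mat_star a) a)"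
  have "corner_norm n a \<le> sqrt ?c"
  proof (rule corner_norm_le)
    fix v
    have "(vec_norm n (mv n a v))\<^sup>2 = norm (ip n v (mv n (fm n (mat_star a) a) v))"
      by (simp add: vec_norm_power2 ip_mv mv_fm)
    also have "\<dots> \<le> vec_norm n v * vec_norm n (mv n (fm n (mat_star a) a) v)"
      by (rule cauchy_schwarz)
    also have "\<dots> \<le> vec_norm n v * (?c * vec_norm n v)"
      by (intro mult_left_mono vec_norm_mv_le) simp
    also have "\<dots> = (sqrt ?c * vec_norm n v)\<^sup>2"
      by (simp add: power_mult_distrib power2_eq_square)
    finally show "vec_norm n (mv n a v) \<le> sqrt ?c * vec_norm n v"
      by (rule power2_le_imp_le) simp
  qed simp
  then have "(corner_norm n a)\<^sup>2 \<le> (sqrt ?c)\<^sup>2"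
    by (intro power_mono) auto
  then show ?thesis
    by simp
qed

text \<open>Lower semicontinuity under entrywise convergence, as a corner has finitely many entries.
  It carries uniform bounds over to series and to limits of Cauchy sequences.\<close>

lemma corner_norm_limit_le:
  assumes lim: "\<And>i j. (\<lambda>k. A k i j) \<longlonglongrightarrow> a i j"
    and le: "\<forall>\<^sub>F k in sequentially. corner_norm n (A k) \<le> M"
  shows "corner_norm n a \<le> M"
proof -
  obtain N where N: "\<And>k. k \<ge> N \<Longrightarrow> corner_norm n (A k) \<le> M"
    using le unfolding eventually_sequentially by blast
  show ?thesis
  proof (rule corner_norm_le)
    show "0 \<le> M"
      using N[of N] corner_norm_nonneg order_trans by blast
    fix v
    show "vec_norm n (mv n a v) \<le> M * vec_norm n v"
    proof (rule LIMSEQ_le_const2)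
      show "(\<lambda>k. vec_norm n (mv n (A k) v)) \<longlonglongrightarrow> vec_norm n (mv n a v)"
        by (intro tendsto_vec_norm) (auto simp: mv_def intro!: tendsto_intros lim)
      show "\<exists>K. \<forall>k\<ge>K. vec_norm n (mv n (A k) v) \<le> M * vec_norm n v"
        using N vec_norm_mv_le[of n _ v]
        by (metis mult_right_mono order_trans vec_norm_nonneg)
    qed
  qed
qed


section \<open>The stabilization as a C*-algebra\<close>

lemma corner_norm_diff_triangle:
  "corner_norm n (\<lambda>i j. a i j - c i j)
    \<le> corner_norm n (\<lambda>i j. a i j - b i j) + corner_norm n (\<lambda>i j. b i j - c i j)"
  using corner_norm_add[of n "\<lambda>i j. a i j - b i j" "\<lambda>i j. b i j - c i j"] by simp

lemma corner_norm_diff_commute: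
  "corner_norm n (\<lambda>i j. a i j - b i j) = corner_norm n (\<lambda>i j. b i j - a i j)"
  using corner_norm_minus[of n "\<lambda>i j. a i j - b i j"] by simp

lemma stab_iff:
  "a \<in> stab \<longleftrightarrow> (\<forall>e>0. \<exists>b\<in>finite_mats. \<forall>n. corner_norm n (\<lambda>i j. a i j - b i j) \<le> e)"
proof -
  have "a - b = (\<lambda>i j. a i j - b i j)" for b
    by (simp add: fun_eq_iff)
  then show ?thesis
    by (simp add: stab_def)
qed

definition supported :: "nat \<Rightarrow> 'a::cstar_algebra mat \<Rightarrow> bool" where
  "supported N b \<longleftrightarrow> (\<forall>i j. N \<le> i \<or> N \<le> j \<longrightarrow> b i j = 0)"

lemma supportedD: "supported N b \<Longrightarrow> N \<le> i \<or> N \<le> j \<Longrightarrow> b i j = 0"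
  unfolding supported_def by blast

lemma supported_mono: "supported N b \<Longrightarrow> N \<le> M \<Longrightarrow> supported M b"
  by (auto simp: supported_def)

lemma finite_matsD: "b \<in> finite_mats \<Longrightarrow> \<exists>N. supported N b"
  unfolding finite_mats_def supported_def by simp

lemma finite_matsI: "supported N b \<Longrightarrow> b \<in> finite_mats"
  unfolding finite_mats_def supported_def by blast

lemma finite_mats_subset_stab: "b \<in> finite_mats \<Longrightarrow> b \<in> stab"
  unfolding stab_iff by (auto intro!: bexI[of _ b])

lemma stab_limit:
  assumes "\<And>e. e > 0 \<Longrightarrow> \<exists>b\<in>stab. \<forall>n. corner_norm n (\<lambda>i j. a i j - b i j) \<le> e"
  shows "a \<in> stab"
  unfolding stab_iff
proof (intro allI impI)
  fix e :: real
  assume "e > 0"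
  then obtain b where "b \<in> stab" and b: "\<And>n. corner_norm n (\<lambda>i j. a i j - b i j) \<le> e/2"
    using assms[of "e/2"] by auto
  then obtain c where "c \<in> finite_mats" and c: "\<And>n. corner_norm n (\<lambda>i j. b i j - c i j) \<le> e/2"
    using \<open>e > 0\<close> unfolding stab_iff by (meson half_gt_zero)
  have "corner_norm n (\<lambda>i j. a i j - c i j) \<le> e" for n
    using corner_norm_diff_triangle[of n a c b] b[of n] c[of n] by simp
  with \<open>c \<in> finite_mats\<close> show "\<exists>b\<in>finite_mats. \<forall>n. corner_norm n (\<lambda>i j. a i j - b i j) \<le> e"
    by blast
qed

text \<open>Reduces membership to finitely supported matrices. All corners of the source may be used
  to bound a single corner of the image, as is necessary for maps that permute rows.\<close>

lemma stab_map:
  assumes a: "a \<in> stab" and fin: "\<And>b. b \<in> finite_mats \<Longrightarrow> T b \<in> stab" and "K > 0"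
    and T: "\<And>b M n. (\<And>m. corner_norm m (\<lambda>i j. a i j - b i j) \<le> M) \<Longrightarrow>
      corner_norm n (\<lambda>i j. T a i j - T b i j) \<le> K * M"
  shows "T a \<in> stab"
proof (rule stab_limit)
  fix e :: real
  assume "e > 0"
  then have "e / K > 0"
    using \<open>K > 0\<close> by simp
  then obtain b where "b \<in> finite_mats" and b: "\<And>n. corner_norm n (\<lambda>i j. a i j - b i j) \<le> e / K"
    using a unfolding stab_iff by blast
  then show "\<exists>b\<in>stab. \<forall>n. corner_norm n (\<lambda>i j. T a i j - b i j) \<le> e"
    using T[OF b] fin \<open>K > 0\<close> by (intro bexI[of _ "T b"]) auto
qed

lemma finite_mats_add: "a \<in> finite_mats \<Longrightarrow> b \<in> finite_mats \<Longrightarrow> (\<lambda>i j. a i j + b i j) \<in> finite_mats"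
proof -
  assume "a \<in> finite_mats" "b \<in> finite_mats"
  then obtain N M where "supported N a" "supported M b"
    using finite_matsD[of a] finite_matsD[of b] by blast
  then show "(\<lambda>i j. a i j + b i j) \<in> finite_mats"
    by (intro finite_matsI[of "max N M"]) (auto simp: supported_def)
qed

lemma stab_add:
  assumes "a \<in> stab" "b \<in> stab"
  shows "(\<lambda>i j. a i j + b i j) \<in> stab"
  unfolding stab_iff
proof (intro allI impI)
  fix e :: real
  assume "e > 0"
  then obtain a' b' where fin: "a' \<in> finite_mats" "b' \<in> finite_mats"
    and a': "\<And>n. corner_norm n (\<lambda>i j. a i j - a' i j) \<le> e/2"
    and b': "\<And>n. corner_norm n (\<lambda>i j. b i j - b' i j) \<le> e/2"
    using assms unfolding stab_iff by (meson half_gt_zero)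
  have "corner_norm n (\<lambda>i j. (a i j + b i j) - (a' i j + b' i j)) \<le> e" for n
    using corner_norm_add[of n "\<lambda>i j. a i j - a' i j" "\<lambda>i j. b i j - b' i j"] a'[of n] b'[of n]
    by (simp add: algebra_simps)
  then show "\<exists>b''\<in>finite_mats. \<forall>n. corner_norm n (\<lambda>i j. (a i j + b i j) - b'' i j) \<le> e"
    by (intro bexI[of _ "\<lambda>i j. a' i j + b' i j"] allI finite_mats_add fin)
qed

lemma stab_scaleC:
  assumes "a \<in> stab"
  shows "(\<lambda>i j. scaleC c (a i j)) \<in> stab"
proof (rule stab_map[OF assms, of "\<lambda>a i j. scaleC c (a i j)" "cmod c + 1"])
  show "(\<lambda>i j. scaleC c (b i j)) \<in> stab" if fin: "b \<in> finite_mats" for b :: "'a mat"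
  proof -
    obtain N where "supported N b"
      using finite_matsD[OF fin] by blast
    then show ?thesis
      by (intro finite_mats_subset_stab finite_matsI[of N]) (simp add: supported_def)
  qed
  fix b M n
  assume M: "\<And>m. corner_norm m (\<lambda>i j. a i j - b i j) \<le> M"
  have "corner_norm n (\<lambda>i j. scaleC c (a i j) - scaleC c (b i j))
      \<le> cmod c * corner_norm n (\<lambda>i j. a i j - b i j)"
    unfolding scaleC_diff_right[symmetric] by (rule corner_norm_scaleC_le)
  also have "\<dots> \<le> (cmod c + 1) * M"
    by (intro mult_mono M) auto
  finally show "corner_norm n (\<lambda>i j. scaleC c (a i j) - scaleC c (b i j)) \<le> (cmod c + 1) * M" .
qed (simp add: add_nonneg_pos)

lemma stab_scaleR: "a \<in> stab \<Longrightarrow> (\<lambda>i j. r *\<^sub>R a i j) \<in> stab"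
  by (simp add: scaleR_scaleC stab_scaleC)

lemma stab_minus: "a \<in> stab \<Longrightarrow> (\<lambda>i j. - a i j) \<in> stab"
  using stab_scaleR[of a "-1"] by simp

lemma stab_diff: "a \<in> stab \<Longrightarrow> b \<in> stab \<Longrightarrow> (\<lambda>i j. a i j - b i j) \<in> stab"
  using stab_add[of a "\<lambda>i j. - b i j"] stab_minus[of b] by simp

lemma stab_zero: "(\<lambda>_ _. 0) \<in> stab"
  by (rule finite_mats_subset_stab) (simp add: finite_mats_def)

lemma mat_star_diff: "(\<lambda>i j. mat_star a i j - mat_star b i j) = mat_star (\<lambda>i j. a i j - b i j)"
  by (simp add: mat_star_def star_diff)

lemma finite_mats_mat_star:
  assumes "b \<in> finite_mats"
  shows "mat_star b \<in> finite_mats"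
proof -
  obtain N where "supported N b"
    using finite_matsD[OF assms] by blast
  then show ?thesis
    by (intro finite_matsI[of N]) (auto simp: supported_def mat_star_def)
qed

lemma stab_mat_star: "a \<in> stab \<Longrightarrow> mat_star a \<in> stab"
  by (rule stab_map[of a mat_star 1])
    (simp_all add: finite_mats_subset_stab finite_mats_mat_star mat_star_diff corner_norm_mat_star)

lemma bdd_above_corner_norm:
  assumes "a \<in> stab"
  shows "bdd_above (range (\<lambda>n. corner_norm n a))"
proof -
  obtain b where "b \<in> finite_mats" and b: "\<And>n. corner_norm n (\<lambda>i j. a i j - b i j) \<le> 1"
    using assms unfolding stab_iff by (meson zero_less_one)
  then obtain N where N: "supported N b"
    using finite_matsD by blast
  have "corner_norm n a \<le> 1 + (\<Sum>i<N. \<Sum>j<N. norm (b i j))" for n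
  proof -
    have "corner_norm n a = corner_norm n (\<lambda>i j. (a i j - b i j) + b i j)"
      by simp
    also have "\<dots> \<le> 1 + corner_norm n b"
      using corner_norm_add[of n "\<lambda>i j. a i j - b i j" b] b[of n] by simp
    also have "corner_norm n b \<le> corner_norm (max n N) b"
      by (rule corner_norm_mono) simp
    also have "\<dots> \<le> (\<Sum>i<max n N. \<Sum>j<max n N. norm (b i j))"
      by (rule corner_norm_crude)
    also have "\<dots> = (\<Sum>i<N. \<Sum>j<max n N. norm (b i j))"
      by (rule sum.mono_neutral_right) (auto simp: supportedD[OF N])
    also have "\<dots> = (\<Sum>i<N. \<Sum>j<N. norm (b i j))"
      by (intro sum.cong sum.mono_neutral_right refl) (auto simp: supportedD[OF N])
    finally show ?thesis
      by simp
  qed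
  then show ?thesis
    by (intro bdd_aboveI2)
qed

lemma corner_norm_le_mat_norm: "a \<in> stab \<Longrightarrow> corner_norm n a \<le> mat_norm a"
  unfolding mat_norm_def by (intro cSUP_upper bdd_above_corner_norm) auto

lemma mat_norm_le: "(\<And>n. corner_norm n a \<le> M) \<Longrightarrow> mat_norm a \<le> M"
  unfolding mat_norm_def by (intro cSUP_least) auto

lemma mat_norm_nonneg: "a \<in> stab \<Longrightarrow> 0 \<le> mat_norm a"
  using corner_norm_le_mat_norm corner_norm_nonneg order_trans by blast

lemma norm_entry_le_mat_norm:
  assumes "a \<in> stab"
  shows "norm (a i j) \<le> mat_norm a"
  using corner_norm_entry[of i "Suc (i + j)" j a]
    corner_norm_le_mat_norm[OF assms, of "Suc (i + j)"] by simp


subsection \<open>Products\<close>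

lemma corner_norm_truncate_rows: "corner_norm n (\<lambda>i j. if i < K then a i j else 0) \<le> corner_norm n a"
proof (rule corner_norm_le)
  fix v
  let ?w = "mv n a v"
  have "mv n (\<lambda>i j. if i < K then a i j else 0) v = (\<lambda>i. if i < K then ?w i else 0)"
    by (auto simp: mv_def)
  moreover have "(\<Sum>i<n. star (if i < K then ?w i else 0) * (if i < K then ?w i else 0))
      = (\<Sum>i<min n K. star (?w i) * ?w i)"
    by (rule sum.mono_neutral_cong_right) auto
  ultimately have "vec_norm n (mv n (\<lambda>i j. if i < K then a i j else 0) v) \<le> vec_norm n ?w"
    unfolding vec_norm_def by (simp add: norm_sum_star_mono)
  then show "vec_norm n (mv n (\<lambda>i j. if i < K then a i j else 0) v) \<le> corner_norm n a * vec_norm n v"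
    using vec_norm_mv_le order_trans by blast
qed simp

lemma corner_norm_fm:
  assumes A: "\<And>m. corner_norm m a \<le> A" and B: "\<And>m. corner_norm m b \<le> B"
  shows "corner_norm n (fm K a b) \<le> A * B"
proof -
  \<comment> \<open>The rows of \<open>b\<close> from \<open>K\<close> on are set to 0, so that the
    inner sum up to \<open>K\<close> equals the inner sum up to \<open>M\<close> and the product is
    taken in one corner of size \<open>M\<close>.\<close>
  define M where "M = max n K"
  let ?b = "\<lambda>i j. if i < K then b i j else 0"
  have "fm K a b = fm M a ?b"
    unfolding fm_def M_def by (intro ext sum.mono_neutral_cong_left) auto
  then have "corner_norm n (fm K a b) \<le> corner_norm M a * corner_norm M ?b"
    by (simp only:) (rule corner_norm_fm_le, simp add: M_def)
  also have "\<dots> \<le> A * B"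
    using order_trans[OF corner_norm_nonneg A] order_trans[OF corner_norm_truncate_rows B]
    by (intro mult_mono A) auto
  finally show ?thesis .
qed

lemma fm_diff_left: "fm K (\<lambda>i j. a i j - a' i j) b = (\<lambda>i j. fm K a b i j - fm K a' b i j)"
  by (simp add: fm_def algebra_simps sum_subtractf)

lemma fm_diff_right: "fm K a (\<lambda>i j. b i j - b' i j) = (\<lambda>i j. fm K a b i j - fm K a b' i j)"
  by (simp add: fm_def algebra_simps sum_subtractf)

lemma fm_finite_left:
  assumes "supported N a" "N \<le> K"
  shows "fm K a b = fm N a b"
  unfolding fm_def by (intro ext sum.mono_neutral_right) (use assms in \<open>auto simp: supported_def\<close>)

text \<open>The entrywise series need not converge absolutely, so tails are not estimated termwise.
  For a finitely supported \<open>a'\<close> near \<open>a\<close> the partial sums are eventually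
  constant, and replacing \<open>a\<close> by \<open>a'\<close> costs at most \<open>e / 2\<close>
  in every corner and for every truncation.\<close>

lemma fm_cauchy:
  assumes a: "a \<in> stab" and b: "b \<in> stab" and "e > 0"
  shows "\<exists>N. \<forall>K\<ge>N. \<forall>L\<ge>N. \<forall>n. corner_norm n (\<lambda>i j. fm K a b i j - fm L a b i j) \<le> e"
proof -
  define B where "B = mat_norm b + 1"
  have "B > 0"
    using mat_norm_nonneg[OF b] by (simp add: B_def)
  have B: "corner_norm m b \<le> B" for m
    using corner_norm_le_mat_norm[OF b, of m] by (simp add: B_def)
  have "e / (2 * B) > 0"
    using \<open>e > 0\<close> \<open>B > 0\<close> by simp
  then obtain a' where "a' \<in> finite_mats" and a': "\<And>n. corner_norm n (\<lambda>i j. a i j - a' i j) \<le> e / (2 * B)"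
    using a unfolding stab_iff by blast
  then obtain N where N: "supported N a'"
    using finite_matsD by blast
  have half: "corner_norm n (\<lambda>i j. fm K a b i j - fm K a' b i j) \<le> e / 2" for n K
    using corner_norm_fm[OF a' B, of n K] \<open>B > 0\<close> by (simp add: fm_diff_left)
  have "corner_norm n (\<lambda>i j. fm K a b i j - fm L a b i j) \<le> e" if "K \<ge> N" "L \<ge> N" for K L n
  proof -
    have "corner_norm n (\<lambda>i j. fm N a' b i j - fm L a b i j) \<le> e / 2"
      using half[of n L] fm_finite_left[OF N \<open>L \<ge> N\<close>] corner_norm_diff_commute[of n "fm L a b" "fm N a' b"]
      by simp
    moreover have "corner_norm n (\<lambda>i j. fm K a b i j - fm N a' b i j) \<le> e / 2"
      using half[of n K] fm_finite_left[OF N \<open>K \<ge> N\<close>] by simp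
    ultimately show ?thesis
      using corner_norm_diff_triangle[of n "fm K a b" "fm L a b" "fm N a' b"] by simp
  qed
  then show ?thesis
    by blast
qed

lemma summable_mat_mult:
  assumes a: "a \<in> stab" and b: "b \<in> stab"
  shows "summable (\<lambda>k. a i k * b k j)"
  unfolding summable_iff_convergent
proof (rule Cauchy_convergent, rule metric_CauchyI)
  fix e :: real
  assume "e > 0"
  then obtain N where N: "\<And>K L n. K \<ge> N \<Longrightarrow> L \<ge> N \<Longrightarrow>
      corner_norm n (\<lambda>i j. fm K a b i j - fm L a b i j) \<le> e / 2"
    using fm_cauchy[OF a b, of "e/2"] by auto
  have "dist (fm K a b i j) (fm L a b i j) < e" if "K \<ge> N" "L \<ge> N" for K L
    using corner_norm_entry[of i "Suc (i + j)" j "\<lambda>i j. fm K a b i j - fm L a b i j"]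
      N[OF that, of "Suc (i + j)"] \<open>e > 0\<close>
    by (simp add: dist_norm)
  then show "\<exists>M. \<forall>m\<ge>M. \<forall>n\<ge>M. dist (\<Sum>k<m. a i k * b k j) (\<Sum>k<n. a i k * b k j) < e"
    unfolding fm_def by blast
qed

lemma fm_tendsto:
  assumes "a \<in> stab" "b \<in> stab"
  shows "(\<lambda>K. fm K a b i j) \<longlonglongrightarrow> mat_mult a b i j"
  unfolding fm_def mat_mult_def by (rule summable_LIMSEQ[OF summable_mat_mult[OF assms]])

lemma mat_mult_approx:
  assumes a: "a \<in> stab" and b: "b \<in> stab" and "e > 0"
  shows "\<exists>N. \<forall>K\<ge>N. \<forall>n. corner_norm n (\<lambda>i j. mat_mult a b i j - fm K a b i j) \<le> e"
proof -
  obtain N where N: "\<And>K L n. K \<ge> N \<Longrightarrow> L \<ge> N \<Longrightarrow>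
      corner_norm n (\<lambda>i j. fm K a b i j - fm L a b i j) \<le> e"
    using fm_cauchy[OF assms] by auto
  have "corner_norm n (\<lambda>i j. mat_mult a b i j - fm K a b i j) \<le> e" if "K \<ge> N" for K n
  proof (rule corner_norm_limit_le[where A = "\<lambda>L i j. fm L a b i j - fm K a b i j"])
    show "(\<lambda>L. fm L a b i j - fm K a b i j) \<longlonglongrightarrow> mat_mult a b i j - fm K a b i j" for i j
      by (intro tendsto_intros fm_tendsto a b)
    show "\<forall>\<^sub>F L in sequentially. corner_norm n (\<lambda>i j. fm L a b i j - fm K a b i j) \<le> e"
      using eventually_ge_at_top[of N] by eventually_elim (rule N[OF _ that])
  qed
  then show ?thesis
    by blast
qed

lemma finite_mats_fm:
  assumes "a \<in> finite_mats" "b \<in> finite_mats"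
  shows "fm K a b \<in> finite_mats"
proof -
  obtain N M where "supported N a" "supported M b"
    using finite_matsD[OF assms(1)] finite_matsD[OF assms(2)] by blast
  then show ?thesis
    by (intro finite_matsI[of "max N M"]) (auto simp: supported_def fm_def)
qed

lemma corner_norm_mat_mult:
  assumes a: "a \<in> stab" and b: "b \<in> stab"
  shows "corner_norm n (mat_mult a b) \<le> mat_norm a * mat_norm b"
proof (rule corner_norm_limit_le[OF fm_tendsto[OF a b]])
  show "\<forall>\<^sub>F K in sequentially. corner_norm n (fm K a b) \<le> mat_norm a * mat_norm b"
    by (intro always_eventually allI corner_norm_fm corner_norm_le_mat_norm a b)
qed

lemma stab_fm:
  assumes a: "a \<in> stab" and b: "b \<in> stab"
  shows "fm K a b \<in> stab"
proof -
  have bound: "corner_norm m c \<le> mat_norm c + 1" if "c \<in> stab" for m and c :: "'a mat"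
    using corner_norm_le_mat_norm[OF that, of m] by simp
  have "fm K a' b \<in> stab" if fin: "a' \<in> finite_mats" for a'
  proof (rule stab_map[OF b, of "fm K a'" "mat_norm a' + 1"])
    have a': "a' \<in> stab"
      by (rule finite_mats_subset_stab[OF fin])
    show "0 < mat_norm a' + 1"
      using mat_norm_nonneg[OF a'] by simp
    show "corner_norm n (\<lambda>i j. fm K a' b i j - fm K a' b' i j) \<le> (mat_norm a' + 1) * M"
      if "\<And>m. corner_norm m (\<lambda>i j. b i j - b' i j) \<le> M" for b' M n
      using corner_norm_fm[OF bound[OF a'] that] by (simp add: fm_diff_right)
  qed (intro finite_mats_subset_stab finite_mats_fm fin)
  then show ?thesis
  proof (rule stab_map[OF a, of "\<lambda>a. fm K a b" "mat_norm b + 1"])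
    show "0 < mat_norm b + 1"
      using mat_norm_nonneg[OF b] by simp
    show "corner_norm n (\<lambda>i j. fm K a b i j - fm K a' b i j) \<le> (mat_norm b + 1) * M"
      if "\<And>m. corner_norm m (\<lambda>i j. a i j - a' i j) \<le> M" for a' M n
      using corner_norm_fm[OF that bound[OF b]] by (simp add: fm_diff_left mult.commute)
  qed
qed

lemma stab_mat_mult:
  assumes a: "a \<in> stab" and b: "b \<in> stab"
  shows "mat_mult a b \<in> stab"
  by (rule stab_limit) (use mat_mult_approx[OF a b] stab_fm[OF a b] in blast)


subsection \<open>The type of stable matrices\<close>

text \<open>As a type, the stabilization can be made an instance of \<open>cstar_algebra\<close>, so
  that the functional calculus and the theory of positive elements apply to it.\<close>

typedef (overloaded) 'a smat = "stab :: 'a::cstar_algebra mat set"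
  by (rule exI[of _ "\<lambda>_ _. 0"], rule stab_zero)

lemma Rep_smat_stab [simp]: "Rep_smat x \<in> stab"
  by (rule Rep_smat)

lemma smat_eqI: "(\<And>i j. Rep_smat x i j = Rep_smat y i j) \<Longrightarrow> x = y"
  by (simp add: Rep_smat_inject[symmetric] fun_eq_iff)

instantiation smat :: (cstar_algebra) real_normed_vector
begin

definition zero_smat :: "'a smat" where
  "0 = Abs_smat (\<lambda>_ _. 0)"

definition plus_smat :: "'a smat \<Rightarrow> 'a smat \<Rightarrow> 'a smat" where
  "x + y = Abs_smat (\<lambda>i j. Rep_smat x i j + Rep_smat y i j)"

definition minus_smat :: "'a smat \<Rightarrow> 'a smat \<Rightarrow> 'a smat" where
  "x - y = Abs_smat (\<lambda>i j. Rep_smat x i j - Rep_smat y i j)"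

definition uminus_smat :: "'a smat \<Rightarrow> 'a smat" where
  "- x = Abs_smat (\<lambda>i j. - Rep_smat x i j)"

definition scaleR_smat :: "real \<Rightarrow> 'a smat \<Rightarrow> 'a smat" where
  "r *\<^sub>R x = Abs_smat (\<lambda>i j. r *\<^sub>R Rep_smat x i j)"

definition norm_smat :: "'a smat \<Rightarrow> real" where
  "norm x = mat_norm (Rep_smat x)"

definition dist_smat :: "'a smat \<Rightarrow> 'a smat \<Rightarrow> real" where
  "dist_smat x y = norm (x - y)"

definition sgn_smat :: "'a smat \<Rightarrow> 'a smat" where
  "sgn_smat x = inverse (norm x) *\<^sub>R x"

definition uniformity_smat :: "('a smat \<times> 'a smat) filter" where
  "uniformity_smat = (INF e\<in>{0 <..}. principal {(x, y). dist x y < e})"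

definition open_smat :: "'a smat set \<Rightarrow> bool" where
  "open_smat U \<longleftrightarrow> (\<forall>x\<in>U. \<forall>\<^sub>F (x', y) in uniformity. x' = x \<longrightarrow> y \<in> U)"

lemma Rep_smat_zero: "Rep_smat 0 i j = (0::'a)"
  by (simp add: zero_smat_def Abs_smat_inverse stab_zero)

lemma Rep_smat_plus: "Rep_smat (x + y) i j = Rep_smat x i j + (Rep_smat y i j :: 'a)"
  by (simp add: plus_smat_def Abs_smat_inverse stab_add)

lemma Rep_smat_minus: "Rep_smat (x - y) i j = Rep_smat x i j - (Rep_smat y i j :: 'a)"
  by (simp add: minus_smat_def Abs_smat_inverse stab_diff)

lemma Rep_smat_uminus: "Rep_smat (- x) i j = - (Rep_smat x i j :: 'a)"
  by (simp add: uminus_smat_def Abs_smat_inverse stab_minus)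

lemma Rep_smat_scaleR: "Rep_smat (r *\<^sub>R x) i j = r *\<^sub>R (Rep_smat x i j :: 'a)"
  by (simp add: scaleR_smat_def Abs_smat_inverse stab_scaleR)

lemmas Rep_smat_simps = Rep_smat_zero Rep_smat_plus Rep_smat_minus Rep_smat_uminus Rep_smat_scaleR

lemma corner_norm_le_norm: "corner_norm n (Rep_smat x) \<le> norm (x :: 'a smat)"
  unfolding norm_smat_def by (rule corner_norm_le_mat_norm) simp

lemma norm_smat_le: "(\<And>n. corner_norm n (Rep_smat x) \<le> M) \<Longrightarrow> norm (x :: 'a smat) \<le> M"
  unfolding norm_smat_def by (rule mat_norm_le)

lemma norm_entry_le_norm: "norm (Rep_smat x i j) \<le> norm (x :: 'a smat)"
  unfolding norm_smat_def by (rule norm_entry_le_mat_norm) simp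

instance
proof
  fix x y z :: "'a smat" and r s :: real
  show "x + y + z = x + (y + z)" "x + y = y + x" "0 + x = x" "- x + x = 0" "x - y = x + - y"
    "r *\<^sub>R (x + y) = r *\<^sub>R x + r *\<^sub>R y" "(r + s) *\<^sub>R x = r *\<^sub>R x + s *\<^sub>R x"
    "r *\<^sub>R s *\<^sub>R x = (r * s) *\<^sub>R x" "1 *\<^sub>R x = x"
    by (auto intro!: smat_eqI simp: Rep_smat_simps algebra_simps)
  show "dist x y = norm (x - y)" "sgn x = inverse (norm x) *\<^sub>R x"
    "uniformity = (INF e\<in>{0 <..}. principal {(x :: 'a smat, y). dist x y < e})"
    "open U \<longleftrightarrow> (\<forall>x\<in>U. \<forall>\<^sub>F (x', y) in uniformity. x' = x \<longrightarrow> y \<in> U)" for U :: "'a smat set"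
    by (fact dist_smat_def sgn_smat_def uniformity_smat_def open_smat_def)+
  show "norm x = 0 \<longleftrightarrow> x = 0"
  proof
    assume "norm x = 0"
    then have "norm (Rep_smat x i j) \<le> 0" for i j
      using norm_entry_le_norm[of x i j] by simp
    then show "x = 0"
      by (intro smat_eqI) (simp add: Rep_smat_simps)
  next
    assume "x = 0"
    then have "Rep_smat x = (\<lambda>_ _. 0)"
      by (simp add: fun_eq_iff Rep_smat_simps)
    then show "norm x = 0"
      by (simp add: norm_smat_def mat_norm_def)
  qed
  show "norm (x + y) \<le> norm x + norm y"
  proof (rule norm_smat_le)
    fix n
    have "corner_norm n (Rep_smat (x + y)) = corner_norm n (\<lambda>i j. Rep_smat x i j + Rep_smat y i j)"
      by (rule corner_norm_cong) (simp add: Rep_smat_simps)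
    then show "corner_norm n (Rep_smat (x + y)) \<le> norm x + norm y"
      using corner_norm_add[of n "Rep_smat x" "Rep_smat y"] corner_norm_le_norm[of n x]
        corner_norm_le_norm[of n y] by simp
  qed
  have scale: "norm (r *\<^sub>R x) \<le> \<bar>r\<bar> * norm x" for r and x :: "'a smat"
  proof (rule norm_smat_le)
    fix n
    have "corner_norm n (Rep_smat (r *\<^sub>R x)) = corner_norm n (\<lambda>i j. scaleC (of_real r) (Rep_smat x i j))"
      by (rule corner_norm_cong) (simp add: Rep_smat_simps scaleR_scaleC)
    also have "\<dots> \<le> cmod (of_real r) * corner_norm n (Rep_smat x)"
      by (rule corner_norm_scaleC_le)
    also have "\<dots> \<le> \<bar>r\<bar> * norm x"
      using corner_norm_le_norm[of n x] by (simp add: mult_left_mono)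
    finally show "corner_norm n (Rep_smat (r *\<^sub>R x)) \<le> \<bar>r\<bar> * norm x" .
  qed
  show "norm (r *\<^sub>R x) = \<bar>r\<bar> * norm x"
  proof (cases "r = 0")
    case True
    then show ?thesis
      using scale[of r x] corner_norm_le_norm[of 0 "r *\<^sub>R x"] corner_norm_nonneg[of 0 "Rep_smat (r *\<^sub>R x)"]
      by (simp only: abs_zero mult_zero_left)
  next
    case False
    have "x = inverse r *\<^sub>R (r *\<^sub>R x)"
      using False by (intro smat_eqI) (simp add: Rep_smat_simps)
    then have "norm x \<le> \<bar>inverse r\<bar> * norm (r *\<^sub>R x)"
      using scale[of "inverse r" "r *\<^sub>R x"] by simp
    then have "\<bar>r\<bar> * norm x \<le> norm (r *\<^sub>R x)"
      using False by (simp add: field_simps)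
    then show ?thesis
      using scale[of r x] by simp
  qed
qed

end

lemma Rep_smat_diff_fun: "Rep_smat (x - y) = (\<lambda>i j. Rep_smat x i j - Rep_smat y i j)"
  by (simp add: fun_eq_iff Rep_smat_minus)

instance smat :: (cstar_algebra) complete_space
proof
  fix X :: "nat \<Rightarrow> 'a smat"
  assume "Cauchy X"
  have "\<exists>l. (\<lambda>n. Rep_smat (X n) i j) \<longlonglongrightarrow> l" for i j
  proof -
    have "Cauchy (\<lambda>n. Rep_smat (X n) i j)"
    proof (rule metric_CauchyI)
      fix e :: real
      assume "e > 0"
      then obtain M where M: "\<And>m n. m \<ge> M \<Longrightarrow> n \<ge> M \<Longrightarrow> dist (X m) (X n) < e"
        using metric_CauchyD[OF \<open>Cauchy X\<close> \<open>e > 0\<close>] by blast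
      have "dist (Rep_smat (X m) i j) (Rep_smat (X n) i j) \<le> dist (X m) (X n)" for m n
        using norm_entry_le_norm[of "X m - X n" i j] by (simp add: dist_norm Rep_smat_minus)
      with M show "\<exists>M. \<forall>m\<ge>M. \<forall>n\<ge>M. dist (Rep_smat (X m) i j) (Rep_smat (X n) i j) < e"
        by (meson le_less_trans)
    qed
    then show ?thesis
      using Cauchy_convergent convergentD by blast
  qed
  then obtain a where a: "\<And>i j. (\<lambda>n. Rep_smat (X n) i j) \<longlonglongrightarrow> a i j"
    by metis
  have approx: "\<exists>N. \<forall>m\<ge>N. \<forall>n. corner_norm n (\<lambda>i j. a i j - Rep_smat (X m) i j) \<le> e" if pos: "e > 0" for e
  proof -
    obtain N where N: "\<And>m n. m \<ge> N \<Longrightarrow> n \<ge> N \<Longrightarrow> dist (X m) (X n) < e"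
      using metric_CauchyD[OF \<open>Cauchy X\<close> pos] by blast
    have "corner_norm n (\<lambda>i j. a i j - Rep_smat (X m) i j) \<le> e" if "m \<ge> N" for m n
    proof (rule corner_norm_limit_le[where A = "\<lambda>k i j. Rep_smat (X k) i j - Rep_smat (X m) i j"])
      show "(\<lambda>k. Rep_smat (X k) i j - Rep_smat (X m) i j) \<longlonglongrightarrow> a i j - Rep_smat (X m) i j" for i j
        by (intro tendsto_intros a)
      show "\<forall>\<^sub>F k in sequentially. corner_norm n (\<lambda>i j. Rep_smat (X k) i j - Rep_smat (X m) i j) \<le> e"
        using eventually_ge_at_top[of N]
      proof eventually_elim
        case (elim k)
        then show ?case
          using corner_norm_le_norm[of n "X k - X m"] N[of k m] that
          by (simp add: dist_norm Rep_smat_diff_fun)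
      qed
    qed
    then show ?thesis
      by blast
  qed
  have "a \<in> stab"
    by (rule stab_limit) (use approx Rep_smat_stab in blast)
  have "X \<longlonglongrightarrow> Abs_smat a"
  proof (rule metric_LIMSEQ_I)
    fix e :: real
    assume "e > 0"
    then obtain N where N: "\<And>m n. m \<ge> N \<Longrightarrow> corner_norm n (\<lambda>i j. a i j - Rep_smat (X m) i j) \<le> e / 2"
      using approx[of "e/2"] by auto
    have "dist (X m) (Abs_smat a) < e" if "m \<ge> N" for m
    proof -
      have "norm (Abs_smat a - X m) \<le> e / 2"
        by (rule norm_smat_le) (simp only: Rep_smat_diff_fun Abs_smat_inverse[OF \<open>a \<in> stab\<close>] N[OF that])
      then show ?thesis
        using \<open>e > 0\<close> by (simp add: dist_norm norm_minus_commute)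
    qed
    then show "\<exists>N. \<forall>n\<ge>N. dist (X n) (Abs_smat a) < e"
      by blast
  qed
  then show "convergent X"
    by (rule convergentI)
qed

section \<open>The algebra structure on stable matrices\<close>

instantiation smat :: (cstar_algebra) times
begin

definition times_smat :: "'a smat \<Rightarrow> 'a smat \<Rightarrow> 'a smat" where
  "x * y = Abs_smat (mat_mult (Rep_smat x) (Rep_smat y))"

instance ..

end

lemma Rep_smat_times: "Rep_smat (x * y) = mat_mult (Rep_smat x) (Rep_smat y)"
  by (simp add: times_smat_def Abs_smat_inverse stab_mat_mult)

lemma smat_distrib_right: "(x + y) * z = x * z + y * (z :: 'a::cstar_algebra smat)"
  by (rule smat_eqI) (simp add: Rep_smat_times Rep_smat_simps mat_mult_def distrib_right
    suminf_add[symmetric] summable_mat_mult)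

lemma smat_distrib_left: "x * (y + z) = x * y + x * (z :: 'a::cstar_algebra smat)"
  by (rule smat_eqI) (simp add: Rep_smat_times Rep_smat_simps mat_mult_def distrib_left
    suminf_add[symmetric] summable_mat_mult)

lemma smat_scaleR_left: "(r *\<^sub>R x) * y = r *\<^sub>R (x * (y :: 'a::cstar_algebra smat))"
  by (rule smat_eqI) (simp add: Rep_smat_times Rep_smat_simps mat_mult_def
    suminf_scaleR_right summable_mat_mult)

lemma smat_scaleR_right: "x * (r *\<^sub>R y) = r *\<^sub>R (x * (y :: 'a::cstar_algebra smat))"
  by (rule smat_eqI) (simp add: Rep_smat_times Rep_smat_simps mat_mult_def
    suminf_scaleR_right summable_mat_mult)

lemma smat_norm_mult: "norm (x * y) \<le> norm x * norm (y :: 'a::cstar_algebra smat)"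
  by (rule norm_smat_le) (simp add: Rep_smat_times norm_smat_def corner_norm_mat_mult)

lemma bounded_bilinear_smat_times:
  "bounded_bilinear ((*) :: 'a::cstar_algebra smat \<Rightarrow> 'a smat \<Rightarrow> 'a smat)"
  by (rule bounded_bilinear.intro)
    (auto simp: smat_distrib_right smat_distrib_left smat_scaleR_left smat_scaleR_right
      intro!: exI[of _ 1] smat_norm_mult)

lemma finite_smat_dense:
  fixes x :: "'a::cstar_algebra smat"
  obtains f where "\<And>n. Rep_smat (f n) \<in> finite_mats" and "f \<longlonglongrightarrow> x"
proof -
  have "\<exists>y. Rep_smat y \<in> finite_mats \<and> norm (y - x) \<le> 1 / real (Suc n)" for n
  proof -
    have "1 / real (Suc n) > 0"
      by simp
    then obtain b where b: "b \<in> finite_mats"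
      "\<And>m. corner_norm m (\<lambda>i j. Rep_smat x i j - b i j) \<le> 1 / real (Suc n)"
      using Rep_smat_stab[of x] unfolding stab_iff by blast
    have "norm (x - Abs_smat b) \<le> 1 / real (Suc n)"
      by (rule norm_smat_le)
        (simp only: Rep_smat_diff_fun Abs_smat_inverse[OF finite_mats_subset_stab[OF b(1)]] b(2))
    then show ?thesis
      using b(1) by (intro exI[of _ "Abs_smat b"])
        (simp add: Abs_smat_inverse finite_mats_subset_stab norm_minus_commute)
  qed
  then obtain f where f: "\<And>n. Rep_smat (f n) \<in> finite_mats" "\<And>n. norm (f n - x) \<le> 1 / real (Suc n)"
    by metis
  have "(\<lambda>n. f n - x) \<longlonglongrightarrow> 0"
    by (rule Lim_null_comparison[OF _ inverse_Suc_tendsto]) (intro always_eventually allI f(2))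
  then have "f \<longlonglongrightarrow> x"
    using Lim_null by blast
  with f(1) show thesis
    by (rule that)
qed

lemma mat_mult_finite_left:
  assumes "supported N a"
  shows "mat_mult a b = fm N a b"
  unfolding mat_mult_def fm_def by (intro ext suminf_finite) (use assms in \<open>auto simp: supported_def\<close>)

lemma fm_assoc: "fm N (fm N a b) c = fm N a (fm N b c)"
proof (intro ext)
  fix i j
  have "fm N (fm N a b) c i j = (\<Sum>k<N. \<Sum>l<N. a i l * (b l k * c k j))"
    by (simp add: fm_def sum_distrib_right mult.assoc)
  also have "\<dots> = (\<Sum>l<N. \<Sum>k<N. a i l * (b l k * c k j))"
    by (rule sum.swap)
  finally show "fm N (fm N a b) c i j = fm N a (fm N b c) i j"
    by (simp add: fm_def sum_distrib_left)
qed

text \<open>Conditional convergence does not justify an exchange of the two series. If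
  \<open>x\<close> and \<open>y\<close> are finitely supported, the inner sums are finite; the
  general case follows by density and continuity of the product.\<close>

lemma smat_mult_assoc: "x * y * z = x * (y * (z :: 'a::cstar_algebra smat))"
proof -
  interpret bounded_bilinear "(*) :: 'a smat \<Rightarrow> 'a smat \<Rightarrow> 'a smat"
    by (rule bounded_bilinear_smat_times)
  obtain f where f: "\<And>n. Rep_smat (f n) \<in> finite_mats" "f \<longlonglongrightarrow> x"
    using finite_smat_dense[of x] by blast
  obtain g where g: "\<And>n. Rep_smat (g n) \<in> finite_mats" "g \<longlonglongrightarrow> y"
    using finite_smat_dense[of y] by blast
  have "f n * g n * z = f n * (g n * z)" for n
  proof -
    obtain N M where "supported N (Rep_smat (f n))"
      "supported M (Rep_smat (g n))"
      using finite_matsD[OF f(1)[of n]] finite_matsD[OF g(1)[of n]] by blast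
    then have K: "supported (max N M) (Rep_smat (f n))"
      "supported (max N M) (Rep_smat (g n))"
      by (auto intro: supported_mono)
    have fg: "Rep_smat (f n * g n) = fm (max N M) (Rep_smat (f n)) (Rep_smat (g n))"
      unfolding Rep_smat_times by (rule mat_mult_finite_left[OF K(1)])
    then have "supported (max N M) (Rep_smat (f n * g n))"
      using K by (auto simp: fm_def supported_def)
    then have "Rep_smat (f n * g n * z) = fm (max N M) (Rep_smat (f n * g n)) (Rep_smat z)"
      unfolding Rep_smat_times[of "f n * g n"] by (rule mat_mult_finite_left)
    also have "\<dots> = fm (max N M) (Rep_smat (f n)) (fm (max N M) (Rep_smat (g n)) (Rep_smat z))"
      unfolding fg by (rule fm_assoc)
    also have "\<dots> = Rep_smat (f n * (g n * z))"
      unfolding Rep_smat_times mat_mult_finite_left[OF K(1)] mat_mult_finite_left[OF K(2)] by (rule refl)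
    finally show ?thesis
      by (simp add: Rep_smat_inject)
  qed
  then have "(\<lambda>n. f n * (g n * z)) \<longlonglongrightarrow> x * y * z"
    using tendsto[OF tendsto[OF f(2) g(2)] tendsto_const[of z]] by simp
  moreover have "(\<lambda>n. f n * (g n * z)) \<longlonglongrightarrow> x * (y * z)"
    by (intro tendsto f(2) g(2) tendsto_const)
  ultimately show ?thesis
    using LIMSEQ_unique by blast
qed

instance smat :: (cstar_algebra) real_normed_algebra
  by standard (rule smat_mult_assoc smat_distrib_right smat_distrib_left smat_scaleR_left
    smat_scaleR_right smat_norm_mult)+

instantiation smat :: (cstar_algebra) cstar_algebra
begin

definition scaleC_smat :: "complex \<Rightarrow> 'a smat \<Rightarrow> 'a smat" where
  "scaleC c x = Abs_smat (\<lambda>i j. scaleC c (Rep_smat x i j))"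

definition star_smat :: "'a smat \<Rightarrow> 'a smat" where
  "star x = Abs_smat (mat_star (Rep_smat x))"

lemma Rep_smat_scaleC: "Rep_smat (scaleC c x) i j = scaleC c (Rep_smat x i j :: 'a)"
  by (simp add: scaleC_smat_def Abs_smat_inverse stab_scaleC)

lemma Rep_smat_star: "Rep_smat (star x) = mat_star (Rep_smat x :: 'a mat)"
  by (simp add: star_smat_def Abs_smat_inverse stab_mat_star)

lemma norm_smat_star: "norm (star x) = norm (x :: 'a smat)"
  by (simp add: norm_smat_def Rep_smat_star mat_norm_def corner_norm_mat_star)

lemma smat_cstar: "norm (star x * x) = (norm (x :: 'a smat))\<^sup>2"
proof (rule antisym)
  show "norm (star x * x) \<le> (norm x)\<^sup>2"
    using norm_mult_ineq[of "star x" x] by (simp add: norm_smat_star power2_eq_square)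
  \<comment> \<open>The lower bound is known for corners only. For a finitely supported matrix a
    large truncation already is the whole product, and continuity of both sides does the
    rest.\<close>
  obtain f where f: "\<And>n. Rep_smat (f n) \<in> finite_mats" "f \<longlonglongrightarrow> x"
    using finite_smat_dense[of x] by blast
  have "star (a + b) = star a + star b" for a b :: "'a smat"
    by (rule smat_eqI) (simp add: Rep_smat_simps Rep_smat_star mat_star_def star_add)
  moreover have "star (r *\<^sub>R a) = r *\<^sub>R star a" for r and a :: "'a smat"
    by (rule smat_eqI) (simp add: Rep_smat_simps Rep_smat_star mat_star_def star_scaleR)
  ultimately have "bounded_linear (star :: 'a smat \<Rightarrow> 'a smat)"
    by (intro bounded_linear_intro[where K = 1]) (simp_all add: norm_smat_star)
  then have "(\<lambda>n. star (f n)) \<longlonglongrightarrow> star x"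
    using f(2) bounded_linear.tendsto by blast
  then have lim: "(\<lambda>n. norm (star (f n) * f n)) \<longlonglongrightarrow> norm (star x * x)"
    by (intro tendsto_intros f(2))
  have fin: "(norm (f n))\<^sup>2 \<le> norm (star (f n) * f n)" for n
  proof -
    let ?a = "Rep_smat (f n)"
    obtain N where N: "supported N (mat_star ?a)"
      using finite_matsD[OF finite_mats_mat_star[OF f(1)[of n]]] by blast
    have "corner_norm m ?a \<le> sqrt (norm (star (f n) * f n))" for m
    proof -
      let ?M = "max m N"
      have "(corner_norm ?M ?a)\<^sup>2 \<le> corner_norm ?M (fm ?M (mat_star ?a) ?a)"
        by (rule corner_norm_cstar)
      also have "fm ?M (mat_star ?a) ?a = Rep_smat (star (f n) * f n)"
        unfolding Rep_smat_times Rep_smat_star mat_mult_finite_left[OF N]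
        by (rule fm_finite_left[OF N]) simp
      also have "corner_norm ?M (Rep_smat (star (f n) * f n)) \<le> norm (star (f n) * f n)"
        by (rule corner_norm_le_norm)
      finally have "corner_norm ?M ?a \<le> sqrt (norm (star (f n) * f n))"
        by (rule real_le_rsqrt)
      then show ?thesis
        using corner_norm_mono[of m ?M ?a] by simp
    qed
    then have "norm (f n) \<le> sqrt (norm (star (f n) * f n))"
      by (rule norm_smat_le)
    then have "(norm (f n))\<^sup>2 \<le> (sqrt (norm (star (f n) * f n)))\<^sup>2"
      by (intro power_mono) auto
    then show ?thesis
      by simp
  qed
  show "(norm x)\<^sup>2 \<le> norm (star x * x)"
    by (rule LIMSEQ_le[OF tendsto_power[OF tendsto_norm[OF f(2)]] lim]) (use fin in blast)
qed

lemma summable_star_mat: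
  "star (\<Sum>k. Rep_smat x i k * Rep_smat y k j) = (\<Sum>k. star (Rep_smat x i k * Rep_smat y k j :: 'a))"
  by (rule bounded_linear.suminf[OF bounded_linear_star]) (simp add: summable_mat_mult)

lemma bounded_linear_scaleC: "bounded_linear (scaleC c :: 'a \<Rightarrow> 'a)"
  by (rule bounded_linear_intro[where K = "cmod c"])
    (simp_all add: scaleC_add_right scaleR_scaleC scaleC_scaleC norm_scaleC mult.commute)

lemma suminf_scaleC:
  "scaleC c (\<Sum>k. Rep_smat x i k * Rep_smat y k j) = (\<Sum>k. scaleC c (Rep_smat x i k * Rep_smat y k j :: 'a))"
  by (rule bounded_linear.suminf[OF bounded_linear_scaleC]) (simp add: summable_mat_mult)

instance
proof
  fix x y :: "'a smat" and c d :: complex and r :: real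
  show "scaleC c (x + y) = scaleC c x + scaleC c y" "scaleC (c + d) x = scaleC c x + scaleC d x"
    "scaleC c (scaleC d x) = scaleC (c * d) x" "r *\<^sub>R x = scaleC (of_real r) x"
    by (auto intro!: smat_eqI simp: Rep_smat_simps Rep_smat_scaleC scaleC_add_right scaleC_add_left
      scaleC_scaleC scaleR_scaleC)
  show "scaleC c x * y = scaleC c (x * y)" "x * scaleC c y = scaleC c (x * y)"
    by (auto intro!: smat_eqI simp: Rep_smat_times Rep_smat_scaleC mat_mult_def suminf_scaleC
      mult_scaleC_left mult_scaleC_right)
  show "star (x + y) = star x + star y" "star (scaleC c x) = scaleC (cnj c) (star x)"
    "star (star x) = x"
    by (auto intro!: smat_eqI simp: Rep_smat_simps Rep_smat_scaleC Rep_smat_star mat_star_def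
      star_add star_scaleC star_star)
  show "star (x * y) = star y * star x"
    by (auto intro!: smat_eqI simp: Rep_smat_times Rep_smat_star mat_mult_def mat_star_def
      summable_star_mat star_mult)
  show "norm (star x * x) = (norm x)\<^sup>2"
    by (rule smat_cstar)
  have le: "norm (scaleC c x) \<le> cmod c * norm x" for c and x :: "'a smat"
  proof (rule norm_smat_le)
    fix n
    have "corner_norm n (Rep_smat (scaleC c x)) \<le> cmod c * corner_norm n (Rep_smat x)"
      using corner_norm_scaleC_le[of n c "Rep_smat x"] by (simp add: Rep_smat_scaleC[abs_def, symmetric])
    also have "\<dots> \<le> cmod c * norm x"
      by (intro mult_left_mono corner_norm_le_norm) simp
    finally show "corner_norm n (Rep_smat (scaleC c x)) \<le> cmod c * norm x" .
  qed
  show "norm (scaleC c x) = cmod c * norm x"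
  proof (cases "c = 0")
    case True
    then show ?thesis
      using le[of c x] by simp
  next
    case False
    have "scaleC 1 z = z" for z :: 'a
      using scaleR_scaleC[of 1 z] by simp
    then have "x = scaleC (inverse c) (scaleC c x)"
      using False by (intro smat_eqI) (simp add: Rep_smat_scaleC scaleC_scaleC)
    then have "norm x \<le> cmod (inverse c) * norm (scaleC c x)"
      using le[of "inverse c" "scaleC c x"] by simp
    then have "cmod c * norm x \<le> norm (scaleC c x)"
      using False unfolding norm_inverse by (simp add: divide_simps mult.commute)
    then show ?thesis
      using le[of c x] by simp
  qed
qed

end


subsection \<open>Isometries permuting the rows\<close>

text \<open>
  Left multiplication by the isometry that sends the \<open>k\<close>-th basis vector to the \<open>f k\<close>-th one, and by
  its adjoint. Monotonicity of \<open>f\<close> allows reindexing series that converge only conditionally.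
\<close>

definition row_ins :: "(nat \<Rightarrow> nat) \<Rightarrow> 'a::cstar_algebra mat \<Rightarrow> 'a mat" where
  "row_ins f a = (\<lambda>i j. if i \<in> range f then a (inv f i) j else 0)"

definition row_sel :: "(nat \<Rightarrow> nat) \<Rightarrow> 'a::cstar_algebra mat \<Rightarrow> 'a mat" where
  "row_sel f a = (\<lambda>i j. a (f i) j)"

lemma corner_norm_row_ins:
  assumes f: "inj f" and M: "\<And>m. corner_norm m a \<le> M"
  shows "corner_norm n (row_ins f a) \<le> M"
proof (rule corner_norm_le)
  show "0 \<le> M"
    using M[of 0] corner_norm_nonneg order_trans by blast
  fix v
  let ?w = "mv n a v"
  obtain m where "insert n (inv f ` {i. i < n \<and> i \<in> range f}) \<subseteq> {..<m}"
    using finite_nat_bounded[of "insert n (inv f ` {i. i < n \<and> i \<in> range f})"] by auto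
  then have "n \<le> m" and sub: "inv f ` {i. i < n \<and> i \<in> range f} \<subseteq> {..<m}"
    by auto
  have "mv n (row_ins f a) v i = (if i \<in> range f then ?w (inv f i) else 0)" for i
    by (simp add: mv_def row_ins_def)
  then have "(\<Sum>i<n. star (mv n (row_ins f a) v i) * mv n (row_ins f a) v i)
      = (\<Sum>i\<in>{i. i < n \<and> i \<in> range f}. star (?w (inv f i)) * ?w (inv f i))"
    by (intro sum.mono_neutral_cong_right) auto
  also have "\<dots> = (\<Sum>k\<in>inv f ` {i. i < n \<and> i \<in> range f}. star (?w k) * ?w k)"
    by (subst sum.reindex) (auto intro!: inj_onI simp: f)
  finally have "vec_norm n (mv n (row_ins f a) v) \<le> vec_norm m ?w"
    unfolding vec_norm_def using norm_sum_star_mono[OF _ sub, of ?w] by simp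
  also have "\<dots> \<le> corner_norm m a * vec_norm n v"
    by (rule vec_norm_mv_le_larger[OF \<open>n \<le> m\<close>])
  also have "\<dots> \<le> M * vec_norm n v"
    by (intro mult_right_mono M) simp
  finally show "vec_norm n (mv n (row_ins f a) v) \<le> M * vec_norm n v" .
qed

lemma corner_norm_row_sel:
  assumes f: "inj f" and M: "\<And>m. corner_norm m a \<le> M"
  shows "corner_norm n (row_sel f a) \<le> M"
proof (rule corner_norm_le)
  show "0 \<le> M"
    using M[of 0] corner_norm_nonneg order_trans by blast
  fix v
  let ?w = "mv n a v"
  obtain m where "insert n (f ` {..<n}) \<subseteq> {..<m}"
    using finite_nat_bounded[of "insert n (f ` {..<n})"] by auto
  then have "n \<le> m" and sub: "f ` {..<n} \<subseteq> {..<m}"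
    by auto
  have "mv n (row_sel f a) v = (\<lambda>i. ?w (f i))"
    by (simp add: mv_def row_sel_def)
  then have "vec_norm n (mv n (row_sel f a) v) \<le> vec_norm m ?w"
    using vec_norm_reindex[OF inj_on_subset[OF f] sub] by simp
  also have "\<dots> \<le> corner_norm m a * vec_norm n v"
    by (rule vec_norm_mv_le_larger[OF \<open>n \<le> m\<close>])
  also have "\<dots> \<le> M * vec_norm n v"
    by (intro mult_right_mono M) simp
  finally show "vec_norm n (mv n (row_sel f a) v) \<le> M * vec_norm n v" .
qed

lemma stab_row_ins:
  assumes f: "inj f" and a: "a \<in> stab"
  shows "row_ins f a \<in> stab"
proof (rule stab_map[OF a, of "row_ins f" 1])
  show "row_ins f b \<in> stab" if fin: "b \<in> finite_mats" for b :: "'a mat"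
  proof -
    obtain N where N: "supported N b"
      using finite_matsD[OF fin] by blast
    obtain m where m: "insert N (f ` {..<N}) \<subseteq> {..<m}"
      using finite_nat_bounded[of "insert N (f ` {..<N})"] by auto
    have "row_ins f b i j = 0" if ij: "m \<le> i \<or> m \<le> j" for i j
    proof (cases "i \<in> range f")
      case True
      then obtain k where k: "i = f k"
        by blast
      have "k < N \<Longrightarrow> f k < m" "N < m"
        using m by auto
      then have "N \<le> k \<or> N \<le> j"
        using ij by (cases "k < N") (auto simp: k)
      then show ?thesis
        by (simp add: row_ins_def k f supportedD[OF N])
    qed (simp add: row_ins_def)
    then have "supported m (row_ins f b)"
      by (simp add: supported_def)
    then show ?thesis
      by (intro finite_mats_subset_stab finite_matsI)
  qed
  fix b M n
  assume "\<And>m. corner_norm m (\<lambda>i j. a i j - b i j) \<le> M"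
  then have "corner_norm n (row_ins f (\<lambda>i j. a i j - b i j)) \<le> M"
    by (rule corner_norm_row_ins[OF f])
  moreover have "row_ins f (\<lambda>i j. a i j - b i j) = (\<lambda>i j. row_ins f a i j - row_ins f b i j)"
    by (intro ext) (simp add: row_ins_def)
  ultimately show "corner_norm n (\<lambda>i j. row_ins f a i j - row_ins f b i j) \<le> 1 * M"
    by simp
qed simp

lemma stab_row_sel:
  assumes f: "inj f" and a: "a \<in> stab"
  shows "row_sel f a \<in> stab"
proof (rule stab_map[OF a, of "row_sel f" 1])
  show "row_sel f b \<in> stab" if fin: "b \<in> finite_mats" for b :: "'a mat"
  proof -
    obtain N where N: "supported N b"
      using finite_matsD[OF fin] by blast
    have "finite (f -` {..<N})"
      using f by (intro finite_vimageI) auto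
    then obtain K where K: "\<And>i. f i < N \<Longrightarrow> i < K"
      using finite_nat_set_iff_bounded[of "f -` {..<N}"] by auto
    have "supported (max N K) (row_sel f b)"
      unfolding supported_def row_sel_def using supportedD[OF N] K
      by (metis leD le_less_linear max.bounded_iff)
    then show ?thesis
      by (intro finite_mats_subset_stab finite_matsI)
  qed
  fix b M n
  assume "\<And>m. corner_norm m (\<lambda>i j. a i j - b i j) \<le> M"
  then have "corner_norm n (row_sel f (\<lambda>i j. a i j - b i j)) \<le> M"
    by (rule corner_norm_row_sel[OF f])
  then show "corner_norm n (\<lambda>i j. row_sel f a i j - row_sel f b i j) \<le> 1 * M"
    by (simp add: row_sel_def)
qed simp

definition ins :: "(nat \<Rightarrow> nat) \<Rightarrow> 'a::cstar_algebra smat \<Rightarrow> 'a smat" where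
  "ins f x = Abs_smat (row_ins f (Rep_smat x))"

definition sel :: "(nat \<Rightarrow> nat) \<Rightarrow> 'a::cstar_algebra smat \<Rightarrow> 'a smat" where
  "sel f x = Abs_smat (row_sel f (Rep_smat x))"

lemma Rep_smat_ins:
  "strict_mono f \<Longrightarrow> Rep_smat (ins f x) i j = (if i \<in> range f then Rep_smat x (inv f i) j else 0)"
  unfolding ins_def Abs_smat_inverse[OF stab_row_ins[OF strict_mono_imp_inj_on Rep_smat_stab]]
  by (simp add: row_ins_def)

lemma Rep_smat_sel: "strict_mono f \<Longrightarrow> Rep_smat (sel f x) i j = Rep_smat x (f i) j"
  unfolding sel_def Abs_smat_inverse[OF stab_row_sel[OF strict_mono_imp_inj_on Rep_smat_stab]]
  by (simp add: row_sel_def)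

text \<open>Stands in for left multiplication by an element of a larger algebra: the row isometries
  need not belong to the stabilization, but they act on it.\<close>

definition lmult :: "('a::cstar_algebra \<Rightarrow> 'a) \<Rightarrow> bool" where
  "lmult T \<longleftrightarrow> bounded_linear T \<and> (\<forall>x y. T (x * y) = T x * y)"

lemma lmult_bounded_linear: "lmult T \<Longrightarrow> bounded_linear T"
  by (simp add: lmult_def)

lemma lmult_mult: "lmult T \<Longrightarrow> T (x * y) = T x * y"
  by (simp add: lmult_def)

lemma lmult_add: "lmult T \<Longrightarrow> T (x + y) = T x + T y"
  by (simp add: lmult_def bounded_linear.linear linear_add)

lemma lmult_diff: "lmult T \<Longrightarrow> T (x - y) = T x - T y"
  by (simp add: lmult_def bounded_linear.linear linear_diff)

lemma lmult_scaleR: "lmult T \<Longrightarrow> T (r *\<^sub>R x) = r *\<^sub>R T x"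
  by (simp add: lmult_def bounded_linear.linear linear_scale)

lemma norm_ins_le: "strict_mono f \<Longrightarrow> norm (ins f x) \<le> norm x"
  by (rule norm_smat_le)
    (simp add: ins_def Abs_smat_inverse stab_row_ins strict_mono_imp_inj_on corner_norm_row_ins
      corner_norm_le_norm)

lemma norm_sel_le: "strict_mono f \<Longrightarrow> norm (sel f x) \<le> norm x"
  by (rule norm_smat_le)
    (simp add: sel_def Abs_smat_inverse stab_row_sel strict_mono_imp_inj_on corner_norm_row_sel
      corner_norm_le_norm)

lemma lmult_ins:
  assumes f: "strict_mono f"
  shows "lmult (ins f :: 'a::cstar_algebra smat \<Rightarrow> 'a smat)"
  unfolding lmult_def
proof (intro conjI allI)
  show "bounded_linear (ins f :: 'a smat \<Rightarrow> 'a smat)"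
    by (rule bounded_linear_intro[where K = 1])
      (auto intro!: smat_eqI simp: Rep_smat_ins f Rep_smat_simps norm_ins_le)
  show "ins f (x * y) = ins f x * y" for x y :: "'a smat"
    by (rule smat_eqI) (simp add: Rep_smat_ins f Rep_smat_times mat_mult_def)
qed

lemma lmult_sel:
  assumes f: "strict_mono f"
  shows "lmult (sel f :: 'a::cstar_algebra smat \<Rightarrow> 'a smat)"
  unfolding lmult_def
proof (intro conjI allI)
  show "bounded_linear (sel f :: 'a smat \<Rightarrow> 'a smat)"
    by (rule bounded_linear_intro[where K = 1])
      (auto intro!: smat_eqI simp: Rep_smat_sel f Rep_smat_simps norm_sel_le)
  show "sel f (x * y) = sel f x * y" for x y :: "'a smat"
    by (rule smat_eqI) (simp add: Rep_smat_sel f Rep_smat_times mat_mult_def)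
qed

lemma sel_ins:
  assumes f: "strict_mono f"
  shows "sel f (ins f x) = x"
  by (rule smat_eqI) (simp add: Rep_smat_sel Rep_smat_ins f strict_mono_imp_inj_on inv_f_f)

lemma sel_ins_disjoint:
  assumes "strict_mono f" "strict_mono g" "range f \<inter> range g = {}"
  shows "sel f (ins g x) = 0"
proof (rule smat_eqI)
  fix i j
  have "f i \<notin> range g"
    using assms(3) by blast
  then show "Rep_smat (sel f (ins g x)) i j = Rep_smat 0 i j"
    by (simp add: Rep_smat_sel Rep_smat_ins assms Rep_smat_zero)
qed

text \<open>The terms off the range of \<open>f\<close> vanish. In effect \<open>sel f\<close> is
  the adjoint of \<open>ins f\<close>, expressed inside a product because neither is multiplication
  by a given element.\<close>

lemma star_ins_mult:
  assumes f: "strict_mono f"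
  shows "star (ins f x) * y = star x * sel f (y :: 'a::cstar_algebra smat)"
proof (rule smat_eqI)
  fix i j
  let ?g = "\<lambda>k. star (Rep_smat (ins f x) k i) * Rep_smat y k j"
  have "(\<lambda>k. ?g (f k)) sums c \<longleftrightarrow> ?g sums c" for c
    by (rule sums_mono_reindex[OF f]) (simp add: Rep_smat_ins f)
  then have "(\<Sum>k. ?g k) = (\<Sum>k. ?g (f k))"
    by (simp add: suminf_def)
  moreover have "?g (f k) = star (Rep_smat x k i) * Rep_smat (sel f y) k j" for k
    by (simp add: Rep_smat_ins Rep_smat_sel f strict_mono_imp_inj_on inv_f_f)
  ultimately show "Rep_smat (star (ins f x) * y) i j = Rep_smat (star x * sel f y) i j"
    by (simp add: Rep_smat_times Rep_smat_star mat_mult_def mat_star_def)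
qed


section \<open>Cuntz comparison\<close>

definition cle :: "'a::cstar_algebra \<Rightarrow> 'a \<Rightarrow> bool" where
  "cle a b \<longleftrightarrow> (\<forall>e>0. \<exists>x. norm (a - x * b * star x) < e)"

lemma cleD:
  assumes "cle a b" "e > 0"
  obtains x where "norm (a - x * b * star x) < e"
  using assms unfolding cle_def by blast

lemma cle_conj: "cle (x * b * star x) b"
  unfolding cle_def by (auto intro!: exI[of _ x])

lemma norm_sandwich_le: "norm (x * d * star x) \<le> norm x * norm x * norm (d::'a::cstar_algebra)"
proof -
  have "norm (x * d * star x) \<le> norm (x * d) * norm x"
    using norm_mult_ineq[of "x * d" "star x"] by simp
  also have "\<dots> \<le> norm x * norm d * norm x"
    by (intro mult_right_mono norm_mult_ineq) simp
  finally show ?thesis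
    by (simp add: mult_ac)
qed

lemma cle_trans:
  assumes ab: "cle a b" and bc: "cle b c"
  shows "cle a c"
  unfolding cle_def
proof (intro allI impI)
  fix e :: real
  assume "e > 0"
  then obtain x where x: "norm (a - x * b * star x) < e/2"
    using cleD[OF ab, of "e/2"] by auto
  define K where "K = norm x * norm x + 1"
  have "K > 0"
    by (simp add: K_def add_nonneg_pos)
  then obtain y where y: "norm (b - y * c * star y) < e / (2 * K)"
    using cleD[OF bc, of "e / (2 * K)"] \<open>e > 0\<close> by auto
  have "norm (x * (b - y * c * star y) * star x) \<le> norm x * norm x * norm (b - y * c * star y)"
    by (rule norm_sandwich_le)
  also have "\<dots> \<le> K * (e / (2 * K))"
    using y \<open>K > 0\<close> by (intro mult_mono) (auto simp: K_def)
  also have "\<dots> = e/2"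
    using \<open>K > 0\<close> by simp
  finally have "norm (x * (b - y * c * star y) * star x) \<le> e/2" .
  moreover have "a - (x * y) * c * star (x * y) = (a - x * b * star x) + x * (b - y * c * star y) * star x"
    by (simp add: star_mult algebra_simps)
  ultimately have "norm (a - (x * y) * c * star (x * y)) < e"
    using x norm_triangle_ineq[of "a - x * b * star x" "x * (b - y * c * star y) * star x"]
    by (simp only:)
  then show "\<exists>x. norm (a - x * c * star x) < e"
    by blast
qed

lemma cle_limit:
  assumes "\<And>e. e > 0 \<Longrightarrow> \<exists>c. norm (a - c) < e \<and> cle c b"
  shows "cle a b"
  unfolding cle_def
proof (intro allI impI)
  fix e :: real
  assume "e > 0"
  then obtain c where c: "norm (a - c) < e/2" "cle c b"
    using assms[of "e/2"] by auto
  then obtain x where "norm (c - x * b * star x) < e/2"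
    using cleD[of c b "e/2"] \<open>e > 0\<close> by auto
  then have "norm (a - x * b * star x) < e"
    using c norm_triangle_ineq[of "a - c" "c - x * b * star x"] by simp
  then show "\<exists>x. norm (a - x * b * star x) < e"
    by blast
qed

lemma cle_scaleR:
  assumes "0 \<le> r"
  shows "cle a b \<Longrightarrow> cle (r *\<^sub>R a) b"
proof (rule cle_limit)
  fix e :: real
  assume "cle a b" "e > 0"
  define K where "K = r + 1"
  have "K > 0"
    using assms by (simp add: K_def)
  then obtain x where x: "norm (a - x * b * star x) < e / K"
    using cleD[OF \<open>cle a b\<close>, of "e / K"] \<open>e > 0\<close> by auto
  have "norm (r *\<^sub>R a - r *\<^sub>R (x * b * star x)) = r * norm (a - x * b * star x)"
    using assms by (simp flip: scaleR_diff_right)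
  also have "\<dots> \<le> K * norm (a - x * b * star x)"
    by (intro mult_right_mono) (simp_all add: K_def)
  also have "\<dots> < e"
    using x \<open>K > 0\<close> by (simp add: field_simps)
  finally have "norm (r *\<^sub>R a - r *\<^sub>R (x * b * star x)) < e" .
  moreover have "r *\<^sub>R (x * b * star x) = (sqrt r *\<^sub>R x) * b * star (sqrt r *\<^sub>R x)"
    using assms by (simp add: star_scaleR)
  ultimately show "\<exists>c. norm (r *\<^sub>R a - c) < e \<and> cle c b"
    using cle_conj by metis
qed

lemma psd_mult_star: "psd (y * star (y::'a::cstar_algebra))"
  using psd_star_mult_self[of "star y"] by (simp add: star_star)

lemma psd_obtain:
  assumes "psd a"
  obtains y where "a = star y * y" "a = y * star y"
  using assms unfolding psd_def by metis

lemma left_approximate_unit: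
  fixes w :: "'a::cstar_algebra"
  assumes "e > 0"
  obtains u where "norm (u * w - w) < e"
proof -
  define d where "d = e\<^sup>2 / 4"
  have "d > 0"
    using assms by (simp add: d_def)
  define c where "c = w * star w"
  have c: "psd c"
    unfolding c_def by (rule psd_mult_star)
  have sc: "star c = c"
    by (rule psd_star[OF c])
  \<comment> \<open>The squared error is governed by
    \<open>t (1 - f t)^2 = t (d / (t + d))^2\<close>, which is at most \<open>d\<close>; hence the
    choice \<open>d = e^2 / 4\<close>.\<close>
  define f where "f t = t / (\<bar>t\<bar> + d)" for t
  have f: "cont0 f"
    unfolding f_def cont0_def using \<open>d > 0\<close> by (auto intro!: continuous_intros)
  define u where "u = fc c f"
  have su: "star u = u"
    unfolding u_def by (rule star_fc[OF sc f])
  define g where "g t = f t * (t * f t) - 2 * (f t * t) + t" for t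
  have ft: "cont0 (\<lambda>t. f t * t)" "cont0 (\<lambda>t. t * f t)" "cont0 (\<lambda>t. f t * (t * f t))"
    by (intro cont0_mult f cont0_id)+
  have "fc c g = u * (c * u) - 2 *\<^sub>R (u * c) + c"
    unfolding g_def u_def
    by (simp add: fc_add[OF sc] fc_diff[OF sc] fc_scale[OF sc] fc_mult[OF sc] fc_id[OF sc]
      ft f cont0_intros)
  moreover have "u * c = c * u"
    using fc_mult[OF sc f cont0_id] fc_mult[OF sc cont0_id f]
    by (simp add: u_def fc_id[OF sc] mult.commute)
  ultimately have "fc c g = (u * w - w) * star (u * w - w)"
    by (simp add: c_def star_diff star_mult su scaleR_2 algebra_simps)
  then have "(norm (u * w - w))\<^sup>2 = norm (fc c g)"
    by (simp add: norm_mult_star)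
  also have "\<dots> \<le> d"
  proof (rule norm_fc_psd_le[OF c])
    show "cont0 g"
      unfolding g_def by (intro cont0_intros f)
    fix t :: real
    assume "0 \<le> t"
    then have "g t = t * (d / (t + d))\<^sup>2"
      using \<open>d > 0\<close> by (simp add: g_def f_def divide_simps power2_eq_square) (simp add: algebra_simps)
    also have "\<dots> = (t / (t + d)) * (d / (t + d)) * d"
      by (simp add: power2_eq_square)
    also have "\<bar>\<dots>\<bar> \<le> 1 * 1 * d"
      unfolding abs_mult using \<open>0 \<le> t\<close> \<open>d > 0\<close> by (intro mult_mono) auto
    finally show "\<bar>g t\<bar> \<le> d"
      by simp
  qed
  also have "\<dots> < e\<^sup>2"
    using assms by (simp add: d_def)
  finally have "norm (u * w - w) < e"
    by (rule power2_less_imp_less) (use assms in simp)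
  then show thesis
    by (rule that)
qed

lemma cle_square:
  assumes a: "psd a"
  shows "cle a (a * a)"
  unfolding cle_def
proof (intro allI impI)
  fix e :: real
  assume "e > 0"
  define d where "d = e / 4"
  have "d > 0"
    using \<open>e > 0\<close> by (simp add: d_def)
  have sa: "star a = a"
    by (rule psd_star[OF a])
  \<comment> \<open>Conjugation by \<open>1 / sqrt t\<close> would turn \<open>t^2\<close> into
    \<open>t\<close> but is not continuous at 0. The regularized choice gives
    \<open>t^3 / (t + d)^2\<close>, which misses \<open>t\<close> by at most
    \<open>2 * d = e / 2\<close>.\<close>
  define f where "f t = sqrt \<bar>t\<bar> / (\<bar>t\<bar> + d)" for t
  have f: "cont0 f"
    unfolding f_def cont0_def using \<open>d > 0\<close> by (auto intro!: continuous_intros)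
  define x where "x = fc a f"
  have sx: "star x = x"
    unfolding x_def by (rule star_fc[OF sa f])
  define g where "g t = t - f t * (t * (t * f t))" for t
  have "a - x * (a * (a * x)) = fc a g"
    unfolding g_def x_def
    by (simp add: fc_diff[OF sa] fc_mult[OF sa] fc_id[OF sa] f cont0_intros)
  also have "norm \<dots> \<le> 2 * d"
  proof (rule norm_fc_psd_le[OF a])
    show "cont0 g"
      unfolding g_def by (intro cont0_intros f)
    fix t :: real
    assume "0 \<le> t"
    have "f t * (t * (t * f t)) = (sqrt t * sqrt t) * (t * t) / ((t + d) * (t + d))"
      using \<open>0 \<le> t\<close> by (simp add: f_def)
    then have "g t = t - t * (t * t) / ((t + d) * (t + d))"
      using \<open>0 \<le> t\<close> by (simp add: g_def)
    also have "\<dots> = (t * ((t + d) * (t + d)) - t * (t * t)) / ((t + d) * (t + d))"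
      using \<open>0 \<le> t\<close> \<open>d > 0\<close> by (simp add: diff_divide_distrib)
    also have "t * ((t + d) * (t + d)) - t * (t * t) = 2 * t * t * d + t * d * d"
      by (simp add: algebra_simps)
    finally have g: "g t = (2 * t * t * d + t * d * d) / ((t + d) * (t + d))" .
    have "0 \<le> g t"
      unfolding g using \<open>0 \<le> t\<close> \<open>d > 0\<close> by simp
    have "2 * t * t * d + t * d * d \<le> 2 * d * ((t + d) * (t + d))"
      using \<open>0 \<le> t\<close> \<open>d > 0\<close> by (simp add: algebra_simps)
    then have "g t \<le> 2 * d"
      unfolding g using \<open>0 \<le> t\<close> \<open>d > 0\<close> by (simp add: divide_le_eq)
    then show "\<bar>g t\<bar> \<le> 2 * d"
      using \<open>0 \<le> g t\<close> by simp
  qed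
  also have "\<dots> < e"
    using \<open>e > 0\<close> by (simp add: d_def)
  finally show "\<exists>x. norm (a - x * (a * a) * star x) < e"
    by (intro exI[of _ x]) (simp add: sx mult.assoc)
qed

text \<open>\<open>y * star y\<close> is Cuntz below its square, and the square is
  \<open>star y * y\<close> conjugated by \<open>y\<close>.\<close>

lemma cle_commute: "cle (y * star y) (star y * (y::'a::cstar_algebra))"
proof (rule cle_trans[OF cle_square[OF psd_mult_star]])
  have "y * star y * (y * star y) = y * (star y * y) * star y"
    by (simp add: mult.assoc)
  then show "cle (y * star y * (y * star y)) (star y * y)"
    using cle_conj by metis
qed

lemma cle_commute': "cle (star y * y) (y * star (y::'a::cstar_algebra))"
  using cle_commute[of "star y"] by (simp add: star_star)

lemma cle_refl: "psd a \<Longrightarrow> cle a a"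
  by (metis psd_obtain cle_commute)

lemma cle_psd_square_le:
  assumes "psd a"
  shows "cle (a * a) a"
proof -
  obtain h where h: "star h = h" "a = h * h"
    using assms by (auto simp: psd_def)
  then have "a * a = h * a * star h"
    by (simp add: mult.assoc)
  then show ?thesis
    using cle_conj by metis
qed

text \<open>\<open>T\<close> need not be given by an element of the algebra, but
  \<open>T (u * w) = T u * w\<close> is a product in it, and \<open>u * w\<close> can be brought
  arbitrarily close to \<open>w\<close>.\<close>

lemma cle_lmult:
  assumes T: "lmult T"
  shows "cle (T w * star (T w)) (w * star w)"
proof (rule cle_limit)
  fix e :: real
  assume "e > 0"
  have "\<exists>u. norm (u * w - w) < 1 / real (Suc n)" for n
  proof -
    have "1 / real (Suc n) > 0"
      by simp
    then show ?thesis
      by (blast intro: left_approximate_unit)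
  qed
  then obtain u where u: "\<And>n. norm (u n * w - w) < 1 / real (Suc n)"
    by metis
  have "(\<lambda>n. u n * w - w) \<longlonglongrightarrow> 0"
    by (rule Lim_null_comparison[OF always_eventually inverse_Suc_tendsto])
      (use u in \<open>auto intro: less_imp_le\<close>)
  then have "(\<lambda>n. u n * w) \<longlonglongrightarrow> w"
    using Lim_null by blast
  then have "(\<lambda>n. T (u n * w)) \<longlonglongrightarrow> T w"
    by (rule bounded_linear.tendsto[OF lmult_bounded_linear[OF T]])
  then have "(\<lambda>n. T (u n * w) * star (T (u n * w))) \<longlonglongrightarrow> T w * star (T w)"
    by (intro tendsto_mult tendsto_star)
  from LIMSEQ_D[OF this \<open>e > 0\<close>]
  obtain n where "norm (T (u n * w) * star (T (u n * w)) - T w * star (T w)) < e"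
    by blast
  moreover have "T (u n * w) * star (T (u n * w)) = T (u n) * (w * star w) * star (T (u n))"
    by (simp add: lmult_mult[OF T] star_mult mult.assoc)
  ultimately show "\<exists>c. norm (T w * star (T w) - c) < e \<and> cle c (w * star w)"
    using cle_conj by (metis norm_minus_commute)
qed

text \<open>After division by a common norm bound, positivity is traded for contractivity of
  \<open>1 - m\<close>, a condition that passes to limits, and back.\<close>

lemma psd_limit:
  assumes a: "\<And>n. psd (a n)" and lim: "a \<longlonglongrightarrow> b"
  shows "psd b"
proof -
  have "Bseq a"
    using lim convergent_imp_Bseq convergentI by blast
  then obtain K where K: "K > 0" "\<And>n. norm (a n) \<le> K"
    by (auto simp: Bseq_def)
  have contr: "norm (x - ((1 / K) *\<^sub>R a n) * x) \<le> norm x" for n x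
  proof -
    have "psd ((1 / K) *\<^sub>R a n)"
      using a K(1) by (intro psd_scaleR) auto
    then obtain r where r: "star r = r" "(1 / K) *\<^sub>R a n = r * r"
      by (auto simp: psd_def)
    have "(norm r)\<^sup>2 \<le> 1"
      using K(1) K(2)[of n] norm_square_selfadjoint[OF r(1)]
      by (simp flip: r(2)) (metis divide_le_eq_1_pos)
    then have "norm r \<le> 1"
      by (simp add: power2_eq_square abs_square_le_1[of "norm r", simplified power2_eq_square])
    then show ?thesis
      unfolding r(2) by (rule norm_diff_square_mult_le[OF r(1)])
  qed
  have "psd ((1 / K) *\<^sub>R b)"
  proof (rule psd_if_contractive)
    have "star b = b"
      using tendsto_star[OF lim] lim LIMSEQ_unique psd_star[OF a] by auto
    then show "star ((1 / K) *\<^sub>R b) = (1 / K) *\<^sub>R b"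
      by (simp add: star_scaleR)
    fix x
    have "(\<lambda>n. norm (x - ((1 / K) *\<^sub>R a n) * x)) \<longlonglongrightarrow> norm (x - ((1 / K) *\<^sub>R b) * x)"
      by (intro tendsto_intros lim)
    then show "norm (x - ((1 / K) *\<^sub>R b) * x) \<le> norm x"
      by (rule LIMSEQ_le_const2) (use contr in blast)
  qed
  from psd_scaleR[OF this, of K] show ?thesis
    using K(1) by simp
qed


subsection \<open>Comparison in the stabilization\<close>

definition ev :: "nat \<Rightarrow> nat" where "ev k = 2 * k"
definition od :: "nat \<Rightarrow> nat" where "od k = Suc (2 * k)"

lemma strict_mono_ev [simp]: "strict_mono ev" and strict_mono_od [simp]: "strict_mono od"
  by (auto simp: ev_def od_def strict_mono_def)

lemma ev_od_disjoint [simp]: "range ev \<inter> range od = {}" "range od \<inter> range ev = {}"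
  by (auto simp: ev_def od_def) presburger+

lemmas sel_ev_od = lmult_sel[OF strict_mono_ev] lmult_sel[OF strict_mono_od]

lemmas sel_ins_ev_od = sel_ins[OF strict_mono_ev] sel_ins[OF strict_mono_od]
  sel_ins_disjoint[OF strict_mono_ev strict_mono_od ev_od_disjoint(1)]
  sel_ins_disjoint[OF strict_mono_od strict_mono_ev ev_od_disjoint(2)]

text \<open>The column with entries \<open>y\<close> and \<open>z\<close>, folded into one stable
  matrix by the even and odd rows that \<open>mat_diag\<close> uses.\<close>

definition column :: "'a::cstar_algebra smat \<Rightarrow> 'a smat \<Rightarrow> 'a smat" where
  "column y z = ins ev y + ins od z"

lemma sel_column: "sel ev (column y z) = y" "sel od (column y z) = z"
  by (simp_all add: column_def lmult_add[OF sel_ev_od(1)] lmult_add[OF sel_ev_od(2)] sel_ins_ev_od)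

lemma star_column_mult: "star (column y z) * w = star y * sel ev w + star z * sel od w"
  by (simp add: column_def star_add distrib_right star_ins_mult)

lemma star_column_column: "star (column y z) * column y z = star y * y + star z * z"
  by (simp add: star_column_mult sel_column)

text \<open>For \<open>p = star y * y\<close> and \<open>q = star z * z\<close> the column of
  \<open>y\<close> and \<open>z\<close> has inner square \<open>p + q\<close>, while
  \<open>y * star y\<close> is a corner of its outer square. Passing between inner and outer squares
  does not change the Cuntz class.\<close>

lemma cle_add_left:
  fixes p q :: "'a::cstar_algebra smat"
  assumes "psd p" "psd q"
  shows "cle p (p + q)"
proof -
  obtain y where y: "p = star y * y"
    using psd_obtain[OF assms(1)] by metis
  obtain z where z: "q = star z * z"
    using psd_obtain[OF assms(2)] by metis
  have "cle p (y * star y)"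
    unfolding y by (rule cle_commute')
  moreover have "cle (y * star y) (column y z * star (column y z))"
    using cle_lmult[OF sel_ev_od(1), of "column y z"] by (simp add: sel_column)
  moreover have "cle (column y z * star (column y z)) (p + q)"
    using cle_commute[of "column y z"] by (simp add: star_column_column y z)
  ultimately show ?thesis
    using cle_trans by blast
qed

section \<open>Cut-downs and diagonal sums\<close>

definition cut_down :: "'a::cstar_algebra \<Rightarrow> real \<Rightarrow> 'a" where
  "cut_down a e = fc a (\<lambda>t. max (t - e) 0)"

lemma cont0_cut_down: "0 \<le> e \<Longrightarrow> cont0 (\<lambda>t. max (t - e) 0)"
  by (auto simp: cont0_def intro!: continuous_intros)

lemma psd_cut_down: "psd a \<Longrightarrow> 0 \<le> e \<Longrightarrow> psd (cut_down a e)"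
  unfolding cut_down_def by (rule psd_fc[OF _ cont0_cut_down]) auto

lemma norm_diff_cut_down_le:
  assumes "psd a" "0 \<le> e"
  shows "norm (a - cut_down a e) \<le> e"
proof -
  have "a - cut_down a e = fc a (\<lambda>t. t - max (t - e) 0)"
    using assms by (simp add: cut_down_def fc_diff psd_star cont0_cut_down fc_id)
  also have "norm \<dots> \<le> e"
    by (rule norm_fc_psd_le[OF assms(1) cont0_diff[OF cont0_id cont0_cut_down[OF assms(2)]]])
      (use assms in auto)
  finally show ?thesis .
qed

lemma cle_cut_down_cut_down:
  fixes a :: "'a::cstar_algebra smat"
  assumes a: "psd a" and "0 \<le> d" "d \<le> e"
  shows "cle (cut_down a e) (cut_down a d)"
proof -
  have "0 \<le> e"
    using assms by simp
  have c: "cont0 (\<lambda>t. max (t - d) 0 - max (t - e) 0)"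
    by (intro cont0_diff cont0_cut_down \<open>0 \<le> d\<close> \<open>0 \<le> e\<close>)
  have "cut_down a d - cut_down a e = fc a (\<lambda>t. max (t - d) 0 - max (t - e) 0)"
    by (simp add: cut_down_def fc_diff psd_star a cont0_cut_down \<open>0 \<le> d\<close> \<open>0 \<le> e\<close>)
  moreover have "psd (fc a (\<lambda>t. max (t - d) 0 - max (t - e) 0))"
    by (rule psd_fc[OF a c]) (use \<open>d \<le> e\<close> in auto)
  ultimately show ?thesis
    using cle_add_left[OF psd_cut_down[OF a \<open>0 \<le> e\<close>], of "cut_down a d - cut_down a e"]
    by (metis add.commute diff_add_cancel)
qed

text \<open>
  If \<open>g = (a - e)\<^sub>+\<^bsup>1/2\<^esup>\<close>, then \<open>g b g \<ge> g (a - e) g = (a - e)\<^sub>+\<^sup>2\<close>.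
\<close>

lemma cle_cut_down:
  fixes a b :: "'a::cstar_algebra smat"
  assumes a: "psd a" and b: "psd b" and e: "norm (a - b) \<le> e"
  shows "cle (cut_down a e) b"
proof -
  have "0 \<le> e"
    using e norm_ge_zero order_trans by blast
  have sa: "star a = a" and sb: "star b = b"
    using a b psd_star by auto
  define u where "u t = max (t - e) 0" for t :: real
  have cu: "fc a u = cut_down a e"
    unfolding cut_down_def by (rule arg_cong[of _ _ "fc a"]) (simp add: u_def fun_eq_iff)
  have u: "cont0 u"
    unfolding u_def by (rule cont0_cut_down[OF \<open>0 \<le> e\<close>])
  have v: "cont0 (\<lambda>t. sqrt (u t))"
    using u by (auto simp: cont0_def intro!: continuous_intros)
  have nn: "u t \<ge> 0" for t
    by (simp add: u_def)
  define g where "g = fc a (\<lambda>t. sqrt (u t))"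
  have sg: "star g = g"
    unfolding g_def by (rule star_fc[OF sa v])
  have gg: "g * g = cut_down a e"
    unfolding g_def fc_mult[OF sa v v, symmetric] cut_down_def using nn by (simp add: u_def)
  have gag: "g * (a * g) = fc a (\<lambda>t. t * u t)"
  proof -
    have "g * (a * g) = fc a (\<lambda>t. sqrt (u t) * (t * sqrt (u t)))"
      unfolding g_def by (simp add: fc_mult[OF sa] v cont0_mult fc_id[OF sa])
    moreover have "sqrt (u t) * (t * sqrt (u t)) = t * u t" for t
      using nn[of t] by (simp add: mult.left_commute)
    ultimately show ?thesis
      by simp
  qed
  \<comment> \<open>\<open>star w * w\<close> is \<open>g (e + b - a) g\<close>, positive because
    \<open>norm (b - a)\<close> is at most \<open>e\<close>. So \<open>g b g\<close> is
    \<open>g (a - e) g\<close> plus a positive element.\<close>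
  obtain w where w: "star w * w = e *\<^sub>R (star g * g) + star g * ((b - a) * g)"
    using root_complement[of "b - a" e g] e by (auto simp: star_diff sa sb norm_minus_commute)
  have "g * (a * g) - e *\<^sub>R (g * g) = fc a (\<lambda>t. t * u t - e * u t)"
    unfolding gag gg cut_down_def u_def[symmetric]
    by (simp add: fc_diff[OF sa] fc_scale[OF sa] u cont0_intros)
  also have "(\<lambda>t. t * u t - e * u t) = (\<lambda>t. u t * u t)"
    by (auto simp: u_def fun_eq_iff max_def algebra_simps)
  also have "fc a (\<lambda>t. u t * u t) = cut_down a e * cut_down a e"
    by (simp only: fc_mult[OF sa u u] cu)
  finally have "g * b * star g = cut_down a e * cut_down a e + star w * w"
    by (simp add: w sg algebra_simps)
  moreover have "psd (cut_down a e * cut_down a e)"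
    by (intro psd_square psd_star psd_cut_down a \<open>0 \<le> e\<close>)
  ultimately have "cle (cut_down a e * cut_down a e) (g * b * star g)"
    using cle_add_left psd_star_mult_self by metis
  then show ?thesis
    using cle_square[OF psd_cut_down[OF a \<open>0 \<le> e\<close>]] cle_conj cle_trans by blast
qed

lemma cle_if_cut_downs:
  fixes a :: "'a::cstar_algebra smat"
  assumes "psd a" and "\<And>n. cle (cut_down a (1 / real (Suc n))) b"
  shows "cle a b"
proof (rule cle_limit)
  fix e :: real
  assume "e > 0"
  then obtain n where n: "1 / real (Suc n) < e"
    using nat_approx_posE by blast
  have "norm (a - cut_down a (1 / real (Suc n))) \<le> 1 / real (Suc n)"
    by (rule norm_diff_cut_down_le[OF assms(1)]) simp
  then show "\<exists>c. norm (a - c) < e \<and> cle c b"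
    using n assms(2) by (meson le_less_trans)
qed

text \<open>\<open>ins\<close> moves rows only; the adjoints make it move columns as well, so each
  summand is \<open>V a V\<^sup>*\<close> for the isometry \<open>V\<close> of the even or the odd
  indices.\<close>

definition sdiag :: "'a::cstar_algebra smat \<Rightarrow> 'a smat \<Rightarrow> 'a smat" where
  "sdiag a b = ins ev (star (ins ev (star a))) + ins od (star (ins od (star b)))"

lemma ins_star_ins_star:
  assumes f: "strict_mono f"
  shows "ins f (star (ins f (star (star y * y)))) = ins f (star y) * star (ins f (star y))"
proof -
  have "ins f (star (star y * y)) = ins f (star y) * y"
    by (simp add: star_mult star_star lmult_mult[OF lmult_ins[OF f]])
  then show ?thesis
    by (simp add: star_mult lmult_mult[OF lmult_ins[OF f]])
qed

lemma sdiag_squares: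
  "sdiag (star y * y) (star z * z)
    = ins ev (star y) * star (ins ev (star y)) + ins od (star z) * star (ins od (star z))"
  by (simp only: sdiag_def ins_star_ins_star strict_mono_ev strict_mono_od)

lemma psd_sdiag:
  assumes "psd a" "psd b"
  shows "psd (sdiag a b)"
proof -
  obtain y z where "a = star y * y" "b = star z * z"
    using assms psd_obtain by metis
  then show ?thesis
    by (simp add: sdiag_squares psd_add psd_mult_star)
qed

lemma cle_add_sdiag:
  fixes p q a b :: "'a::cstar_algebra smat"
  assumes "psd a" "psd b" "cle p a" "cle q b"
  shows "cle (p + q) (sdiag a b)"
proof (rule cle_limit)
  fix e :: real
  assume "e > 0"
  obtain y z where y: "a = star y * y" and z: "b = star z * z"
    using assms(1,2) psd_obtain by metis
  obtain r where r: "norm (p - r * a * star r) < e/2"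
    using cleD[OF assms(3), of "e/2"] \<open>e > 0\<close> by auto
  obtain s where s: "norm (q - s * b * star s) < e/2"
    using cleD[OF assms(4), of "e/2"] \<open>e > 0\<close> by auto
  \<comment> \<open>The row with entries \<open>r\<close> and \<open>s\<close>, written as the
    adjoint of a column because \<open>ins\<close> and \<open>sel\<close> act on rows.\<close>
  define X where "X = star (column (star r) (star s))"
  have X: "X * ins ev (star y) = r * star y" "X * ins od (star z) = s * star z"
    by (simp_all add: X_def star_column_mult sel_ins_ev_od star_star)
  have "X * sdiag a b * star X
      = (X * ins ev (star y)) * star (X * ins ev (star y)) + (X * ins od (star z)) * star (X * ins od (star z))"
    by (simp add: y z sdiag_squares distrib_left distrib_right star_mult mult.assoc)
  also have "\<dots> = r * a * star r + s * b * star s"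
    by (simp add: X y z star_mult star_star mult.assoc)
  finally have X_eq: "X * sdiag a b * star X = r * a * star r + s * b * star s" .
  have "(p + q) - X * sdiag a b * star X = (p - r * a * star r) + (q - s * b * star s)"
    by (simp add: X_eq)
  then have "norm ((p + q) - X * sdiag a b * star X) < e"
    using r s norm_triangle_ineq[of "p - r * a * star r" "q - s * b * star s"]
    by (simp only:)
  then show "\<exists>c. norm (p + q - c) < e \<and> cle c (sdiag a b)"
    using cle_conj by blast
qed


subsection \<open>Suprema of increasing sequences\<close>

text \<open>Cuts the row indices into infinitely many disjoint infinite blocks, each enumerated
  increasingly as \<open>ins\<close> and \<open>sel\<close> require.\<close>

definition slot :: "nat \<Rightarrow> nat \<Rightarrow> nat" where
  "slot m k = prod_encode (m, k)"

lemma strict_mono_slot [simp]: "strict_mono (slot m)"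
  by (rule strict_monoI_Suc) (simp add: slot_def prod_encode_def)

lemma slot_disjoint: "m \<noteq> n \<Longrightarrow> range (slot m) \<inter> range (slot n) = {}"
  by (auto simp: slot_def prod_encode_eq)

text \<open>This is \<open>V\<^sup>* x V\<close> for the isometry \<open>V\<close> of
  \<open>f\<close>.\<close>

definition compress :: "(nat \<Rightarrow> nat) \<Rightarrow> 'a::cstar_algebra smat \<Rightarrow> 'a smat" where
  "compress f x = sel f (star (sel f (star x)))"

lemma norm_compress_le: "strict_mono f \<Longrightarrow> norm (compress f x) \<le> norm x"
  unfolding compress_def by (metis norm_sel_le norm_star order_trans)

lemma compress_diff: "strict_mono f \<Longrightarrow> compress f (x - y) = compress f x - compress f y"
  by (simp add: compress_def star_diff lmult_diff[OF lmult_sel])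

lemma compress_sandwich:
  assumes f: "strict_mono f"
  shows "compress f (y * b * star y) = sel f y * b * star (sel f y)"
proof -
  have "sel f (star (y * b * star y)) = sel f y * star b * star y"
    by (simp add: star_mult star_star mult.assoc lmult_mult[OF lmult_sel[OF f]])
  then show ?thesis
    by (simp add: compress_def star_mult star_star mult.assoc lmult_mult[OF lmult_sel[OF f]])
qed

lemma cle_compress:
  assumes f: "strict_mono f" and "psd b"
  shows "cle (compress f b) b"
proof -
  obtain h where h: "star h = h" "b = h * h"
    using assms by (auto simp: psd_def)
  have "sel f (star b) = sel f h * h"
    by (simp add: h star_mult lmult_mult[OF lmult_sel[OF f]])
  then have "compress f b = sel f h * star (sel f h)"
    by (simp add: compress_def star_mult h lmult_mult[OF lmult_sel[OF f]])
  then show ?thesis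
    using cle_lmult[OF lmult_sel[OF f], of h] h by simp
qed

text \<open>
  The rows of \<open>Y\<close> beyond the slot \<open>n\<close> are empty. The new slot receives a small multiple of \<open>y\<close>; the
  other rows are multiplied by some \<open>z\<close> with \<open>z b' z\<^sup>* \<approx> b\<close>, which nearly preserves \<open>Y b Y\<^sup>*\<close>.
\<close>

lemma gram_step:
  fixes Y y b b' :: "'a::cstar_algebra smat" and l \<mu> :: real
  assumes le: "cle b b'" and "\<mu> > 0" "l > 0"
    and empty: "\<And>m. n < m \<Longrightarrow> sel (slot m) Y = 0"
  shows "\<exists>Y' l'. 0 < l' \<and> l' \<le> l \<and> (\<forall>m. Suc n < m \<longrightarrow> sel (slot m) Y' = 0)
    \<and> sel (slot (Suc n)) Y' = l' *\<^sub>R y \<and> norm (Y' * b' * star Y' - Y * b * star Y) \<le> \<mu>"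
proof -
  define K where "K = norm Y * norm Y + 1"
  have "K > 0"
    by (simp add: K_def add_nonneg_pos)
  then obtain z where z: "norm (b - z * b' * star z) < \<mu> / (2 * K)"
    using cleD[OF le, of "\<mu> / (2 * K)"] \<open>\<mu> > 0\<close> by auto
  have "norm (Y * (z * b' * star z - b) * star Y) \<le> norm Y * norm Y * norm (z * b' * star z - b)"
    by (rule norm_sandwich_le)
  also have "\<dots> \<le> K * (\<mu> / (2 * K))"
    using z \<open>K > 0\<close> by (intro mult_mono) (auto simp: K_def norm_minus_commute)
  also have "\<dots> = \<mu> / 2"
    using \<open>K > 0\<close> by simp
  finally have zY: "norm (Y * z * b' * star (Y * z) - Y * b * star Y) \<le> \<mu> / 2"
    by (simp add: star_mult algebra_simps)
  define V where "V k = Y * z + (l / real (Suc k)) *\<^sub>R ins (slot (Suc n)) y" for k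
  have "(\<lambda>k. l * (1 / real (Suc k))) \<longlonglongrightarrow> l * 0"
    by (intro tendsto_intros inverse_Suc_tendsto)
  then have "V \<longlonglongrightarrow> Y * z + 0 *\<^sub>R ins (slot (Suc n)) y"
    unfolding V_def by (intro tendsto_intros) simp
  then have "(\<lambda>k. V k * b' * star (V k)) \<longlonglongrightarrow> Y * z * b' * star (Y * z)"
    by (intro tendsto_mult tendsto_star tendsto_const) simp_all
  from LIMSEQ_D[OF this, of "\<mu> / 2"] \<open>\<mu> > 0\<close>
  obtain k where "norm (V k * b' * star (V k) - Y * z * b' * star (Y * z)) < \<mu> / 2"
    by auto
  then have "norm (V k * b' * star (V k) - Y * b * star Y) \<le> \<mu>"
    using zY norm_triangle_ineq[of "V k * b' * star (V k) - Y * z * b' * star (Y * z)"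
      "Y * z * b' * star (Y * z) - Y * b * star Y"] by simp
  moreover have sel_V: "sel (slot m) (V k) = sel (slot m) Y * z
      + (l / real (Suc k)) *\<^sub>R sel (slot m) (ins (slot (Suc n)) y)" for m
    unfolding V_def
    by (simp add: lmult_add[OF lmult_sel] lmult_scaleR[OF lmult_sel] lmult_mult[OF lmult_sel])
  have "sel (slot m) (V k) = 0" if "Suc n < m" for m
    using that by (simp add: sel_V empty sel_ins_disjoint slot_disjoint)
  moreover have "sel (slot (Suc n)) (V k) = (l / real (Suc k)) *\<^sub>R y"
    by (simp add: sel_V empty sel_ins)
  moreover have "l / real (Suc k) \<le> l" "0 < l / real (Suc k)"
    using \<open>l > 0\<close> by (simp_all add: divide_le_eq)
  ultimately show ?thesis
    by blast
qed

lemma cle_chain: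
  assumes "\<And>n. psd (b n)" "\<And>n. cle (b n) (b (Suc n))"
  shows "m \<le> n \<Longrightarrow> cle (b m) (b n)"
  by (induction rule: dec_induct) (use assms cle_refl cle_trans in blast)+

text \<open>Each stage writes into a fresh slot a copy of some \<open>b k\<close>, up to a small
  error and a scalar, and every \<open>k\<close> is served by infinitely many stages. Later stages
  disturb \<open>B\<close> so little, relative to the square of the scale, that the copy can still
  be read off from the limit \<open>s\<close>. Conversely \<open>s\<close> is a limit of conjugates
  of the \<open>b n\<close>.\<close>

lemma increasing_sequence_bound:
  fixes b :: "nat \<Rightarrow> 'a::cstar_algebra smat"
  assumes b: "\<And>n. psd (b n)" and inc: "\<And>n. cle (b n) (b (Suc n))"
  obtains s where "psd s" and "\<And>n. cle (b n) s"
    and "\<And>e. e > 0 \<Longrightarrow> \<exists>Y n. norm (s - Y * b n * star Y) < e"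
proof -
  \<comment> \<open>\<open>prod_decode\<close> makes every index recur infinitely often; this use of
    the pairing is unrelated to the one in \<open>slot\<close>. The decoded index never exceeds
    \<open>m\<close>, so its element is Cuntz below \<open>b m\<close>.\<close>
  have "\<exists>y. norm (b (fst (prod_decode m)) - y * b m * star y) < (1/2) ^ m" for m
  proof -
    have "fst (prod_decode m) \<le> m"
      by (metis le_prod_encode_1 prod.collapse prod_decode_inverse)
    then show ?thesis
      using cleD[OF cle_chain[of b, OF b inc], of "fst (prod_decode m)" m "(1/2) ^ m"]
      by (meson zero_less_divide_1_iff zero_less_numeral zero_less_power)
  qed
  then obtain y where y: "\<And>m. norm (b (fst (prod_decode m)) - y m * b m * star (y m)) < (1/2) ^ m"
    by metis
  define P where "P n Yl \<longleftrightarrow> 0 < snd Yl \<and> snd Yl \<le> 1 \<and> (\<forall>m. n < m \<longrightarrow> sel (slot m) (fst Yl) = 0)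
    \<and> sel (slot n) (fst Yl) = snd Yl *\<^sub>R y n" for n and Yl :: "'a smat \<times> real"
  \<comment> \<open>The tolerance carries the square of the current scale: reading off a slot
    divides by that square, and the quotient has to stay of order \<open>(1/2) ^ n\<close>.\<close>
  define Q where "Q n Yl Yl' \<longleftrightarrow> snd Yl' \<le> snd Yl
    \<and> norm (fst Yl' * b (Suc n) * star (fst Yl') - fst Yl * b n * star (fst Yl)) \<le> (1/2) ^ n * (snd Yl)\<^sup>2"
    for n and Yl Yl' :: "'a smat \<times> real"
  have start: "\<exists>Yl. P 0 Yl"
    by (rule exI[of _ "(ins (slot 0) (y 0), 1)"])
      (simp add: P_def sel_ins sel_ins_disjoint slot_disjoint)
  have step: "\<exists>Yl'. P (Suc n) Yl' \<and> Q n Yl Yl'" if "P n Yl" for n Yl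
  proof -
    have pos: "(1/2) ^ n * (snd Yl)\<^sup>2 > 0" "snd Yl > 0" "snd Yl \<le> 1"
      and empty: "\<And>m. n < m \<Longrightarrow> sel (slot m) (fst Yl) = 0"
      using that by (auto simp: P_def)
    obtain Y' l' where "0 < l'" "l' \<le> snd Yl" "\<forall>m. Suc n < m \<longrightarrow> sel (slot m) Y' = 0"
      "sel (slot (Suc n)) Y' = l' *\<^sub>R y (Suc n)"
      "norm (Y' * b (Suc n) * star Y' - fst Yl * b n * star (fst Yl)) \<le> (1/2) ^ n * (snd Yl)\<^sup>2"
      using gram_step[OF inc[of n] pos(1,2) empty, where y = "y (Suc n)"] by blast
    then have "P (Suc n) (Y', l') \<and> Q n Yl (Y', l')"
      using pos(3) by (simp add: P_def Q_def)
    then show ?thesis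
      by blast
  qed
  obtain F where F: "\<And>n. P n (F n)" "\<And>n. Q n (F n) (F (Suc n))"
    using dependent_nat_choice[of P Q] start step by blast
  define Y where "Y n = fst (F n)" for n
  define l where "l n = snd (F n)" for n
  define B where "B n = Y n * b n * star (Y n)" for n
  have l: "0 < l n" "l n \<le> 1" and sel_Y: "sel (slot n) (Y n) = l n *\<^sub>R y n" for n
    using F(1)[of n] by (simp_all add: P_def Y_def l_def)
  have decl: "l (Suc n) \<le> l n" and stepB: "norm (B (Suc n) - B n) \<le> (1/2) ^ n * (l n)\<^sup>2" for n
    using F(2)[of n] by (simp_all add: Q_def Y_def l_def B_def)
  have l_mono: "l (m + k) \<le> l m" for m k
    by (induction k) (use decl order_trans in auto)
  have tail: "norm (B (m + k) - B m) \<le> (2 * (1/2) ^ m - 2 * (1/2) ^ (m + k)) * (l m)\<^sup>2" for m k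
  proof (induction k)
    case (Suc k)
    have "norm (B (m + Suc k) - B m) \<le> norm (B (Suc (m + k)) - B (m + k)) + norm (B (m + k) - B m)"
      using norm_triangle_ineq[of "B (Suc (m + k)) - B (m + k)" "B (m + k) - B m"] by simp
    moreover have "(1/2) ^ (m + k) * (l (m + k))\<^sup>2 \<le> (1/2) ^ (m + k) * (l m)\<^sup>2"
      using l_mono[of m k] l(1)[of "m + k"] by (intro mult_left_mono power_mono) auto
    ultimately have "norm (B (m + Suc k) - B m)
        \<le> (1/2) ^ (m + k) * (l m)\<^sup>2 + (2 * (1/2) ^ m - 2 * (1/2) ^ (m + k)) * (l m)\<^sup>2"
      using stepB[of "m + k"] Suc by linarith
    also have "\<dots> = (2 * (1/2) ^ m - 2 * (1/2) ^ (m + Suc k)) * (l m)\<^sup>2"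
      by (simp add: algebra_simps)
    finally show ?case .
  qed simp
  have tail': "norm (B (m + k) - B m) \<le> 2 * (1/2) ^ m * (l m)\<^sup>2" for m k
  proof -
    have "(2 * (1/2) ^ m - 2 * (1/2) ^ (m + k)) * (l m)\<^sup>2 \<le> 2 * (1/2) ^ m * (l m)\<^sup>2"
      by (intro mult_right_mono) auto
    then show ?thesis
      using tail[of m k] by linarith
  qed
  \<comment> \<open>The 3 anticipates the final estimate, where the tail contributes
    \<open>2 * (1/2) ^ m\<close> and the choice of \<open>y m\<close> another
    \<open>(1/2) ^ m\<close>.\<close>
  have half: "(\<lambda>n. 3 * (1/2) ^ n :: real) \<longlonglongrightarrow> 0"
    using tendsto_mult_left[OF LIMSEQ_power_zero[of "1/2 :: real"], of 3] by simp
  have small: "\<exists>N. \<forall>n\<ge>N. 3 * (1/2) ^ n < e" if "e > 0" for e :: real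
    using order_tendstoD(2)[OF half that] unfolding eventually_sequentially .
  have tail1: "norm (B (m + k) - B m) \<le> 2 * (1/2) ^ m" for m k
  proof -
    have "2 * (1/2) ^ m * (l m)\<^sup>2 \<le> 2 * (1/2) ^ m * 1"
      using l[of m] by (intro mult_left_mono power_le_one) auto
    then show ?thesis
      using tail'[of m k] by linarith
  qed
  have "Cauchy B"
  proof (rule CauchyI')
    fix e :: real
    assume "e > 0"
    then obtain N where N: "\<And>n. n \<ge> N \<Longrightarrow> 3 * (1/2) ^ n < e"
      using small by blast
    have "dist (B m) (B n) < e" if "m \<ge> N" "n > m" for m n
    proof -
      have "dist (B m) (B n) \<le> 2 * (1/2) ^ m"
        using tail1[of m "n - m"] that by (simp add: dist_norm norm_minus_commute)
      also have "\<dots> \<le> 3 * (1/2) ^ m"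
        by simp
      finally show ?thesis
        using N[OF \<open>m \<ge> N\<close>] by linarith
    qed
    then show "\<exists>M. \<forall>m\<ge>M. \<forall>n>m. dist (B m) (B n) < e"
      by blast
  qed
  then obtain s where s: "B \<longlonglongrightarrow> s"
    using Cauchy_convergent convergentD by blast
  have psd_B: "psd (B n)" for n
  proof -
    have "B n = star (star (Y n)) * (b n * star (Y n))"
      by (simp add: B_def star_star mult.assoc)
    then show ?thesis
      by (simp only: psd_sandwich[OF b])
  qed
  have psd_s: "psd s"
    by (rule psd_limit[OF psd_B s])
  show thesis
  proof (rule that[OF psd_s])
    show "\<exists>Y n. norm (s - Y * b n * star Y) < e" if pos: "e > 0" for e
    proof -
      obtain n where "norm (B n - s) < e"
        using LIMSEQ_D[OF s pos] by blast
      then show ?thesis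
        unfolding B_def by (metis norm_minus_commute)
    qed
    show "cle (b k) s" for k
    proof (rule cle_limit)
      fix e :: real
      assume "e > 0"
      then obtain N where N: "\<And>n. n \<ge> N \<Longrightarrow> 3 * (1/2) ^ n < e"
        using small by blast
      \<comment> \<open>A stage that serves \<open>k\<close> and is as late as wanted.\<close>
      define m where "m = prod_encode (k, N)"
      have "m \<ge> N"
        by (simp add: m_def le_prod_encode_2)
      have k: "fst (prod_decode m) = k"
        by (simp add: m_def)
      \<comment> \<open>The block of \<open>s\<close> in slot \<open>m\<close> with the scale
        divided out. With \<open>B m\<close> in place of \<open>s\<close> it would be exactly
        \<open>y m * b m * star (y m)\<close>.\<close>
      define c where "c = (1 / (l m)\<^sup>2) *\<^sub>R compress (slot m) s"
      have "norm (s - B m) \<le> 2 * (1/2) ^ m * (l m)\<^sup>2"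
      proof (rule LIMSEQ_le_const2)
        show "(\<lambda>k. norm (B (m + k) - B m)) \<longlonglongrightarrow> norm (s - B m)"
          using LIMSEQ_ignore_initial_segment[OF s, of m]
          by (intro tendsto_intros) (simp add: add.commute)
      qed (use tail' in blast)
      then have "norm (compress (slot m) (s - B m)) \<le> 2 * (1/2) ^ m * (l m)\<^sup>2"
        using norm_compress_le[OF strict_mono_slot] order_trans by blast
      then have "norm ((1 / (l m)\<^sup>2) *\<^sub>R compress (slot m) (s - B m)) \<le> 2 * (1/2) ^ m"
        using l(1)[of m] by (simp add: divide_le_eq)
      moreover have "(1 / (l m)\<^sup>2) *\<^sub>R compress (slot m) (s - B m) = c - y m * b m * star (y m)"
        using l(1)[of m]
        by (simp add: c_def compress_diff scaleR_diff_right B_def compress_sandwich sel_Y star_scaleR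
          power2_eq_square)
      ultimately have "norm (c - y m * b m * star (y m)) \<le> 2 * (1/2) ^ m"
        by simp
      moreover have "norm (b k - y m * b m * star (y m)) < (1/2) ^ m"
        using y[of m] by (simp add: k)
      ultimately have "norm (b k - c) < 3 * (1/2) ^ m"
        using norm_triangle_ineq4[of "b k - y m * b m * star (y m)" "c - y m * b m * star (y m)"] by simp
      then have "norm (b k - c) < e"
        using N[OF \<open>m \<ge> N\<close>] by linarith
      moreover have "cle c s"
        unfolding c_def by (intro cle_scaleR cle_compress psd_s) simp_all
      ultimately show "\<exists>c. norm (b k - c) < e \<and> cle c s"
        by blast
    qed
  qed
qed


section \<open>The Cuntz semigroup\<close>

lemma stab_pos_iff: "a \<in> stab_pos \<longleftrightarrow> (\<exists>x. psd x \<and> a = Rep_smat x)"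
proof
  assume "a \<in> stab_pos"
  then obtain y where "y \<in> stab" "a = mat_mult (mat_star y) y"
    unfolding stab_pos_def by blast
  then have "a = Rep_smat (star (Abs_smat y) * Abs_smat y)"
    by (simp add: Rep_smat_times Rep_smat_star Abs_smat_inverse)
  then show "\<exists>x. psd x \<and> a = Rep_smat x"
    using psd_star_mult_self by blast
next
  assume "\<exists>x. psd x \<and> a = Rep_smat x"
  then obtain y where "a = Rep_smat (star y * y)"
    by (metis psd_obtain)
  then show "a \<in> stab_pos"
    unfolding stab_pos_def by (auto simp: Rep_smat_times Rep_smat_star)
qed

lemma Rep_smat_in_stab_pos: "psd x \<Longrightarrow> Rep_smat x \<in> stab_pos"
  unfolding stab_pos_iff by blast

lemma cuntz_le_Rep_smat: "cuntz_le (Rep_smat a) (Rep_smat b) \<longleftrightarrow> cle a b"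
proof -
  have n: "mat_norm (Rep_smat a - mat_mult (mat_mult (Rep_smat x) (Rep_smat b)) (mat_star (Rep_smat x)))
      = norm (a - x * b * star x)" for x
  proof -
    have "Rep_smat a - mat_mult (mat_mult (Rep_smat x) (Rep_smat b)) (mat_star (Rep_smat x))
        = Rep_smat (a - x * b * star x)"
      by (simp add: fun_eq_iff Rep_smat_minus Rep_smat_times Rep_smat_star)
    then show ?thesis
      by (simp add: norm_smat_def)
  qed
  show ?thesis
  proof
    assume "cuntz_le (Rep_smat a) (Rep_smat b)"
    then obtain x where x: "\<And>n. x n \<in> stab"
      "(\<lambda>n. mat_norm (Rep_smat a - mat_mult (mat_mult (x n) (Rep_smat b)) (mat_star (x n)))) \<longlonglongrightarrow> 0"
      unfolding cuntz_le_def by blast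
    have "(\<lambda>n. norm (a - Abs_smat (x n) * b * star (Abs_smat (x n)))) \<longlonglongrightarrow> 0"
      using x(2) by (simp add: Abs_smat_inverse[OF x(1)] flip: n)
    then have "\<forall>\<^sub>F n in sequentially. norm (a - Abs_smat (x n) * b * star (Abs_smat (x n))) < e"
      if "e > 0" for e
      using that by (rule order_tendstoD(2))
    then show "cle a b"
      unfolding cle_def eventually_sequentially by blast
  next
    assume "cle a b"
    then have "\<exists>x. norm (a - x * b * star x) < 1 / real (Suc n)" for n
      unfolding cle_def by simp
    then obtain x where x: "\<And>n. norm (a - x n * b * star (x n)) < 1 / real (Suc n)"
      by metis
    have "(\<lambda>n. norm (a - x n * b * star (x n))) \<longlonglongrightarrow> 0"
      by (rule Lim_null_comparison[OF always_eventually inverse_Suc_tendsto])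
        (use x in \<open>auto intro: less_imp_le\<close>)
    then show "cuntz_le (Rep_smat a) (Rep_smat b)"
      unfolding cuntz_le_def by (intro exI[of _ "\<lambda>n. Rep_smat (x n)"]) (simp add: n)
  qed
qed

lemma equiv_cuntz_rel: "equiv (stab_pos :: 'a::cstar_algebra mat set) cuntz_rel"
proof (rule equivI)
  show "cuntz_rel \<subseteq> stab_pos \<times> (stab_pos :: 'a mat set)"
    by (auto simp: cuntz_rel_def)
  show "refl_on (stab_pos :: 'a mat set) cuntz_rel"
    by (rule refl_onI) (auto simp: cuntz_rel_def stab_pos_iff cuntz_le_Rep_smat cle_refl)
  show "sym (cuntz_rel :: ('a mat \<times> 'a mat) set)"
    by (rule symI) (auto simp: cuntz_rel_def)
  show "trans (cuntz_rel :: ('a mat \<times> 'a mat) set)"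
    by (rule transI)
      (auto simp: cuntz_rel_def stab_pos_iff cuntz_le_Rep_smat intro: cle_trans)
qed

definition crep :: "'a::cstar_algebra cu \<Rightarrow> 'a smat" where
  "crep x = Abs_smat (cu_rep x)"

lemma cu_rep_in: "cu_rep x \<in> Rep_cu x"
proof -
  have "Rep_cu x \<noteq> {}"
    using in_quotient_imp_non_empty[OF equiv_cuntz_rel Rep_cu] .
  then show ?thesis
    unfolding cu_rep_def by (simp add: some_in_eq)
qed

lemma cu_rep_stab_pos: "cu_rep x \<in> stab_pos"
  using cu_rep_in[of x] Rep_cu[of x] in_quotient_imp_subset[OF equiv_cuntz_rel] by blast

lemma crep: "psd (crep x)" "Rep_smat (crep x) = cu_rep x"
proof -
  obtain a where "psd a" "cu_rep x = Rep_smat a"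
    using cu_rep_stab_pos[of x] unfolding stab_pos_iff by blast
  then show "psd (crep x)" "Rep_smat (crep x) = cu_rep x"
    by (simp_all add: crep_def Rep_smat_inverse)
qed

lemma cu_le_iff: "x \<le> y \<longleftrightarrow> cle (crep x) (crep y)"
  unfolding less_eq_cu_def by (simp flip: crep(2) add: cuntz_le_Rep_smat)

definition cu_of :: "'a::cstar_algebra smat \<Rightarrow> 'a cu" where
  "cu_of a = cu_class (Rep_smat a)"

lemma crep_cu_of:
  assumes "psd a"
  shows "cle a (crep (cu_of a))" and "cle (crep (cu_of a)) a"
proof -
  have "Rep_cu (cu_of a) = cuntz_rel `` {Rep_smat a}"
    unfolding cu_of_def cu_class_def
    by (rule Abs_cu_inverse) (intro quotientI Rep_smat_in_stab_pos assms)
  then have "(Rep_smat a, cu_rep (cu_of a)) \<in> cuntz_rel"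
    using cu_rep_in[of "cu_of a"] by simp
  then show "cle a (crep (cu_of a))" "cle (crep (cu_of a)) a"
    by (simp_all add: cuntz_rel_def cuntz_le_Rep_smat flip: crep(2))
qed

lemma cu_le_cu_of: "psd a \<Longrightarrow> x \<le> cu_of a \<longleftrightarrow> cle (crep x) a"
  and cu_of_le: "psd a \<Longrightarrow> cu_of a \<le> x \<longleftrightarrow> cle a (crep x)"
  unfolding cu_le_iff using crep_cu_of cle_trans by blast+

lemma mat_diag_Rep_smat: "mat_diag (Rep_smat a) (Rep_smat b) = Rep_smat (sdiag a b)"
proof (intro ext)
  fix i j
  have ev: "i \<in> range ev \<longleftrightarrow> even i" "even i \<Longrightarrow> inv ev i = i div 2" for i
    by (auto simp: ev_def elim!: evenE intro!: inv_f_eq injI)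
  have od: "i \<in> range od \<longleftrightarrow> odd i" "odd i \<Longrightarrow> inv od i = i div 2" for i
    by (auto simp: od_def elim!: oddE intro!: inv_f_eq injI)
  show "mat_diag (Rep_smat a) (Rep_smat b) i j = Rep_smat (sdiag a b) i j"
    by (simp add: mat_diag_def sdiag_def Rep_smat_plus Rep_smat_ins Rep_smat_star mat_star_def
      ev od star_star)
qed

lemma plus_cu: "x + y = cu_of (sdiag (crep x) (crep y))"
  unfolding plus_cu_def cu_of_def by (simp flip: crep(2) add: mat_diag_Rep_smat)

text \<open>The class \<open>y\<close> is the supremum of the classes of the cut-downs of
  \<open>crep y\<close> by \<open>1 / Suc n\<close>, so the way-below relation is tested on this
  sequence.\<close>

lemma way_below_cut_down:
  fixes x y :: "'a::cstar_algebra cu"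
  assumes "x \<lless> y"
  obtains e where "e > 0" and "cle (crep x) (cut_down (crep y) e)"
proof -
  define b where "b n = cut_down (crep y) (1 / real (Suc n))" for n
  have b: "psd (b n)" for n
    unfolding b_def by (intro psd_cut_down crep) simp
  have "cle (b n) (b (Suc n))" for n
    unfolding b_def by (intro cle_cut_down_cut_down crep) (simp_all add: frac_le)
  then have inc: "cu_of (b n) \<le> cu_of (b (Suc n))" for n
    using b crep_cu_of cle_trans by (metis cu_of_le)
  have lub: "isLub UNIV (range (\<lambda>n. cu_of (b n))) y"
  proof (rule isLubI2)
    show "isUb UNIV (range (\<lambda>n. cu_of (b n))) y"
    proof (rule isUbI)
      have "cle (b n) (crep y)" for n
        unfolding b_def by (rule cle_cut_down) (simp_all add: crep)
      then show "range (\<lambda>n. cu_of (b n)) *<= y"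
        by (auto simp: setle_def cu_of_le b)
    qed simp
    show "y <=* Collect (isUb UNIV (range (\<lambda>n. cu_of (b n))))"
    proof (intro setgeI ballI)
      fix t
      assume "t \<in> Collect (isUb UNIV (range (\<lambda>n. cu_of (b n))))"
      then have "cu_of (b n) \<le> t" for n
        by (auto simp: isUb_def setle_def)
      then have "cle (b n) (crep t)" for n
        by (simp add: cu_of_le b)
      then show "y \<le> t"
        unfolding cu_le_iff b_def by (rule cle_if_cut_downs[OF crep(1)])
    qed
  qed
  have "y \<le> y"
    by (simp add: cu_le_iff cle_refl crep)
  then obtain n where "x \<le> cu_of (b n)"
    using assms[unfolded way_below_def, rule_format, of "\<lambda>n. cu_of (b n)" y] inc lub by blast
  then have "cle (crep x) (b n)"
    by (simp add: cu_le_cu_of b)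
  then show thesis
    unfolding b_def by (intro that[of "1 / real (Suc n)"]) simp_all
qed

text \<open>A supremum \<open>s\<close> lies below every upper bound, in particular below the class
  of the concrete bound \<open>t\<close>. Then \<open>a\<close> is close to a conjugate of
  \<open>t\<close>, hence to a conjugate of some \<open>crep (z n)\<close>, and that conjugate
  dominates \<open>crep x\<close> by assumption.\<close>

lemma way_belowI:
  fixes x y :: "'a::cstar_algebra cu"
  assumes a: "psd a" and le: "cle a (crep y)" and "e > 0"
    and x: "\<And>b. psd b \<Longrightarrow> norm (a - b) < e \<Longrightarrow> cle (crep x) b"
  shows "x \<lless> y"
  unfolding way_below_def
proof (intro allI impI)
  fix z :: "nat \<Rightarrow> 'a cu" and s
  assume as: "(\<forall>n. z n \<le> z (Suc n)) \<and> isLub UNIV (range z) s \<and> y \<le> s"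
  obtain t where t: "psd t" "\<And>n. cle (crep (z n)) t"
    "\<And>e. e > 0 \<Longrightarrow> \<exists>Y n. norm (t - Y * crep (z n) * star Y) < e"
    using increasing_sequence_bound[of "\<lambda>n. crep (z n)"] as by (auto simp: crep cu_le_iff)
  have "isUb UNIV (range z) (cu_of t)"
    by (auto simp: isUb_def setle_def cu_le_cu_of t)
  then have "s \<le> cu_of t"
    using as by (auto simp: isLub_def leastP_def setge_def)
  then have "cle a t"
    using as le cle_trans t(1) by (metis cu_le_iff cu_le_cu_of)
  then obtain r where r: "norm (a - r * t * star r) < e/2"
    using cleD[of a t "e/2"] \<open>e > 0\<close> by auto
  define K where "K = norm r * norm r + 1"
  have "K > 0"
    by (simp add: K_def add_nonneg_pos)
  then obtain Y n where Y: "norm (t - Y * crep (z n) * star Y) < e / (2 * K)"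
    using t(3)[of "e / (2 * K)"] \<open>e > 0\<close> by auto
  let ?b = "(r * Y) * crep (z n) * star (r * Y)"
  have "norm (r * (t - Y * crep (z n) * star Y) * star r) \<le> norm r * norm r * norm (t - Y * crep (z n) * star Y)"
    by (rule norm_sandwich_le)
  also have "\<dots> \<le> K * (e / (2 * K))"
    using Y \<open>K > 0\<close> by (intro mult_mono) (auto simp: K_def)
  also have "\<dots> = e/2"
    using \<open>K > 0\<close> by simp
  finally have "norm (r * t * star r - ?b) \<le> e/2"
    by (simp add: star_mult algebra_simps)
  then have "norm (a - ?b) < e"
    using r norm_triangle_ineq[of "a - r * t * star r" "r * t * star r - ?b"] by simp
  moreover have "psd ?b"
    using psd_sandwich[OF crep(1), of "star (r * Y)" "z n"] by (simp add: star_star mult.assoc)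
  ultimately have "cle (crep x) ?b"
    by (rule x[rotated])
  then have "x \<le> z n"
    unfolding cu_le_iff using cle_conj cle_trans by blast
  then show "\<exists>n. x \<le> z n" ..
qed

text \<open>
  An element between \<open>x'\<close> and \<open>x\<close> of the exact form \<open>z w z\<^sup>*\<close>: take \<open>r a\<^sup>3 r\<^sup>*\<close> close to \<open>a\<close> and replace the
  middle factor by some \<open>s w s\<^sup>*\<close> close to it.
\<close>

lemma way_below_interpolation:
  fixes x' x w :: "'a::cstar_algebra cu"
  assumes wb: "x' \<lless> x" and le: "x \<le> w"
  obtains z e where "e > 0" and "cle (z * crep w * star z) (crep x)"
    and "\<And>b. psd b \<Longrightarrow> norm (z * crep w * star z - b) < e \<Longrightarrow> cle (crep x') b"
proof -
  let ?a = "crep x" and ?c = "crep w"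
  have sa: "star ?a = ?a"
    by (rule psd_star[OF crep(1)])
  obtain d where "d > 0" and d: "cle (crep x') (cut_down ?a d)"
    using way_below_cut_down[OF wb] by blast
  \<comment> \<open>The chain \<open>a \<precsim> a^2 \<precsim> a^4 \<precsim> a^3\<close>: a cube
    offers one \<open>a\<close> on either side of a middle factor that can be exchanged.\<close>
  have "cle (?a * ?a) ((?a * ?a) * (?a * ?a))"
    by (intro cle_square psd_square sa)
  moreover have "cle ((?a * ?a) * (?a * ?a)) (?a * ?a * ?a)"
  proof -
    obtain h where h: "star h = h" "?a = h * h"
      using crep(1)[of x] by (auto simp: psd_def)
    have "(?a * ?a) * (?a * ?a) = h * (?a * ?a * ?a) * star h"
      unfolding h by (simp add: mult.assoc h(1))
    then show ?thesis
      using cle_conj by metis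
  qed
  ultimately have "cle ?a (?a * ?a * ?a)"
    using cle_square[OF crep(1)] cle_trans by blast
  then obtain r where r: "norm (?a - r * (?a * ?a * ?a) * star r) < d/4"
    using cleD[of ?a _ "d/4"] \<open>d > 0\<close> by auto
  define K where "K = norm (r * ?a) * norm (r * ?a) + 1"
  have "K > 0"
    by (simp add: K_def add_nonneg_pos)
  then obtain s where s: "norm (?a - s * ?c * star s) < d / (4 * K)"
    using cleD[of ?a ?c "d / (4 * K)"] le \<open>d > 0\<close> by (auto simp: cu_le_iff)
  \<comment> \<open>The factor \<open>?a\<close> inside \<open>z\<close> is what keeps the conjugate
    below \<open>?a\<close>. Of the distance \<open>d\<close> granted by the cut-down, two quarters
    are spent on the approximation and one half remains as the radius of the ball.\<close>
  define z where "z = r * ?a * s"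
  have "norm ((r * ?a) * (?a - s * ?c * star s) * star (r * ?a))
      \<le> norm (r * ?a) * norm (r * ?a) * norm (?a - s * ?c * star s)"
    by (rule norm_sandwich_le)
  also have "\<dots> \<le> K * (d / (4 * K))"
    using s \<open>K > 0\<close> by (intro mult_mono) (auto simp: K_def)
  also have "\<dots> = d/4"
    using \<open>K > 0\<close> by simp
  finally have "norm (r * (?a * ?a * ?a) * star r - z * ?c * star z) \<le> d/4"
    by (simp add: z_def star_mult sa algebra_simps)
  then have close: "norm (?a - z * ?c * star z) < d/2"
    using r norm_triangle_ineq[of "?a - r * (?a * ?a * ?a) * star r" "r * (?a * ?a * ?a) * star r - z * ?c * star z"]
    by simp
  show thesis
  proof (rule that[of "d/2" z])
    show "d/2 > 0"
      using \<open>d > 0\<close> by simp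
    show "cle (crep x') b" if "psd b" "norm (z * ?c * star z - b) < d/2" for b
    proof -
      have "norm (?a - b) \<le> d"
        using close that(2) norm_triangle_ineq[of "?a - z * ?c * star z" "z * ?c * star z - b"] by simp
      then show ?thesis
        using cle_cut_down[OF crep(1) that(1)] d cle_trans by blast
    qed
    obtain h where h: "star h = h" "?c = h * h"
      using crep(1)[of w] by (auto simp: psd_def)
    \<comment> \<open>With \<open>q = ?a * v\<close>, exchanging \<open>q * star q\<close> for
      \<open>star q * q\<close> brings \<open>?a * ?a\<close> into the middle, whose conjugates are
      Cuntz below \<open>?a\<close>.\<close>
    define v where "v = s * h"
    have "z * ?c * star z = r * ((?a * v) * star (?a * v)) * star r"
      by (simp add: z_def v_def h star_mult sa mult.assoc)
    then have "cle (z * ?c * star z) ((?a * v) * star (?a * v))"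
      using cle_conj by metis
    moreover have "star (?a * v) * (?a * v) = star v * (?a * ?a) * star (star v)"
      by (simp add: star_mult sa star_star mult.assoc)
    then have "cle ((?a * v) * star (?a * v)) (?a * ?a)"
      using cle_commute[of "?a * v"] cle_conj cle_trans by metis
    ultimately show "cle (z * ?c * star z) ?a"
      using cle_psd_square_le[OF crep(1)] cle_trans by blast
  qed
qed

theorem proposition2p2:
  fixes x1' x1 x2' x2 w :: "'a::cstar_algebra cu"
  assumes "x1' \<lless> x1" and "x1 \<le> w"
    and "x2' \<lless> x2" and "x2 \<le> w"
  shows "\<exists>x :: 'a cu. x1' \<lless> x \<and> x2' \<lless> x \<and> x \<le> w \<and> x \<le> x1 + x2"
proof -
  let ?c = "crep w"
  obtain z1 e1 where "e1 > 0" and le1: "cle (z1 * ?c * star z1) (crep x1)"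
    and wb1: "\<And>b. psd b \<Longrightarrow> norm (z1 * ?c * star z1 - b) < e1 \<Longrightarrow> cle (crep x1') b"
    using way_below_interpolation[OF assms(1,2)] by blast
  obtain z2 e2 where "e2 > 0" and le2: "cle (z2 * ?c * star z2) (crep x2)"
    and wb2: "\<And>b. psd b \<Longrightarrow> norm (z2 * ?c * star z2 - b) < e2 \<Longrightarrow> cle (crep x2') b"
    using way_below_interpolation[OF assms(3,4)] by blast
  obtain h where h: "star h = h" "?c = h * h"
    using crep(1)[of w] by (auto simp: psd_def)
  define W where "W = column z1 z2"
  define m where "m = W * ?c * star W"
  have m: "m = (W * h) * star (W * h)"
    by (simp add: m_def h star_mult mult.assoc)
  have psd_m: "psd m"
    unfolding m by (rule psd_mult_star)
  have sel: "sel ev (W * h) = z1 * h" "sel od (W * h) = z2 * h"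
    by (simp_all add: W_def lmult_mult[OF sel_ev_od(1)] lmult_mult[OF sel_ev_od(2)] sel_column)
  have z: "z1 * ?c * star z1 = (z1 * h) * star (z1 * h)" "z2 * ?c * star z2 = (z2 * h) * star (z2 * h)"
    by (simp_all add: h star_mult mult.assoc)
  have "cle (z1 * ?c * star z1) m" "cle (z2 * ?c * star z2) m"
    using cle_lmult[OF sel_ev_od(1), of "W * h"] cle_lmult[OF sel_ev_od(2), of "W * h"]
    by (simp_all only: sel z m)
  moreover have "psd (z1 * ?c * star z1)" "psd (z2 * ?c * star z2)"
    unfolding z by (rule psd_mult_star)+
  \<comment> \<open>The ball in \<open>way_belowI\<close> is centred at a block, while the class on
    the right is that of the whole matrix \<open>m\<close>, which dominates the block.\<close>
  ultimately have "x1' \<lless> cu_of m" "x2' \<lless> cu_of m"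
    using way_belowI[OF _ _ \<open>e1 > 0\<close> wb1] way_belowI[OF _ _ \<open>e2 > 0\<close> wb2]
      crep_cu_of(1)[OF psd_m] cle_trans by blast+
  moreover have "cle m ?c"
    unfolding m_def by (rule cle_conj)
  then have "cu_of m \<le> w"
    by (simp add: cu_of_le psd_m)
  moreover have "cu_of m \<le> x1 + x2"
  proof -
    \<comment> \<open>Exchanging outer for inner square turns the column into a sum, so that the
      unknown off-diagonal blocks disappear.\<close>
    have "cle m (star (W * h) * (W * h))"
      unfolding m by (rule cle_commute)
    also have "star (W * h) * (W * h) = star h * (star W * W) * h"
      by (simp add: star_mult mult.assoc)
    also have "\<dots> = star (z1 * h) * (z1 * h) + star (z2 * h) * (z2 * h)"
      by (simp add: W_def star_column_column star_mult distrib_left distrib_right mult.assoc)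
    finally have "cle m (star (z1 * h) * (z1 * h) + star (z2 * h) * (z2 * h))" .
    \<comment> \<open>Each summand is exchanged back separately, into the block
      \<open>z1 * ?c * star z1\<close> or \<open>z2 * ?c * star z2\<close>.\<close>
    moreover have "cle (star (z1 * h) * (z1 * h)) (crep x1)" "cle (star (z2 * h) * (z2 * h)) (crep x2)"
      using cle_commute' le1 le2 cle_trans unfolding z by blast+
    then have "cle (star (z1 * h) * (z1 * h) + star (z2 * h) * (z2 * h)) (sdiag (crep x1) (crep x2))"
      by (intro cle_add_sdiag crep)
    ultimately have "cle m (sdiag (crep x1) (crep x2))"
      using cle_trans by blast
    then show ?thesis
      unfolding plus_cu cu_of_le[OF psd_m]
      using crep_cu_of(1)[OF psd_sdiag[OF crep(1) crep(1)]] cle_trans by blast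
  qed
  ultimately show ?thesis
    by blast
qed

end
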